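(* Suppose that $F\in\mathcal{S}^*(1)$, with functional equation $$\epsilon^2 Q^s\,\Gamma\!\left(\tfrac{s}{2}+\mu\right)F(s)=Q^{1-s}\,\Gamma\!\left(\tfrac{1-s}{2}+\overline{\mu}\right)\overline{F}(1-s),$$ and let $q=\pi Q^2$. Then $q$ is a positive integer and there exist a primitive Dirichlet character $\chi$ mod $q$ and a real number $\alpha$ such that $F(s)=L(s+i\alpha,\chi)$.
   Context: Write $\sigma=\Re s$, and for a function $F$ put $\overline{F}(s)=\overline{F(\overline{s})}$. For a non-negative integer $d$, $\mathcal{S}^*(d)$ is the set of Dirichlet series $F(s)=\sum_{n=1}^{\infty} a_n n^{-s}$ satisfying: (1) Analyticity: $(s-1)^mF(s)$ is (continues to) an entire function of finite order for some non-negative integer $m$. (2) Ramanujan hypothesis: $a_n\ll_\epsilon n^{\epsilon}$ for any fixed $\epsilon>0$. (3) Functional equation: there are $\epsilon$ with $|\epsilon|=1$, $Q>0$, and $\mu_1,\dots,\mu_d\in\mathbb{C}$ with $\Re\mu_i\ge 0$ such that $$\epsilon^2Q^s\prod_{i=1}^{d}\Gamma(s/2+\mu_i)F(s)=Q^{1-s}\prod_{i=1}^{d}\Gamma((1-s)/2+\overline{\mu_i})\,\overline{F}(1-s).$$ (4) Euler product: $a_1=1$ and $\log F(s)=\sum_{n=1}^{\infty} b_n n^{-s}$ (for $\sigma>1$), where $b_n=0$ unless $n$ is a positive power of a prime, and $b_n\ll n^{\theta}$ for some $\theta<1/2$. Here $L(s,\chi)$ is the Dirichlet $L$-function; for $q=1$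 the primitive character is the trivial one and $L(s,\chi)=\zeta(s)$. *)

theory Defs
  imports
    "HOL-Complex_Analysis.Complex_Analysis"
    "HOL-Number_Theory.Number_Theory"
    "HOL-Library.Landau_Symbols"
begin

text \<open>
  \<open>F\<close> is the meromorphic continuation to the whole plane of the Dirichlet series with coefficients
  \<open>a 1, a 2, \<dots>\<close>, which converges to \<open>F\<close> in the half-plane \<open>Re s > 1\<close>; \<open>a 0\<close> plays no role. That
  \<open>F\<close> is nicely meromorphic normalises its values as a total function: removable singularities
  are removed, and the value at a pole is \<open>0\<close>.
\<close>
definition continues_dirichlet_series :: "(complex \<Rightarrow> complex) \<Rightarrow> (nat \<Rightarrow> complex) \<Rightarrow> bool" where
  "continues_dirichlet_series F a \<longleftrightarrow>
     F nicely_meromorphic_on UNIV \<and>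
     (\<forall>s. Re s > 1 \<longrightarrow> (\<lambda>n. a (Suc n) * of_nat (Suc n) powr (- s)) sums F s)"

lemma continues_dirichlet_series_unique:
  assumes "continues_dirichlet_series F a" "continues_dirichlet_series G a"
  shows "F = G"
proof
  fix z
  have F: "F nicely_meromorphic_on UNIV" and G: "G nicely_meromorphic_on UNIV"
    using assms by (auto simp: continues_dirichlet_series_def)
  have eq: "F s = G s" if "Re s > 1" for s
    using assms that by (auto simp: continues_dirichlet_series_def intro: sums_unique2)
  define h where "h = (\<lambda>s. F s - G s)"
  have h: "h meromorphic_on UNIV"
    using F G by (auto simp: h_def nicely_meromorphic_on_def intro!: meromorphic_intros)
  have ev: "\<forall>\<^sub>F w in at u. remove_sings h w = h w" for u
    by (rule eventually_remove_sings_eq_at) (metis h UNIV_I meromorphic_on_altdef)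
  have "\<forall>\<^sub>F w in at (2::complex). h w = 0"
  proof -
    have "open {s. Re s > 1}" by (simp add: open_halfspace_Re_gt)
    then have "\<forall>\<^sub>F w in at (2::complex). w \<in> {s. Re s > 1}"
      by (rule eventually_at_in_open') auto
    then show ?thesis by eventually_elim (auto simp: h_def eq)
  qed
  with ev[of 2] have "\<forall>\<^sub>F w in at (2::complex). remove_sings h w = 0"
    by eventually_elim auto
  then have "\<exists>\<^sub>F w in at (2::complex). remove_sings h w = 0"
    by (rule eventually_frequently[rotated]) simp
  then have h0: "remove_sings h w = 0" for w
    using frequently_eq_meromorphic_imp_constant[of "remove_sings h" 0 2 UNIV w]
      remove_sings_nicely_meromorphic[OF h] by auto
  have near: "\<forall>\<^sub>F w in at z. F w = G w"
    using ev[of z] unfolding h0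
    by eventually_elim (simp add: h_def)
  show "F z = G z"
  proof (cases "is_pole F z")
    case True
    with near have "is_pole G z" using is_pole_cong by blast
    have "f z = 0" if "f nicely_meromorphic_on UNIV" "is_pole f z" for f :: "complex \<Rightarrow> complex"
      using that not_tendsto_and_filterlim_at_infinity[of "at z" f "f z"]
      by (auto simp: nicely_meromorphic_on_def is_pole_def)
    from this[OF F True] this[OF G \<open>is_pole G z\<close>] show ?thesis by simp
  next
    case False
    then have "\<not> is_pole G z" using near is_pole_cong by blast
    with False F G have "F \<midarrow>z\<rightarrow> F z" "G \<midarrow>z\<rightarrow> G z"
      by (auto simp: nicely_meromorphic_on_def)
    moreover from this(1) near have "G \<midarrow>z\<rightarrow> F z"
      using tendsto_cong by blast
    ultimately show ?thesis using LIM_unique by blast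
  qed
qed

definition dirichlet_character :: "nat \<Rightarrow> (nat \<Rightarrow> complex) \<Rightarrow> bool" where
  "dirichlet_character q chi \<longleftrightarrow>
     q > 0 \<and> chi 1 = 1 \<and>
     (\<forall>m n. chi (m * n) = chi m * chi n) \<and>
     (\<forall>n. chi (n + q) = chi n) \<and>
     (\<forall>n. chi n \<noteq> 0 \<longleftrightarrow> coprime n q)"

text \<open>A character is primitive if no character to a proper divisor of the modulus induces it.\<close>
definition primitive_character :: "nat \<Rightarrow> (nat \<Rightarrow> complex) \<Rightarrow> bool" where
  "primitive_character q chi \<longleftrightarrow>
     dirichlet_character q chi \<and>
     \<not> (\<exists>d psi. d dvd q \<and> d < q \<and> dirichlet_character d psi \<and>
              (\<forall>n. coprime n q \<longrightarrow> chi n = psi n))"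

text \<open>
  \<open>L(s, chi)\<close> on the whole plane. The continuation is unique by
  \<open>continues_dirichlet_series_unique\<close> and classically exists for every character; its value at the
  pole \<open>s = 1\<close> of a principal character is \<open>0\<close> by convention.
\<close>
definition dirichlet_L :: "(nat \<Rightarrow> complex) \<Rightarrow> complex \<Rightarrow> complex" where
  "dirichlet_L chi = (THE L. continues_dirichlet_series L chi)"

definition entire_of_finite_order :: "(complex \<Rightarrow> complex) \<Rightarrow> bool" where
  "entire_of_finite_order g \<longleftrightarrow>
     g holomorphic_on UNIV \<and>
     (\<exists>\<rho>::real. (\<lambda>z. norm (g z)) \<in> O[at_infinity](\<lambda>z. exp (norm z powr \<rho>)))"

text \<open>
  The functional equation is an identity of meromorphic functions, so it is asserted away from the
  possible poles of \<open>F\<close>, of its reflection and of the Gamma factors, where HOL assigns junk values.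
  The list \<open>\<mu>s\<close> contains \<open>\<mu>\<^sub>1, \<dots>, \<mu>\<^sub>d\<close>.
\<close>
definition functional_equation ::
  "complex \<Rightarrow> real \<Rightarrow> complex list \<Rightarrow> (complex \<Rightarrow> complex) \<Rightarrow> bool" where
  "functional_equation \<epsilon> Q \<mu>s F \<longleftrightarrow>
     norm \<epsilon> = 1 \<and> Q > 0 \<and> (\<forall>\<mu>\<in>set \<mu>s. Re \<mu> \<ge> 0) \<and>
     (\<forall>s. s \<noteq> 0 \<longrightarrow> s \<noteq> 1 \<longrightarrow>
        (\<forall>\<mu>\<in>set \<mu>s. s / 2 + \<mu> \<notin> \<int>\<^sub>\<le>\<^sub>0 \<and> (1 - s) / 2 + cnj \<mu> \<notin> \<int>\<^sub>\<le>\<^sub>0) \<longrightarrow>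
        \<epsilon>\<^sup>2 * of_real Q powr s * (\<Prod>\<mu>\<leftarrow>\<mu>s. Gamma (s / 2 + \<mu>)) * F s =
        of_real Q powr (1 - s) * (\<Prod>\<mu>\<leftarrow>\<mu>s. Gamma ((1 - s) / 2 + cnj \<mu>)) * cnj (F (cnj (1 - s))))"

text \<open>
  In the Euler product, \<open>log F\<close> denotes the branch given by the series
  \<open>\<Sum> b\<^sub>n n\<^sup>-\<^sup>s\<close>, which need not be the principal one: its sum \<open>l\<close> satisfies \<open>exp l = F s\<close>.
\<close>
definition S_star :: "nat \<Rightarrow> (complex \<Rightarrow> complex) set" where
  "S_star d = {F. \<exists>a.
     continues_dirichlet_series F a \<and>
     (\<exists>m::nat. \<exists>g. entire_of_finite_order g \<and> (\<forall>s. s \<noteq> 1 \<longrightarrow> g s = (s - 1) ^ m * F s)) \<and>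
     (\<forall>\<delta>>0::real. (\<lambda>n. norm (a n)) \<in> O(\<lambda>n. real n powr \<delta>)) \<and>
     (\<exists>\<epsilon> Q \<mu>s. length \<mu>s = d \<and> functional_equation \<epsilon> Q \<mu>s F) \<and>
     a 1 = 1 \<and>
     (\<exists>b. (\<forall>n. b n \<noteq> 0 \<longrightarrow> primepow n) \<and>
          (\<exists>\<theta><1/2. (\<lambda>n. norm (b n)) \<in> O(\<lambda>n. real n powr \<theta>)) \<and>
          (\<forall>s. Re s > 1 \<longrightarrow>
             (\<exists>l. (\<lambda>n. b (Suc n) * of_nat (Suc n) powr (- s)) sums l \<and> exp l = F s)))}"

end

theory Submission
  imports
    Defs
    "HOL-Computational_Algebra.Fundamental_Theorem_Algebra"
    "HOL-Probability.Sinc_Integral"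
    "HOL-Real_Asymp.Real_Asymp"
begin

text \<open>
  Translating \<open>F\<close> by \<open>2 i Im \<mu>\<close> makes the shift \<open>\<mu>\<close> in the Gamma factor real. Integrate
  \<open>F(s) \<Gamma>(s/2 + \<mu>) \<Gamma>(1 + \<mu> - s/2) y\<^sup>s\<close> over vertical lines. On the right, expanding \<open>F\<close> gives
  \<open>S(y) = \<Sum> a\<^sub>n n\<^bsup>2\<mu>\<^esup> (n\<^sup>2 + y\<^sup>2)\<^bsup>-2\<mu>-1\<^esup>\<close>; on the left, the functional equation and the duplication formula
  turn the integrand into a single Gamma factor and give \<open>E(y) = \<Sum> cnj a\<^sub>n n\<^bsup>2\<mu>\<^esup> exp (-2 n y / Q\<^sup>2)\<close>.
  Hence \<open>y S(y)\<close> is a multiple of \<open>E(y)\<close> up to a function that is holomorphic on the slit plane.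
  As \<open>y \<rightarrow> i v\<close> with \<open>v > 0\<close>, the left side has a singularity of size \<open>a\<^sub>v\<close> if \<open>v\<close> is an integer and none
  otherwise, whereas \<open>E\<close> has period \<open>i \<pi> Q\<^sup>2\<close>. So \<open>q = \<pi> Q\<^sup>2\<close> is an integer and \<open>a\<close> has period \<open>q\<close>;
  comparing the sizes of the singularities shows that \<open>a\<close> is proportional to its conjugate Fourier
  transform modulo \<open>q\<close>.

  Being periodic and multiplicative, \<open>a\<close> is a character on the residues prime to \<open>q\<close>. If it did not vanish
  at some power of a prime \<open>p\<close> dividing \<open>q\<close>, self-duality and Parseval would make the last coefficient of
  its Euler factor at \<open>p\<close> so large that this factor had a zero \<open>z\<close> with \<open>|z| \<le> p\<^bsup>-1/2\<^esup>\<close>, contrary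
  to \<open>b\<^sub>n \<lless> n\<^sup>\<theta>\<close> with \<open>\<theta> < 1/2\<close>. So \<open>a\<close> vanishes off the residues prime to \<open>q\<close>, and self-duality makes
  it primitive.
\<close>

section \<open>Periodic multiplicative functions\<close>

text \<open>Moving the line of integration from \<open>Re s = 3/2\<close> to
  \<open>Re s = -1/2\<close> would normally require residues of \<open>F\<close> and of the Gamma
  factors and the asymptotics of the Gamma function. Both are avoided. The two lines are compared
  only above a fixed height that exceeds the height of every singularity. What remains below that
  height, closed by two horizontal segments, consists of integrals of \<open>y powr s\<close> over
  compact sets. Their sum is holomorphic on the whole slit plane, whatever lies inside the contour.
  The numerical constants stay unknown throughout: transforms are found up to a constant of
  integration, and the singular part at \<open>i v\<close> carries the same factor for every
  \<open>v\<close>. Comparison with \<open>v = 1\<close>, where the coefficient is 1, removes them.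
  A real shift \<open>\<mu>\<close> equals its conjugate. The reflected factor
  \<open>Gamma ((1 - s) / 2 + \<mu>)\<close> and the auxiliary factor of the kernel then differ by
  exactly 1/2 in their arguments, as the duplication formula demands.\<close>

definition unity_root :: "nat \<Rightarrow> nat \<Rightarrow> complex" where
  "unity_root q k = cis (2 * pi * real k / real q)"

lemma unity_root_0 [simp]: "unity_root q 0 = 1"
  by (simp add: unity_root_def)

lemma unity_root_add: "unity_root q (j + k) = unity_root q j * unity_root q k"
  by (simp add: unity_root_def cis_mult add_divide_distrib algebra_simps)

lemma unity_root_power: "unity_root q (j * k) = unity_root q j ^ k"
proof -
  have "2 * pi * real (j * k) / real q = real k * (2 * pi * real j / real q)"
    by simp
  then show ?thesis
    by (simp only: unity_root_def Complex.DeMoivre)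
qed

lemma unity_root_cancel: "N > 0 \<Longrightarrow> unity_root (M * N) (N * k) = unity_root M k"
  by (simp add: unity_root_def field_simps)

lemma unity_root_self [simp]: "q > 0 \<Longrightarrow> unity_root q q = 1"
  by (simp add: unity_root_def)

lemma unity_root_eq_1_iff:
  assumes "q > 0"
  shows "unity_root q k = 1 \<longleftrightarrow> q dvd k"
proof
  assume "unity_root q k = 1"
  then have "cos (2 * pi * real k / real q) = 1"
    by (simp add: unity_root_def complex_eq_iff)
  then obtain n :: int where "2 * pi * real k / real q = of_int n * 2 * pi"
    by (auto simp: cos_one_2pi_int)
  then have "real k = of_int n * real q"
    using assms by (simp add: field_simps)
  then have "int k = n * int q"
    by (metis of_int_eq_iff of_int_mult of_int_of_nat_eq)
  then show "q dvd k"
    by (metis dvd_triv_right int_dvd_int_iff)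
next
  assume "q dvd k"
  then show "unity_root q k = 1"
    using assms by (auto simp: unity_root_power elim!: dvdE)
qed

lemma unity_root_cong:
  assumes "q > 0" "[j = k] (mod q)"
  shows "unity_root q j = unity_root q k"
proof -
  have "unity_root q n = unity_root q (n mod q)" for n
    using unity_root_add[of q "q * (n div q)" "n mod q"] assms(1)
    by (simp add: unity_root_power)
  with assms(2) show ?thesis
    unfolding cong_def by metis
qed

lemma sum_unity_root:
  assumes "q > 0"
  shows "(\<Sum>m<q. unity_root q (k * m)) = (if q dvd k then of_nat q else 0)"
proof (cases "q dvd k")
  case True
  then have "unity_root q (k * m) = 1" for m
    using assms by (simp add: unity_root_eq_1_iff)
  then show ?thesis using True by simp
next
  case False
  then have "unity_root q k \<noteq> 1"
    using assms by (simp add: unity_root_eq_1_iff)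
  moreover have "unity_root q k ^ q = 1"
    using assms by (simp flip: unity_root_power add: unity_root_eq_1_iff)
  ultimately show ?thesis
    using False by (simp add: unity_root_power geometric_sum)
qed

text \<open>Frequencies are natural numbers, so the negative of \<open>x\<close> is represented by
  \<open>q - x\<close>.\<close>

lemma cnj_unity_root:
  assumes "x \<le> q" "q > 0"
  shows "cnj (unity_root q (x * m)) = unity_root q ((q - x) * m)"
proof -
  have "unity_root q (x * m) * unity_root q ((q - x) * m) = unity_root q (q * m)"
    using assms by (simp flip: unity_root_add distrib_right)
  also have "\<dots> = 1"
    using assms by (simp add: unity_root_eq_1_iff)
  finally have "cnj (unity_root q (x * m)) * (unity_root q (x * m) * unity_root q ((q - x) * m)) =
      cnj (unity_root q (x * m))"
    by simp
  moreover have "cnj (unity_root q (x * m)) * unity_root q (x * m) = 1"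
    by (simp add: unity_root_def cis_cnj cis_mult)
  ultimately show ?thesis
    by (metis mult.assoc mult_1)
qed

text \<open>Multiplication by the unit \<open>w\<close> permutes the frequencies, so orthogonality
  survives it. Such units arise when the Chinese remainder theorem splits
  \<open>unity_root q\<close>: each part is twisted by the inverse of the complementary
  modulus.\<close>

lemma finite_fourier_parseval:
  fixes c :: "nat \<Rightarrow> complex"
  assumes "M > 0" "coprime w M"
  shows "(\<Sum>m<M. (norm (\<Sum>x<M. c x * unity_root M (x * (w * m))))\<^sup>2) = real M * (\<Sum>x<M. (norm (c x))\<^sup>2)"
proof -
  have orth: "(\<Sum>m<M. unity_root M (x * (w * m)) * cnj (unity_root M (y * (w * m)))) =
      (if x = y then of_nat M else 0)" if "x < M" "y < M" for x y
  proof -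
    have "(\<Sum>m<M. unity_root M (x * (w * m)) * cnj (unity_root M (y * (w * m)))) =
       (\<Sum>m<M. unity_root M (((x + (M - y)) * w) * m))"
      using that assms
      by (intro sum.cong refl)
         (simp add: cnj_unity_root mult.assoc flip: unity_root_add distrib_right)
    also have "\<dots> = (if M dvd (x + (M - y)) * w then of_nat M else 0)"
      by (rule sum_unity_root[OF assms(1)])
    also have "M dvd (x + (M - y)) * w \<longleftrightarrow> M dvd (x + (M - y))"
      using assms by (simp add: coprime_dvd_mult_left_iff coprime_commute)
    also have "\<dots> \<longleftrightarrow> x = y"
    proof
      assume "M dvd x + (M - y)"
      then obtain k where k: "x + (M - y) = M * k" by (auto elim: dvdE)
      have "0 < x + (M - y)" "x + (M - y) < M * 2" using that by auto
      then have "k = 1" using k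
        by (metis One_nat_def less_2_cases_iff mult_0_right nat_mult_less_cancel_disj neq0_conv)
      then show "x = y" using k that by simp
    qed (use that in simp)
    finally show ?thesis by simp
  qed
  have "complex_of_real (\<Sum>m<M. (norm (\<Sum>x<M. c x * unity_root M (x * (w * m))))\<^sup>2) =
    (\<Sum>m<M. (\<Sum>x<M. \<Sum>y<M. c x * cnj (c y) * (unity_root M (x * (w * m)) * cnj (unity_root M (y * (w * m))))))"
    unfolding of_real_sum complex_norm_square cnj_sum complex_cnj_mult sum_product
    by (intro sum.cong refl) (simp only: mult_ac)
  also have "\<dots> = (\<Sum>x<M. \<Sum>y<M. c x * cnj (c y) * (\<Sum>m<M. unity_root M (x * (w * m)) * cnj (unity_root M (y * (w * m)))))"
    unfolding sum_distrib_left
    by (subst sum.swap, rule sum.cong[OF refl], rule sum.swap)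
  also have "\<dots> = (\<Sum>x<M. \<Sum>y<M. if x = y then c x * cnj (c y) * of_nat M else 0)"
    by (intro sum.cong refl) (simp add: orth)
  also have "\<dots> = (\<Sum>x<M. c x * cnj (c x) * of_nat M)"
    by (intro sum.cong refl) simp
  also have "\<dots> = complex_of_real (real M * (\<Sum>x<M. (norm (c x))\<^sup>2))"
    by (simp add: complex_norm_square sum_distrib_left mult_ac del: of_real_power complex_mult_cnj)
  finally show ?thesis by (simp only: of_real_eq_iff)
qed

text \<open>The constant term is 1, so the product of the moduli of the roots is
  \<open>1 / norm (lead_coeff p)\<close>, which is at most \<open>r ^ degree p\<close>; not all of
  them can exceed \<open>r\<close>.\<close>

lemma poly_has_small_root:
  fixes p :: "complex poly"
  assumes "poly.coeff p 0 = 1" "degree p > 0" "r > 0" "norm (lead_coeff p) * r ^ degree p \<ge> 1"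
  shows "\<exists>z. norm z \<le> r \<and> poly p z = 0"
proof (rule ccontr)
  assume neg: "\<not> ?thesis"
  obtain root where root: "Polynomial.smult (lead_coeff p) (\<Prod>i<degree p. [:- root i, 1:]) = p"
    by (rule complex_poly_decompose')
  have eval: "poly p z = lead_coeff p * (\<Prod>i<degree p. z - root i)" for z
    by (subst root[symmetric]) (simp add: poly_prod)
  have big: "norm (root i) > r" if "i < degree p" for i
  proof -
    have "poly p (root i) = 0"
      using that by (auto simp: eval)
    then show ?thesis using neg by force
  qed
  have nz: "root i \<noteq> 0" if "i < degree p" for i
    using big[OF that] assms(3) by auto
  have "r ^ degree p < (\<Prod>i<degree p. norm (root i))"
  proof -
    have "(\<Prod>i<degree p. r) < (\<Prod>i<degree p. norm (root i))"
      using big nz assms(2,3) by (intro prod_mono_strict) (auto simp: less_imp_le)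
    then show ?thesis by simp
  qed
  moreover have "norm (lead_coeff p) > 0"
    using assms(2) by force
  ultimately have "norm (lead_coeff p) * r ^ degree p < norm (lead_coeff p) * (\<Prod>i<degree p. norm (root i))"
    by (rule mult_strict_left_mono)
  also have "\<dots> = norm (poly p 0)"
    by (simp add: eval norm_mult flip: prod_norm)
  also have "\<dots> = 1"
    using assms(1) by (simp add: poly_0_coeff_0)
  finally show False using assms(4) by simp
qed

text \<open>For \<open>j\<close> take the product of the primes of \<open>m\<close> that do not
  divide \<open>n\<close>. A prime of \<open>m\<close> dividing \<open>n\<close> divides neither
  \<open>q\<close> (by the gcd condition) nor \<open>j\<close>; any other prime of \<open>m\<close>
  divides \<open>j * q\<close> but not \<open>n\<close>.\<close>

lemma coprime_shift:
  fixes n q m :: nat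
  assumes "coprime (gcd n q) m" "m > 0"
  shows "\<exists>j. coprime (n + j * q) m"
proof -
  define j where "j = \<Prod>{p \<in> prime_factors m. \<not> p dvd n}"
  have "\<not> p dvd n + j * q" if p: "prime p" "p dvd m" for p
  proof (cases "p dvd n")
    case True
    have "\<not> p dvd q"
      using coprime_common_divisor_nat[OF assms(1), of p] p True by auto
    moreover have "\<not> p dvd j"
    proof
      assume "p dvd j"
      then obtain r where "r \<in> prime_factors m" "\<not> r dvd n" "p dvd r"
        unfolding j_def using p(1)
        by (subst (asm) prime_dvd_prod_iff) auto
      then have "p = r" using p(1) by (simp add: in_prime_factors_iff primes_dvd_imp_eq)
      with True \<open>\<not> r dvd n\<close> show False by simp
    qed
    ultimately show ?thesis
      using True p(1) by (simp add: dvd_add_right_iff prime_dvd_mult_iff)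
  next
    case False
    then have "p dvd j"
      unfolding j_def using p assms(2) by (intro dvd_prodI) (auto simp: in_prime_factors_iff)
    then show ?thesis using False by (simp add: dvd_add_left_iff)
  qed
  then have "gcd (n + j * q) m = 1"
    using prime_factor_nat[of "gcd (n + j * q) m"] by (meson gcd_dvd1 gcd_dvd2 dvd_trans)
  then have "coprime (n + j * q) m" by (simp only: coprime_iff_gcd_eq_1)
  then show ?thesis by blast
qed

text \<open>An Euler product gives multiplicativity on coprime arguments only. How much more follows
  from the period, and what happens at residues sharing a factor with \<open>q\<close>, is the
  subject of this locale.\<close>

locale periodic_multiplicative =
  fixes q :: nat and chi :: "nat \<Rightarrow> complex"
  assumes q_pos: "q > 0"
    and one [simp]: "chi 1 = 1"
    and periodic: "chi (n + q) = chi n"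
    and mult: "coprime m n \<Longrightarrow> chi (m * n) = chi m * chi n"
begin

lemma one' [simp]: "chi (Suc 0) = 1"
  using one by simp

lemma periodic_mult: "chi (n + j * q) = chi n"
proof (induction j)
  case (Suc j)
  then show ?case using periodic[of "n + j * q"] by (simp add: add_ac)
qed simp

lemma chi_mod: "chi (n mod q) = chi n"
  using periodic_mult[of "n mod q" "n div q"] by simp

lemma chi_cong: "[m = n] (mod q) \<Longrightarrow> chi m = chi n"
  unfolding cong_def by (metis chi_mod)

text \<open>By periodicity \<open>n\<close> may be moved within its residue class until it is
  coprime to \<open>m\<close>; the only obstruction is a prime dividing \<open>m\<close>,
  \<open>n\<close> and \<open>q\<close> at once.\<close>

lemma mult_gen:
  assumes "coprime (gcd n q) m"
  shows "chi (m * n) = chi m * chi n"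
proof -
  \<comment> \<open>The residue 0 is represented by \<open>q\<close>, because
    \<open>coprime_shift\<close> needs a positive second argument.\<close>
  define m' where "m' = (if m = 0 then q else m)"
  have m': "m' > 0" "[m = m'] (mod q)" "coprime (gcd n q) m'"
    using q_pos assms by (auto simp: m'_def cong_def)
  obtain j where j: "coprime (n + j * q) m'"
    using coprime_shift m' by blast
  have "chi (m * n) = chi (m' * (n + j * q))"
    by (intro chi_cong cong_mult m'(2)) (simp add: cong_def)
  also have "\<dots> = chi m' * chi (n + j * q)"
    using j by (intro mult) (simp add: coprime_commute)
  also have "chi m' = chi m" using chi_cong[OF m'(2)] by simp
  finally show ?thesis by (simp add: periodic_mult)
qed

lemma mult_unit: "coprime n q \<Longrightarrow> chi (m * n) = chi m * chi n"
  by (rule mult_gen) simp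

text \<open>\<open>chi\<close> is multiplicative along the powers of a unit, and Euler's theorem
  then makes \<open>chi n\<close> a root of unity.\<close>

lemma norm_unit:
  assumes "coprime n q"
  shows "norm (chi n) = 1"
proof -
  have "chi (n ^ k) = chi n ^ k" for k
    using mult_unit[OF assms, of "n ^ i" for i] by (induction k) (simp_all add: mult.commute)
  then have "chi n ^ totient q = chi (n ^ totient q)" by simp
  also have "\<dots> = chi 1"
    using assms by (intro chi_cong euler_theorem)
  finally have "norm (chi n) ^ totient q = 1"
    by (metis norm_one norm_power one)
  then show ?thesis
    using q_pos power_eq_imp_eq_base[of "norm (chi n)" "totient q" 1] by simp
qed

lemma unit_nonzero: "coprime n q \<Longrightarrow> chi n \<noteq> 0"
  using norm_unit by force

text \<open>Suppose \<open>chi\<close> is induced from a proper divisor \<open>d\<close> and put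
  \<open>c = q / d > 1\<close>. Multiples of \<open>c\<close> are not prime to \<open>q\<close>, so
  \<open>chi\<close> vanishes there, and by self-duality so do the Fourier coefficients at these
  frequencies. Those coefficients determine the sum of \<open>chi\<close> over the class of 1 modulo
  \<open>d\<close>, which is the positive number of units in that class.\<close>

lemma primitive_of_support:
  assumes dual: "\<And>m. chi m = \<kappa> * cnj (\<Sum>r<q. chi r * unity_root q (r * m))"
    and supp: "\<And>n. \<not> coprime n q \<Longrightarrow> chi n = 0"
  shows "primitive_character q chi"
proof -
  have mult_all: "chi (m * n) = chi m * chi n" for m n
  proof (cases "coprime n q")
    case False
    then have "\<not> coprime (m * n) q" by (simp add: coprime_mult_left_iff)
    then show ?thesis using False supp by simp
  qed (rule mult_unit)
  have char: "dirichlet_character q chi"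
    unfolding dirichlet_character_def
    using q_pos mult_all periodic supp unit_nonzero by auto
  have "False" if d: "d dvd q" "d < q" "dirichlet_character d psi"
    "\<And>n. coprime n q \<Longrightarrow> chi n = psi n" for d psi
  proof -
    from d(1) obtain c where c: "q = d * c" by (elim dvdE)
    have dpos: "d > 0" using d(3) by (simp add: dirichlet_character_def)
    have cgt: "c > 1"
      using c d(2) by (cases "c = 0 \<or> c = 1") auto
    have psi_cong: "psi n = 1" if "[n = 1] (mod d)" for n
    proof -
      interpret P: periodic_multiplicative d psi
        by unfold_locales (use d(3) in \<open>auto simp: dirichlet_character_def\<close>)
      show ?thesis using P.chi_cong[OF that] by simp
    qed
    have zero: "chi (j * c) = 0" for j
    proof (rule supp)
      have "c dvd j * c" "c dvd q" by (simp_all add: c)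
      then show "\<not> coprime (j * c) q"
        using cgt by (metis coprime_common_divisor_nat less_numeral_extra(4))
    qed
    have "\<kappa> \<noteq> 0" using dual[of 1] by auto
    then have zero': "(\<Sum>r<q. chi r * unity_root q (r * (j * c))) = 0" for j
      using dual[of "j * c"] zero[of j] by (simp del: cnj_sum)
    have root: "unity_root q (r * (j * c)) = unity_root d (r * j)" for r j
      using unity_root_cancel[of c d "r * j"] cgt unfolding c by (simp add: mult_ac)
    \<comment> \<open>Fourier inversion modulo \<open>d\<close> at the residue 1;
      \<open>d - 1\<close> stands for \<open>-1\<close>.\<close>
    have "0 = (\<Sum>j<d. unity_root d ((d - 1) * j) * (\<Sum>r<q. chi r * unity_root q (r * (j * c))))"
      by (simp add: zero')
    also have "\<dots> = (\<Sum>r<q. chi r * (\<Sum>j<d. unity_root d ((r + (d - 1)) * j)))"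
      unfolding root sum_distrib_left
      by (subst sum.swap, intro sum.cong refl) (simp only: distrib_right distrib_left unity_root_add mult_ac)
    also have "\<dots> = (\<Sum>r<q. if d dvd r + (d - 1) then chi r * of_nat d else 0)"
      using dpos by (intro sum.cong refl) (simp add: sum_unity_root)
    also have "\<dots> = (\<Sum>r<q. if [r = 1] (mod d) \<and> coprime r q then of_nat d else 0)"
    proof (intro sum.cong refl)
      fix r assume "r \<in> {..<q}"
      have "d dvd r + (d - 1) \<longleftrightarrow> [r + (d - 1) = 1 + (d - 1)] (mod d)"
        using dpos by (simp add: cong_def dvd_eq_mod_eq_0)
      also have "\<dots> \<longleftrightarrow> [r = 1] (mod d)"
        by (rule cong_add_rcancel_nat)
      finally show "(if d dvd r + (d - 1) then chi r * of_nat d else 0) =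
          (if [r = 1] (mod d) \<and> coprime r q then of_nat d else 0)"
        using supp[of r] d(4)[of r] psi_cong[of r] by auto
    qed
    also have "\<dots> = of_nat (\<Sum>r<q. if [r = 1] (mod d) \<and> coprime r q then d else 0)"
      by (simp only: of_nat_sum if_distrib[of of_nat] of_nat_0)
    finally have "(\<Sum>r<q. if [r = 1] (mod d) \<and> coprime r q then d else 0) = 0"
      by (metis of_nat_eq_0_iff)
    then have "\<forall>r\<in>{..<q}. (if [r = 1] (mod d) \<and> coprime r q then d else 0) = 0"
      by (simp only: sum_eq_0_iff finite_lessThan)
    \<comment> \<open>The residue 1 lies in the range because \<open>0 < d < q\<close>, and it
      contributes \<open>d\<close>.\<close>
    from bspec[OF this, of 1] show False using d(2) dpos by simp
  qed
  with char show ?thesis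
    unfolding primitive_character_def by blast
qed

section \<open>Gauss sums and Euler factors at the primes dividing the modulus\<close>

lemma sum_mult_unit:
  assumes "coprime u q" and "\<And>x y. [x = y] (mod q) \<Longrightarrow> f x = f y"
  shows "(\<Sum>x<q. f x) = (\<Sum>x<q. f (x * u))"
proof -
  have "inj_on (\<lambda>x. x * u mod q) {..<q}"
  proof (rule inj_onI)
    fix x y assume xy: "x \<in> {..<q}" "y \<in> {..<q}" "x * u mod q = y * u mod q"
    then have "[x = y] (mod q)"
      using assms(1) by (simp add: cong_def[symmetric] cong_mult_rcancel_nat coprime_commute)
    with xy show "x = y" by (simp add: cong_def)
  qed
  moreover have "(\<lambda>x. x * u mod q) ` {..<q} \<subseteq> {..<q}" using q_pos by auto
  ultimately have "bij_betw (\<lambda>x. x * u mod q) {..<q} {..<q}"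
    by (simp add: bij_betw_def endo_inj_surj)
  then have "(\<Sum>x<q. f x) = (\<Sum>x<q. f (x * u mod q))"
    by (rule sum.reindex_bij_betw[symmetric])
  also have "\<dots> = (\<Sum>x<q. f (x * u))"
    by (intro sum.cong refl assms(2)) (simp add: cong_def)
  finally show ?thesis .
qed

text \<open>If \<open>chi\<close> is trivial on \<open>1 + h \<int>\<close>, then averaging over the substitutions \<open>x \<mapsto> x (1 + h j)\<close>
  kills all terms of the Gauss sum outside the multiples of \<open>q / h\<close>.\<close>

lemma gauss_sum_collapse:
  assumes q: "q = h * l" and w: "coprime w q"
    and triv: "\<And>j. coprime (1 + h * j) q \<and> chi (1 + h * j) = 1"
  shows "(\<Sum>x<q. chi x * unity_root q (x * w)) = (\<Sum>y<h. chi (l * y) * unity_root h (y * w))"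
proof -
  define T where "T = (\<Sum>x<q. chi x * unity_root q (x * w))"
  have pos: "h > 0" "l > 0" using q q_pos by auto
  have "T = (\<Sum>x<q. chi x * unity_root q (x * w) * unity_root l (x * w * j))" for j
  proof -
    have "T = (\<Sum>x<q. chi (x * (1 + h * j)) * unity_root q (x * (1 + h * j) * w))"
      unfolding T_def using triv[of j]
      by (intro sum_mult_unit) (auto intro!: arg_cong2[of _ _ _ _ "(*)"] chi_cong unity_root_cong q_pos cong_mult)
    also have "\<dots> = (\<Sum>x<q. chi x * unity_root q (x * w) * unity_root l (x * w * j))"
    proof (intro sum.cong refl)
      fix x
      have "x * (1 + h * j) * w = x * w + h * (x * w * j)" by (simp add: algebra_simps)
      moreover have "unity_root q (h * (x * w * j)) = unity_root l (x * w * j)"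
        using unity_root_cancel[of h l "x * w * j"] pos unfolding q by (simp only: mult.commute[of l h])
      ultimately show "chi (x * (1 + h * j)) * unity_root q (x * (1 + h * j) * w) =
          chi x * unity_root q (x * w) * unity_root l (x * w * j)"
        using triv[of j] mult_unit[of "1 + h * j" x] by (simp only: unity_root_add mult_ac mult_1)
    qed
    finally show ?thesis .
  qed
  then have "of_nat l * T = (\<Sum>j<l. \<Sum>x<q. chi x * unity_root q (x * w) * unity_root l (x * w * j))"
    by simp
  also have "\<dots> = (\<Sum>x<q. chi x * unity_root q (x * w) * (\<Sum>j<l. unity_root l (x * w * j)))"
    by (subst sum.swap) (simp only: sum_distrib_left)
  also have "\<dots> = (\<Sum>x<q. if l dvd x then chi x * unity_root q (x * w) * of_nat l else 0)"
  proof (intro sum.cong refl)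
    fix x
    have "l dvd x * w \<longleftrightarrow> l dvd x"
      using w q by (simp add: coprime_dvd_mult_left_iff coprime_commute)
    then show "chi x * unity_root q (x * w) * (\<Sum>j<l. unity_root l (x * w * j)) =
        (if l dvd x then chi x * unity_root q (x * w) * of_nat l else 0)"
      using pos by (simp add: sum_unity_root)
  qed
  also have "\<dots> = (\<Sum>x\<in>{x\<in>{..<q}. l dvd x}. chi x * unity_root q (x * w) * of_nat l)"
    by (rule sum.inter_filter[symmetric]) simp
  also have "{x\<in>{..<q}. l dvd x} = (\<lambda>y. l * y) ` {..<h}"
    using pos by (auto simp: q mult.commute elim!: dvdE)
  also have "(\<Sum>x\<in>(\<lambda>y. l * y) ` {..<h}. chi x * unity_root q (x * w) * of_nat l) =
      (\<Sum>y<h. chi (l * y) * unity_root q (l * y * w) * of_nat l)"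
    using pos by (subst sum.reindex) (auto simp: inj_on_def)
  also have "\<dots> = of_nat l * (\<Sum>y<h. chi (l * y) * unity_root h (y * w))"
  proof -
    have "unity_root q (l * y * w) = unity_root h (y * w)" for y
      using unity_root_cancel[OF pos(2), of h "y * w"] by (simp only: q mult.assoc)
    then show ?thesis by (simp add: sum_distrib_left mult_ac)
  qed
  finally show ?thesis using pos by (simp add: T_def)
qed

text \<open>Substituting \<open>y * m\<close> for \<open>y\<close> with \<open>P m\<close> pulls out
  \<open>chi m\<close>, of modulus 1, so all these twists of the sum have the same modulus. If
  \<open>n\<close> residues satisfy \<open>P\<close>, then \<open>n\<close> equal squares are
  bounded by the Parseval total \<open>h * n\<close>. The predicate \<open>P\<close> plays the role
  of being a unit, on which alone \<open>chi\<close> is known to have the smaller period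
  \<open>h\<close>.\<close>

lemma norm_twisted_sum_le:
  assumes unit: "\<And>y. P y \<Longrightarrow> coprime y q" and P1: "P 1" and h: "h > 1" and w: "coprime w h"
    and Ph: "\<And>y. P y \<Longrightarrow> coprime y h"
    and Pmult: "\<And>y m. P m \<Longrightarrow> P (y * m) \<longleftrightarrow> P y"
    and per: "\<And>y z. [y = z] (mod h) \<Longrightarrow> (P y \<longleftrightarrow> P z) \<and> (P y \<longrightarrow> chi y = chi z)"
  shows "(norm (\<Sum>y<h. (if P y then chi y else 0) * unity_root h (y * w)))\<^sup>2 \<le> real h"
proof -
  define c where "c y = (if P y then chi y else 0)" for y
  \<comment> \<open>The constant function 1 serves only to make \<open>sum_mult_unit\<close>
    available for the modulus \<open>h\<close>.\<close>
  interpret H: periodic_multiplicative h "\<lambda>_. 1"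
    by unfold_locales (use h in auto)
  have c_cong: "c y = c z" if "[y = z] (mod h)" for y z
    using per[OF that] by (auto simp: c_def)
  define \<tau> where "\<tau> m = (\<Sum>y<h. c y * unity_root h (y * (w * m)))" for m
  have norm_eq: "norm (\<tau> m) = norm (\<tau> 1)" if m: "P m" for m
  proof -
    have "\<tau> 1 = (\<Sum>y<h. c (y * m) * unity_root h (y * m * w))"
      unfolding \<tau>_def mult_1_right using h
      by (intro H.sum_mult_unit Ph[OF m]) (auto intro!: arg_cong2[of _ _ _ _ "(*)"] c_cong unity_root_cong cong_mult)
    also have "\<dots> = (\<Sum>y<h. chi m * (c y * unity_root h (y * (w * m))))"
      using mult_unit[OF unit[OF m]] Pmult[OF m] by (intro sum.cong refl) (simp add: c_def mult_ac)
    also have "\<dots> = chi m * \<tau> m"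
      by (simp add: \<tau>_def sum_distrib_left)
    finally show ?thesis using norm_unit[OF unit[OF m]] by (simp add: norm_mult)
  qed
  define n where "n = card {y\<in>{..<h}. P y}"
  have npos: "n > 0"
    using P1 h unfolding n_def by (intro card_gt_0_iff[THEN iffD2]) auto
  have "real n * (norm (\<tau> 1))\<^sup>2 = (\<Sum>m\<in>{y\<in>{..<h}. P y}. (norm (\<tau> m))\<^sup>2)"
    using norm_eq by (simp add: n_def)
  also have "\<dots> \<le> (\<Sum>m<h. (norm (\<tau> m))\<^sup>2)"
    by (intro sum_mono2) auto
  also have "\<dots> = real h * (\<Sum>y<h. (norm (c y))\<^sup>2)"
    unfolding \<tau>_def using h w by (intro finite_fourier_parseval) auto
  also have "(\<Sum>y<h. (norm (c y))\<^sup>2) = (\<Sum>y<h. if P y then 1 else 0)"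
    using norm_unit[OF unit] by (intro sum.cong refl) (simp add: c_def)
  also have "\<dots> = real n"
    by (simp add: n_def flip: sum.inter_filter)
  finally have "(norm (\<tau> 1))\<^sup>2 \<le> real h" using npos by (simp add: mult.commute)
  then show ?thesis by (simp add: \<tau>_def c_def)
qed

text \<open>The two cases below are those of a polynomial Euler factor and of an Euler factor that is a
  polynomial divided by \<open>1 - z\<close>; the size of the Gauss sum makes the last coefficient of the
  polynomial so large that it has a root of modulus at most \<open>1 / sqrt p\<close>.\<close>

lemma prime_power_root:
  assumes p: "prime p" and q: "q = p ^ a" and a: "a > 0" and w: "coprime w p"
    and gauss: "(norm (\<Sum>x<q. chi x * unity_root q (x * w)))\<^sup>2 = real q"
    and nz: "k0 > 0" "chi (p ^ k0) \<noteq> 0"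
  shows "\<exists>z. norm z \<le> 1 / sqrt p \<and> (\<lambda>k. chi (p ^ k) * z ^ k) sums 0"
proof -
  define r where "r = 1 / sqrt (real p)"
  have p1: "p > 1" using p prime_gt_1_nat by blast
  have r: "r > 0" "r < 1" "r\<^sup>2 = 1 / real p" using p1 by (auto simp: r_def power_divide)
  have coprime_q: "coprime y q \<longleftrightarrow> \<not> p dvd y" for y
    using p a by (auto simp: q coprime_power_right_iff prime_imp_coprime coprime_commute
        dest: coprime_common_divisor_nat[of _ _ p])
  have wq: "coprime w q" using w by (simp add: q)
  have high: "chi (p ^ k) = chi 0" if "k \<ge> a" for k
    by (rule chi_cong) (use that in \<open>simp add: q cong_0_iff le_imp_power_dvd\<close>)
  show ?thesis
  \<comment> \<open>The values \<open>chi (p ^ k)\<close> equal \<open>chi 0\<close> from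
    \<open>k = a\<close> on, so \<open>chi 0\<close> decides whether the Euler factor is a
    polynomial.\<close>
  proof (cases "chi 0 = 0")
    case True
    define N where "N = Max {k. k \<le> a \<and> chi (p ^ k) \<noteq> 0}"
    have fin: "finite {k. k \<le> a \<and> chi (p ^ k) \<noteq> 0}" by simp
    have "k0 < a" using high[of k0] nz True by (metis not_less)
    then have k0: "k0 \<in> {k. k \<le> a \<and> chi (p ^ k) \<noteq> 0}" using nz by simp
    have "N \<in> {k. k \<le> a \<and> chi (p ^ k) \<noteq> 0}" using Max_in[OF fin] k0 unfolding N_def by blast
    then have N: "N \<le> a" "chi (p ^ N) \<noteq> 0" by auto
    have "N \<ge> k0" unfolding N_def using Max_ge[OF fin k0] .
    then have Npos: "N > 0" using nz by simp
    have aboveN: "chi (p ^ k) = 0" if "k > N" for k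
    proof (cases "k \<le> a")
      case True
      then show ?thesis using Max_ge[OF fin, of k] that unfolding N_def by fastforce
    qed (use high[of k] \<open>chi 0 = 0\<close> in simp)
    have Na: "N < a" using N high[of a] True by (metis le_neq_implies_less order_refl)
    \<comment> \<open>\<open>N\<close> is the degree of the Euler factor; on residues prime to
      \<open>p\<close>, the period of \<open>chi\<close> drops by the factor
      \<open>p ^ N\<close>.\<close>
    define h where "h = p ^ (a - N)"
    have qh: "q = h * p ^ N" using Na by (simp add: q h_def flip: power_add)
    have h1: "h > 1" and ph: "p dvd h" using p1 Na one_less_power[of p "a - N"] by (auto simp: h_def)
    \<comment> \<open>Multiplication by \<open>p ^ N\<close> lifts a congruence modulo
      \<open>h\<close> to one modulo \<open>q\<close>, and the nonzero factor
      \<open>chi (p ^ N)\<close> cancels.\<close>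
    have per_h: "chi y = chi z" if "[y = z] (mod h)" "\<not> p dvd y" for y z
    proof -
      have "[y = z] (mod p)" using that(1) ph cong_dvd_modulus_nat by blast
      then have "\<not> p dvd z" using that(2) cong_dvd_iff by blast
      have "[p ^ N * y = p ^ N * z] (mod q)"
        using that(1) unfolding qh by (simp add: cong_def mult.commute flip: mult_mod_right)
      then have "chi (p ^ N) * chi y = chi (p ^ N) * chi z"
        using chi_cong[of "p ^ N * y" "p ^ N * z"] mult_unit[of y "p ^ N"] mult_unit[of z "p ^ N"]
          coprime_q[of y] coprime_q[of z] that(2) \<open>\<not> p dvd z\<close> by simp
      then show ?thesis using N by simp
    qed
    have triv: "coprime (1 + h * j) q \<and> chi (1 + h * j) = 1" for j
    proof
      have "\<not> p dvd 1" using p1 by simp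
      then show "coprime (1 + h * j) q"
        unfolding coprime_q using ph dvd_add_left_iff[of p "h * j" 1] by simp
      show "chi (1 + h * j) = 1"
      proof -
        have "[1 = 1 + h * j] (mod h)" by (simp only: cong_def mod_mult_self2)
        from per_h[OF this] show ?thesis using p1 by simp
      qed
    qed
    \<comment> \<open>If \<open>p\<close> divides \<open>y\<close>, the power of \<open>p\<close> in
      \<open>p ^ N * y\<close> exceeds the largest exponent at which \<open>chi\<close> does not
      vanish.\<close>
    have lvl: "chi (p ^ N * y) = chi (p ^ N) * (if \<not> p dvd y then chi y else 0)" for y
    proof (cases "p dvd y")
      case False
      then show ?thesis using mult_unit coprime_q by simp
    next
      case True
      have "chi (p ^ N * y) = 0"
      proof (cases "y = 0")
        case False
        define k where "k = multiplicity p y"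
        obtain u where u: "y = p ^ k * u" "\<not> p dvd u"
          using multiplicity_decompose'[of y p] False p k_def p1
          by (metis not_prime_unit)
        have "k > 0" using True u by (cases k) auto
        have "chi (p ^ N * y) = chi (p ^ (N + k)) * chi u"
          using mult_unit[of u "p ^ (N + k)"] u coprime_q by (simp add: power_add mult_ac)
        then show ?thesis using aboveN[of "N + k"] \<open>k > 0\<close> by simp
      qed (use \<open>chi 0 = 0\<close> in simp)
      then show ?thesis using True by simp
    qed
    \<comment> \<open>The Gauss sum has size \<open>sqrt q\<close>, but the collapsed sum modulo
      \<open>h\<close> has size at most \<open>sqrt h\<close>; the factor \<open>chi (p ^ N)\<close>
      must supply the missing \<open>sqrt (p ^ N)\<close>.\<close>
    have "real q = (norm (chi (p ^ N) * (\<Sum>y<h. (if \<not> p dvd y then chi y else 0) * unity_root h (y * w))))\<^sup>2"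
      unfolding sum_distrib_left gauss[symmetric]
      by (subst gauss_sum_collapse[OF qh wq triv]) (simp only: lvl mult.assoc)
    also have "\<dots> = (norm (chi (p ^ N)))\<^sup>2 * (norm (\<Sum>y<h. (if \<not> p dvd y then chi y else 0) * unity_root h (y * w)))\<^sup>2"
      by (simp add: norm_mult power_mult_distrib)
    also have "\<dots> \<le> (norm (chi (p ^ N)))\<^sup>2 * real h"
    proof (intro mult_left_mono norm_twisted_sum_le)
      show "coprime w h" using w by (simp add: h_def)
      show "coprime y h" if "\<not> p dvd y" for y
        using that p by (simp add: h_def coprime_commute prime_imp_coprime)
      show "(\<not> p dvd y) = (\<not> p dvd z) \<and> (\<not> p dvd y \<longrightarrow> chi y = chi z)" if "[y = z] (mod h)" for y z
        using per_h[OF that] that ph by (metis cong_dvd_iff cong_dvd_modulus_nat)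
      show "(\<not> p dvd y * m) = (\<not> p dvd y)" if "\<not> p dvd m" for y m
        using that p by (simp add: prime_dvd_mult_iff)
    qed (use coprime_q h1 p1 in auto)
    finally have "real (p ^ N) * real h \<le> (norm (chi (p ^ N)))\<^sup>2 * real h"
      by (simp add: qh mult.commute)
    then have big: "real (p ^ N) \<le> (norm (chi (p ^ N)))\<^sup>2" using h1 by simp
    define P where "P = (\<Sum>k\<le>N. Polynomial.monom (chi (p ^ k)) k)"
    have coeffP: "poly.coeff P k = (if k \<le> N then chi (p ^ k) else 0)" for k
      by (simp add: P_def coeff_sum)
    have degP: "degree P = N"
      by (intro antisym degree_le le_degree) (auto simp: coeffP N)
    have "real (p ^ N) * (r\<^sup>2) ^ N = 1"
      using p1 by (simp add: r(3) power_divide)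
    then have "1 \<le> (norm (chi (p ^ N)))\<^sup>2 * (r\<^sup>2) ^ N"
      using mult_right_mono[OF big, of "(r\<^sup>2) ^ N"] by simp
    also have "\<dots> = (norm (chi (p ^ N)) * r ^ N)\<^sup>2"
      by (simp add: power_mult_distrib mult.commute flip: power_mult)
    finally have "1 \<le> norm (chi (p ^ N)) * r ^ N"
      using power2_le_imp_le[of 1 "norm (chi (p ^ N)) * r ^ N"] r(1) by simp
    then obtain z where z: "norm z \<le> r" "poly P z = 0"
      using poly_has_small_root[of P r] degP coeffP[of 0] coeffP[of N] Npos r(1) by auto
    have "(\<lambda>k. chi (p ^ k) * z ^ k) sums (\<Sum>k\<le>N. chi (p ^ k) * z ^ k)"
      by (rule sums_finite) (auto simp: aboveN)
    also have "(\<Sum>k\<le>N. chi (p ^ k) * z ^ k) = poly P z"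
      by (simp add: P_def poly_sum poly_monom)
    finally show ?thesis using z by (auto simp: r_def)
  next
    case False
    \<comment> \<open>Zero times a unit is zero, so \<open>chi 0 = chi 0 * chi u\<close> with
      \<open>chi 0\<close> nonzero.\<close>
    have unit1: "chi u = 1" if "\<not> p dvd u" for u
      using mult_unit[of u 0] that coprime_q False by simp
    obtain b where b: "a = Suc b" using a by (cases a) auto
    have qb: "q = p * p ^ b" by (simp add: q b)
    have triv: "coprime (1 + p * j) q \<and> chi (1 + p * j) = 1" for j
    proof -
      have "\<not> p dvd 1 + p * j" using p1
        by (metis dvd_add_left_iff dvd_triv_left nat_dvd_1_iff_1 nat_neq_iff)
      then show ?thesis using unit1 coprime_q by simp
    qed
    have "(\<Sum>x<q. chi x * unity_root q (x * w)) = (\<Sum>y<p. chi (p ^ b * y) * unity_root p (y * w))"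
      by (rule gauss_sum_collapse[OF qb wq triv])
    also have "\<dots> = (\<Sum>y<p. chi (p ^ b) * unity_root p (w * y) + (if y = 0 then chi 0 - chi (p ^ b) else 0))"
    proof (intro sum.cong refl)
      fix y assume "y \<in> {..<p}"
      show "chi (p ^ b * y) * unity_root p (y * w) =
          chi (p ^ b) * unity_root p (w * y) + (if y = 0 then chi 0 - chi (p ^ b) else 0)"
      proof (cases "y = 0")
        case False
        then have "\<not> p dvd y" using \<open>y \<in> {..<p}\<close> by (auto dest: dvd_imp_le)
        then show ?thesis using mult_unit[of y "p ^ b"] unit1[of y] coprime_q False by (simp add: mult.commute)
      qed simp
    qed
    also have "\<dots> = chi (p ^ b) * (\<Sum>y<p. unity_root p (w * y)) + (chi 0 - chi (p ^ b))"
      using p1 by (simp add: sum.distrib sum_distrib_left)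
    also have "(\<Sum>y<p. unity_root p (w * y)) = 0"
    proof -
      have "\<not> p dvd w" using w p1 coprime_common_divisor_nat[of w p p] by auto
      then show ?thesis using p1 by (simp add: sum_unity_root)
    qed
    finally have big: "(norm (chi 0 - chi (p ^ b)))\<^sup>2 = real q"
      using gauss by simp
    \<comment> \<open>The coefficients of \<open>1 - z\<close> times the Euler factor. They vanish
      beyond \<open>a\<close>, and the Gauss sum just computed is the top one, so its modulus is
      exactly \<open>sqrt q\<close>.\<close>
    define d where "d k = chi (p ^ k) - (if k = 0 then 0 else chi (p ^ (k - 1)))" for k
    define P where "P = (\<Sum>k\<le>a. Polynomial.monom (d k) k)"
    have coeffP: "poly.coeff P k = (if k \<le> a then d k else 0)" for k
      by (simp add: P_def coeff_sum)
    have da: "d a = chi 0 - chi (p ^ b)" using high[of a] by (simp add: d_def b)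
    have "d a \<noteq> 0" using big q_pos da by auto
    then have degP: "degree P = a"
      by (intro antisym degree_le le_degree) (auto simp: coeffP)
    have "(norm (d a) * r ^ a)\<^sup>2 = real q * (r\<^sup>2) ^ a"
      using big by (simp add: da power_mult_distrib mult.commute flip: power_mult)
    also have "\<dots> = 1" using p1 by (simp add: r(3) q power_divide)
    finally have "norm (d a) * r ^ a = 1"
      using power2_eq_imp_eq[of "norm (d a) * r ^ a" 1] r(1) by simp
    then obtain z where z: "norm z \<le> r" "poly P z = 0"
      using poly_has_small_root[of P r] degP coeffP[of 0] coeffP[of a] a r(1) by (auto simp: d_def)
    have nz1: "norm z < 1" using z r by simp
    have "summable (\<lambda>k. chi (p ^ k) * z ^ k)"
    proof -
      have "summable (\<lambda>k. chi 0 * z ^ (k + a))"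
        using nz1 by (intro summable_mult summable_ignore_initial_segment summable_geometric)
      then have "summable (\<lambda>k. chi (p ^ (k + a)) * z ^ (k + a))"
        by (simp add: high)
      then show ?thesis by (rule summable_iff_shift[THEN iffD1])
    qed
    then obtain S where S: "(\<lambda>k. chi (p ^ k) * z ^ k) sums S" by (auto simp: summable_def)
    have "(\<lambda>k. if k = 0 then 0 else chi (p ^ (k - 1)) * z ^ k) sums (z * S)"
    proof -
      have "(\<lambda>k. (\<lambda>k. if k = 0 then 0 else chi (p ^ (k - 1)) * z ^ k) (Suc k)) sums (z * S)"
        using sums_mult[OF S, of z] by (simp add: mult_ac)
      from sums_Suc[OF this] show ?thesis by simp
    qed
    from sums_diff[OF S this] have "(\<lambda>k. d k * z ^ k) sums (S - z * S)"
      by (rule sums_cong[THEN iffD1, rotated]) (auto simp: d_def algebra_simps)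
    moreover have "(\<lambda>k. d k * z ^ k) sums (\<Sum>k\<le>a. d k * z ^ k)"
      by (rule sums_finite) (auto simp: d_def high)
    moreover have "(\<Sum>k\<le>a. d k * z ^ k) = poly P z"
      by (simp add: P_def poly_sum poly_monom)
    ultimately have "S - z * S = 0" using z sums_unique2 by metis
    then have "(1 - z) * S = 0" by (simp add: algebra_simps)
    moreover have "z \<noteq> 1" using nz1 by auto
    ultimately have "S = 0" by simp
    then show ?thesis using S z by (auto simp: r_def)
  qed
qed

text \<open>With \<open>q = M * N\<close>, where \<open>M\<close> is the exact power of
  \<open>p\<close> in \<open>q\<close>, \<open>chi\<close> factors into \<open>g\<close> modulo
  \<open>M\<close> and \<open>h\<close> modulo \<open>N\<close>. Self-duality passes to
  \<open>g\<close> up to a constant, and \<open>prime_power_root\<close> yields a small zero for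
  \<open>g\<close>. Since \<open>p\<close> is a unit modulo \<open>N\<close>,
  \<open>h (p ^ k) = h p ^ k\<close> with \<open>norm (h p) = 1\<close>; dividing the zero by
  \<open>h p\<close> gives one of the same modulus for \<open>chi\<close>.\<close>

lemma vanishes_at_prime_power:
  assumes dual: "\<And>m. chi m = \<kappa> * cnj (\<Sum>r<q. chi r * unity_root q (r * m))"
    and nonvanishing: "\<And>z. norm z \<le> 1 / sqrt p \<Longrightarrow> \<not> (\<lambda>k. chi (p ^ k) * z ^ k) sums 0"
    and p: "prime p" "p dvd q" and k0: "k0 > 0"
  shows "chi (p ^ k0) = 0"
proof (rule ccontr)
  assume nz: "chi (p ^ k0) \<noteq> 0"
  have p1: "p > 1" using p prime_gt_1_nat by blast
  define a where "a = multiplicity p q"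
  obtain N where N: "q = p ^ a * N" "\<not> p dvd N"
    using multiplicity_decompose'[of q p] q_pos p1 a_def by (metis neq0_conv not_prime_unit p(1))
  define M where "M = p ^ a"
  have a: "a > 0" using N p by (cases a) auto
  have qMN: "q = M * N" and M1: "M > 1" and Npos: "N > 0"
    using N q_pos one_less_power[OF p1 a] by (auto simp: M_def)
  have pN: "coprime p N" using N p by (simp add: prime_imp_coprime)
  then have cop: "coprime M N" by (simp add: M_def)
  obtain e' where e': "[N * e' = 1] (mod M)"
    using cong_solve_coprime_nat[of N M] cop by (auto simp: coprime_commute)
  obtain f' where f': "[M * f' = 1] (mod N)"
    using cong_solve_coprime_nat[of M N] cop by auto
  \<comment> \<open>\<open>e\<close> and \<open>f\<close> are the Chinese remainder idempotents:
    \<open>e\<close> is 1 modulo \<open>M\<close> and 0 modulo \<open>N\<close>, and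
    \<open>f\<close> the reverse.\<close>
  define e where "e = N * e'"
  define f where "f = M * f'"
  have eM: "[e = 1] (mod M)" and fN: "[f = 1] (mod N)" using e' f' by (simp_all add: e_def f_def)
  have eN: "[e = 0] (mod N)" and fM: "[f = 0] (mod M)" by (simp_all add: e_def f_def cong_0_iff)
  have crt: "[x = y] (mod q)" if "[x = y] (mod M)" "[x = y] (mod N)" for x y
    unfolding qMN using that cop by (rule coprime_cong_mult_nat)
  have lin_M: "[x * e + y * f = x] (mod M)" for x y
    using cong_add[OF cong_mult[OF cong_refl eM, of x] cong_mult[OF cong_refl fM, of y]] by simp
  have lin_N: "[x * e + y * f = y] (mod N)" for x y
    using cong_add[OF cong_mult[OF cong_refl eN, of x] cong_mult[OF cong_refl fN, of y]] by simp
  \<comment> \<open>The values of \<open>chi\<close> at the residue pairs \<open>(x, 1)\<close> and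
    \<open>(1, y)\<close>.\<close>
  define g where "g x = chi (x * e + f)" for x
  define h where "h y = chi (e + y * f)" for y
  have gM: "[x * e + f = x] (mod M)" and gN: "[x * e + f = 1] (mod N)" for x
    using lin_M[of x 1] lin_N[of x 1] by simp_all
  have hM: "[e + y * f = 1] (mod M)" and hN: "[e + y * f = y] (mod N)" for y
    using lin_M[of 1 y] lin_N[of 1 y] by simp_all
  have coprimeI': "coprime (gcd x q) y"
    if "\<And>r. prime r \<Longrightarrow> r dvd x \<Longrightarrow> r dvd y \<Longrightarrow> r dvd M \<or> r dvd N \<Longrightarrow> False" for x y
  proof -
    have "gcd (gcd x q) y = 1"
    proof (rule ccontr)
      assume "gcd (gcd x q) y \<noteq> 1"
      then obtain r where r: "prime r" "r dvd gcd (gcd x q) y" using prime_factor_nat by blast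
      then have "r dvd M \<or> r dvd N" unfolding qMN by (auto simp: prime_dvd_mult_iff)
      then show False using that[of r] r by auto
    qed
    then show ?thesis by (simp only: coprime_iff_gcd_eq_1)
  qed
  have not1: "\<not> r dvd x" if "prime r" "r dvd K" "[x = 1] (mod K)" for r x K :: nat
  proof
    assume "r dvd x"
    moreover have "[x = 1] (mod r)" using that(2,3) cong_dvd_modulus_nat by blast
    ultimately have "r dvd 1" using cong_dvd_iff by blast
    then show False using that(1) by (metis not_prime_unit)
  qed
  interpret g: periodic_multiplicative M g
  proof
    show "M > 0" using M1 by simp
    show "g 1 = 1"
      using chi_cong[OF crt, of "1 * e + f" 1] gM[of 1] gN[of 1] by (simp add: g_def)
    show "g (n + M) = g n" for n
      unfolding g_def
      by (intro chi_cong crt cong_trans[OF gM cong_sym[OF cong_trans[OF gM]]] cong_trans[OF gN cong_sym[OF gN]])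
         (simp add: cong_def)
    show "g (m * n) = g m * g n" if mn: "coprime m n" for m n
    proof -
      have "g (m * n) = chi ((m * e + f) * (n * e + f))"
        unfolding g_def
      proof (intro chi_cong crt)
        show "[m * n * e + f = (m * e + f) * (n * e + f)] (mod M)"
          by (rule cong_trans[OF gM cong_sym[OF cong_mult[OF gM gM]]])
        have "[(m * e + f) * (n * e + f) = 1] (mod N)"
          using cong_mult[OF gN[of m] gN[of n]] by (simp only: mult_1)
        then show "[m * n * e + f = (m * e + f) * (n * e + f)] (mod N)"
          by (rule cong_trans[OF gN cong_sym])
      qed
      also have "\<dots> = g m * g n"
        unfolding g_def
      proof (intro mult_gen coprimeI')
        fix r assume r: "prime r" "r dvd n * e + f" "r dvd m * e + f" "r dvd M \<or> r dvd N"
        from r(4) show False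
        proof
          assume "r dvd M"
          then have "r dvd x" if "r dvd x * e + f" for x
            using that cong_dvd_iff[OF cong_dvd_modulus_nat[OF gM[of x]], of r] by blast
          with r have "r dvd n" "r dvd m" by blast+
          then show False using mn r(1) coprime_common_divisor_nat[of m n r] by auto
        next
          assume "r dvd N"
          then show False using not1[OF r(1) _ gN] r by blast
        qed
      qed
      finally show ?thesis .
    qed
  qed
  have split: "chi (x * e + y * f) = g x * h y" for x y
  proof -
    have "chi (x * e + y * f) = chi ((x * e + f) * (e + y * f))"
    proof (intro chi_cong crt)
      show "[x * e + y * f = (x * e + f) * (e + y * f)] (mod M)"
        using cong_trans[OF lin_M cong_sym[OF cong_mult[OF gM hM]]] by simp
      show "[x * e + y * f = (x * e + f) * (e + y * f)] (mod N)"
        using cong_trans[OF lin_N cong_sym[OF cong_mult[OF gN hN]]] by simp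
    qed
    also have "\<dots> = g x * h y"
      unfolding g_def h_def
    proof (intro mult_gen coprimeI')
      fix r assume r: "prime r" "r dvd e + y * f" "r dvd x * e + f" "r dvd M \<or> r dvd N"
      then show False using not1[OF r(1) _ gN[of x]] not1[OF r(1) _ hM[of y]] by blast
    qed
    finally show ?thesis .
  qed
  define G where "G m = (\<Sum>x<M. g x * unity_root M (x * (e' * m)))" for m
  define H where "H m = (\<Sum>y<N. h y * unity_root N (y * (f' * m)))" for m
  have fourier_split: "(\<Sum>r<q. chi r * unity_root q (r * m)) = G m * H m" for m
  proof -
    have "inj_on (\<lambda>(x, y). (x * e + y * f) mod q) ({..<M} \<times> {..<N})"
    proof (rule inj_onI, clarify)
      fix x y x' y' assume lt: "x < M" "y < N" "x' < M" "y' < N"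
        and "(x * e + y * f) mod q = (x' * e + y' * f) mod q"
      then have "[x * e + y * f = x' * e + y' * f] (mod q)" by (simp add: cong_def)
      then have "[x * e + y * f = x' * e + y' * f] (mod M)" "[x * e + y * f = x' * e + y' * f] (mod N)"
        unfolding qMN by (rule cong_dvd_modulus_nat, simp)+
      then have "[x = x'] (mod M)" "[y = y'] (mod N)"
        using cong_trans[OF cong_sym[OF lin_M] cong_trans[OF _ lin_M]]
          cong_trans[OF cong_sym[OF lin_N] cong_trans[OF _ lin_N]] by blast+
      then show "x = x' \<and> y = y'" using lt by (simp add: cong_def)
    qed
    moreover have "(\<lambda>(x, y). (x * e + y * f) mod q) ` ({..<M} \<times> {..<N}) \<subseteq> {..<q}"
      using q_pos by auto
    ultimately have "bij_betw (\<lambda>(x, y). (x * e + y * f) mod q) ({..<M} \<times> {..<N}) {..<q}"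
      using card_image[of "\<lambda>(x, y). (x * e + y * f) mod q" "{..<M} \<times> {..<N}"]
      using card_subset_eq[of "{..<q}" "(\<lambda>(x, y). (x * e + y * f) mod q) ` ({..<M} \<times> {..<N})"]
      by (simp only: bij_betw_def card_cartesian_product card_lessThan qMN finite_lessThan)
    then have "(\<Sum>r<q. chi r * unity_root q (r * m)) =
        (\<Sum>z\<in>{..<M} \<times> {..<N}. chi ((case z of (x, y) \<Rightarrow> (x * e + y * f) mod q)) *
           unity_root q ((case z of (x, y) \<Rightarrow> (x * e + y * f) mod q) * m))"
      by (rule sum.reindex_bij_betw[symmetric])
    also have "\<dots> = (\<Sum>(x, y)\<in>{..<M} \<times> {..<N}. (g x * unity_root M (x * (e' * m))) * (h y * unity_root N (y * (f' * m))))"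
    proof (intro sum.cong refl, clarify)
      fix x y
      have "unity_root q ((x * e + y * f) mod q * m) = unity_root q ((x * e + y * f) * m)"
        by (intro unity_root_cong q_pos cong_mult) (simp_all add: cong_def)
      also have "(x * e + y * f) * m = N * (x * (e' * m)) + M * (y * (f' * m))"
        by (simp add: e_def f_def algebra_simps)
      also have "unity_root q \<dots> = unity_root M (x * (e' * m)) * unity_root N (y * (f' * m))"
        using unity_root_cancel[of N M "x * (e' * m)"] unity_root_cancel[of M N "y * (f' * m)"] M1 Npos
        by (simp add: unity_root_add qMN mult.commute[of N M])
      finally show "chi ((x * e + y * f) mod q) * unity_root q ((x * e + y * f) mod q * m) =
          (g x * unity_root M (x * (e' * m))) * (h y * unity_root N (y * (f' * m)))"
        by (simp add: chi_mod split)
    qed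
    also have "\<dots> = G m * H m"
      by (simp add: G_def H_def sum_product sum.cartesian_product)
    finally show ?thesis .
  qed
  define \<kappa>' where "\<kappa>' = \<kappa> * cnj (H 1)"
  \<comment> \<open>Duality is evaluated at the pair \<open>(m, 1)\<close>, which freezes the factor
    modulo \<open>N\<close> at \<open>H 1\<close>.\<close>
  have g_dual: "g m = \<kappa>' * cnj (G m)" for m
  proof -
    have "G (m * e + f) = G m"
      unfolding G_def using M1 gM[of m]
      by (intro sum.cong refl arg_cong2[of _ _ _ _ "(*)"] unity_root_cong cong_mult cong_refl) auto
    moreover have "H (m * e + f) = H 1"
      unfolding H_def using Npos gN[of m]
      by (intro sum.cong refl arg_cong2[of _ _ _ _ "(*)"] unity_root_cong cong_mult cong_refl) auto
    ultimately show ?thesis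
      using dual[of "m * e + f"] by (simp add: fourier_split g_def \<kappa>'_def mult_ac del: cnj_sum)
  qed
  have e'M: "coprime e' M"
    using cong_imp_coprime[OF cong_sym[OF e']] by simp
  \<comment> \<open>Summing the squares of both sides of the duality for \<open>g\<close> and
    applying Parseval forces \<open>norm \<kappa>'\<close> to be \<open>1 / sqrt M\<close>; the
    value \<open>g 1 = 1\<close> then fixes the size of the Gauss sum.\<close>
  have "(\<Sum>m<M. (norm (g m))\<^sup>2) = (norm \<kappa>')\<^sup>2 * (\<Sum>m<M. (norm (G m))\<^sup>2)"
    by (simp add: g_dual norm_mult power_mult_distrib sum_distrib_left)
  also have "(\<Sum>m<M. (norm (G m))\<^sup>2) = real M * (\<Sum>m<M. (norm (g m))\<^sup>2)"
    unfolding G_def using M1 e'M by (intro finite_fourier_parseval) auto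
  finally have "(\<Sum>m<M. (norm (g m))\<^sup>2) * ((norm \<kappa>')\<^sup>2 * real M - 1) = 0"
    by (simp add: algebra_simps)
  moreover have "(\<Sum>m<M. (norm (g m))\<^sup>2) \<ge> (norm (g 1))\<^sup>2"
    using M1 by (intro member_le_sum) auto
  ultimately have kM: "(norm \<kappa>')\<^sup>2 * real M = 1" by auto
  have "1 = (norm \<kappa>')\<^sup>2 * (norm (G 1))\<^sup>2"
    using arg_cong[OF g_dual[of 1], of "\<lambda>z. (norm z)\<^sup>2"]
    by (simp add: norm_mult power_mult_distrib)
  with kM have gauss: "(norm (\<Sum>x<M. g x * unity_root M (x * e')))\<^sup>2 = real M"
  proof -
    have "(norm \<kappa>')\<^sup>2 \<noteq> 0" using kM by auto
    moreover have "(norm \<kappa>')\<^sup>2 * (norm (G 1))\<^sup>2 = (norm \<kappa>')\<^sup>2 * real M"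
      using kM \<open>1 = _\<close> by simp
    ultimately show ?thesis by (simp only: G_def mult_cancel_left mult_1_right) auto
  qed
  have unit_p: "coprime (e + p * f) q"
    unfolding qMN coprime_mult_right_iff
    using cong_imp_coprime[OF cong_sym[OF hM]] cong_imp_coprime[OF cong_sym[OF hN]] pN by simp
  have h_pow: "h (p ^ k) = h p ^ k" and chi_pow: "chi (p ^ k) = g (p ^ k) * h (p ^ k)" for k
  proof -
    show "chi (p ^ k) = g (p ^ k) * h (p ^ k)"
      unfolding split[symmetric] by (intro chi_cong crt cong_sym[OF lin_M] cong_sym[OF lin_N])
    show "h (p ^ k) = h p ^ k"
    proof (induction k)
      case 0
      show ?case using chi_cong[OF crt, of "e + 1 * f" 1] hM[of 1] hN[of 1] by (simp add: h_def)
    next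
      case (Suc k)
      have "h (p ^ Suc k) = chi ((e + p ^ k * f) * (e + p * f))"
        unfolding h_def
      proof (intro chi_cong crt)
        have "[(e + p ^ k * f) * (e + p * f) = 1] (mod M)"
          using cong_mult[OF hM[of "p ^ k"] hM[of p]] by (simp only: mult_1)
        then show "[e + p ^ Suc k * f = (e + p ^ k * f) * (e + p * f)] (mod M)"
          by (rule cong_trans[OF hM cong_sym])
        have "[(e + p ^ k * f) * (e + p * f) = p ^ Suc k] (mod N)"
          using cong_mult[OF hN[of "p ^ k"] hN[of p]] by (simp only: power_Suc2)
        then show "[e + p ^ Suc k * f = (e + p ^ k * f) * (e + p * f)] (mod N)"
          by (rule cong_trans[OF hN cong_sym])
      qed
      also have "\<dots> = h (p ^ k) * h p"
        unfolding h_def using unit_p by (rule mult_unit)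
      finally show ?case using Suc by simp
    qed
  qed
  from unit_p have hp: "norm (h p) = 1" unfolding h_def by (rule norm_unit)
  have "g (p ^ k0) \<noteq> 0" using nz chi_pow[of k0] by auto
  then obtain z where z: "norm z \<le> 1 / sqrt p" "(\<lambda>k. g (p ^ k) * z ^ k) sums 0"
    using g.prime_power_root[OF p(1) M_def a _ gauss k0] e'M a by (auto simp: M_def coprime_power_right_iff)
  have "chi (p ^ k) * (z / h p) ^ k = g (p ^ k) * z ^ k" for k
    using hp by (auto simp: chi_pow h_pow power_divide)
  then show False
    using nonvanishing[of "z / h p"] z hp by (simp add: norm_divide)
qed

text \<open>A residue not prime to \<open>q\<close> shares some prime \<open>p\<close> with it. Its
  full power of \<open>p\<close> splits off by multiplicativity and already carries the value
  0.\<close>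

lemma primitive_of_self_dual:
  assumes dual: "\<And>m. chi m = \<kappa> * cnj (\<Sum>r<q. chi r * unity_root q (r * m))"
    and nonvanishing: "\<And>p z. prime p \<Longrightarrow> norm z \<le> 1 / sqrt (real p) \<Longrightarrow> \<not> (\<lambda>k. chi (p ^ k) * z ^ k) sums 0"
  shows "primitive_character q chi"
proof (rule primitive_of_support[OF dual])
  fix n assume n: "\<not> coprime n q"
  define n' where "n' = (if n = 0 then q else n)"
  have n': "n' > 0" "chi n = chi n'" "gcd n' q \<noteq> 1"
    using q_pos n periodic[of 0] by (auto simp: n'_def coprime_iff_gcd_eq_1 simp del: coprime_imp_gcd_eq_1)
  then obtain p where p: "prime p" "p dvd n'" "p dvd q"
    using prime_factor_nat[of "gcd n' q"] by auto
  define k where "k = multiplicity p n'"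
  obtain u where u: "n' = p ^ k * u" "\<not> p dvd u"
    using multiplicity_decompose'[of n' p] n' p k_def by (metis neq0_conv not_prime_unit)
  have "k > 0" using p u by (cases k) auto
  then have "chi (p ^ k) = 0"
    using p nonvanishing by (intro vanishes_at_prime_power[OF dual]) auto
  moreover have "coprime (p ^ k) u" using u p by (simp add: prime_imp_coprime)
  ultimately show "chi n = 0" using n' u mult by simp
qed

end

section \<open>Dirichlet series with an Euler product\<close>

text \<open>The finitely many terms before the asymptotic bound sets in are absorbed into the
  constant. \<open>n = 0\<close> is excluded because \<open>0 powr \<delta> = 0\<close>.\<close>

lemma bigo_powr_bound:
  fixes f :: "nat \<Rightarrow> real"
  assumes "f \<in> O(\<lambda>n. real n powr \<delta>)"
  obtains C where "C > 0" "\<And>n. n > 0 \<Longrightarrow> \<bar>f n\<bar> \<le> C * real n powr \<delta>"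
proof -
  obtain c where c: "c > 0" "eventually (\<lambda>n. norm (f n) \<le> c * norm (real n powr \<delta>)) at_top"
    using landau_o.bigE[OF assms] by blast
  then obtain N where N: "\<And>n. n \<ge> N \<Longrightarrow> \<bar>f n\<bar> \<le> c * real n powr \<delta>"
    by (auto simp: eventually_at_top_linorder)
  define C where "C = c + (\<Sum>n<N. \<bar>f n\<bar> / real n powr \<delta>)"
  have "\<bar>f n\<bar> \<le> C * real n powr \<delta>" if "n > 0" for n
  proof (cases "n < N")
    case True
    have pos: "real n powr \<delta> > 0" using that by simp
    have "\<bar>f n\<bar> / real n powr \<delta> \<le> (\<Sum>n<N. \<bar>f n\<bar> / real n powr \<delta>)"
      using True by (intro member_le_sum) auto
    also have "\<dots> \<le> C" using c by (simp add: C_def)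
    finally show ?thesis using pos by (simp add: divide_le_eq)
  next
    case False
    have "(\<Sum>n<N. \<bar>f n\<bar> / real n powr \<delta>) \<ge> 0" by (intro sum_nonneg) auto
    then have "c * real n powr \<delta> \<le> C * real n powr \<delta>"
      unfolding C_def by (intro mult_right_mono) auto
    then show ?thesis using N[of n] False by linarith
  qed
  moreover have "C > 0"
    unfolding C_def using c by (intro add_pos_nonneg sum_nonneg) auto
  ultimately show thesis using that by blast
qed

text \<open>Once the earlier coefficients vanish, the first remaining term dominates as the exponent
  grows: relative to it the tail is \<open>O(\<rho> ^ j)\<close>. Integer exponents suffice for
  this, which keeps complex powers out of the argument.\<close>

lemma dirichlet_coefficients_unique:
  fixes c :: "nat \<Rightarrow> complex"
  assumes summ: "summable (\<lambda>n. norm (c (Suc n)) / real (Suc n) ^ k0)"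
    and zero: "\<And>k. k \<ge> k0 \<Longrightarrow> (\<lambda>n. c (Suc n) / of_nat (Suc n) ^ k) sums 0"
  shows "c (Suc n) = 0"
proof (induction n rule: less_induct)
  case (less N)
  define \<rho> where "\<rho> = real (Suc N) / real (Suc (Suc N))"
  have \<rho>: "0 < \<rho>" "\<rho> < 1" by (auto simp: \<rho>_def)
  define K where "K = (\<Sum>n. norm (c (Suc n)) / real (Suc n) ^ k0)"
  have bound: "norm (c (Suc N)) \<le> real (Suc N) ^ k0 * K * \<rho> ^ j" for j
  proof -
    define k where "k = k0 + j"
    let ?f = "\<lambda>n. c (Suc n) / of_nat (Suc n) ^ k"
    have "?f sums 0" using zero by (simp add: k_def)
    moreover have "(\<Sum>i<N. ?f i) = 0" using less by simp
    ultimately have "(\<lambda>i. ?f (i + N)) sums 0"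
      using sums_iff_shift'[of ?f N 0] by simp
    then have "(\<lambda>i. ?f (Suc i + N)) sums (0 - ?f N)"
      using sums_Suc_iff[of "\<lambda>i. ?f (i + N)" "0 - ?f N"] by simp
    then have s: "(\<lambda>i. c (Suc (Suc i + N)) / of_nat (Suc (Suc i + N)) ^ k) sums (- ?f N)"
      by simp
    have summ': "summable (\<lambda>i. norm (c (Suc (Suc i + N))) / real (Suc (Suc i + N)) ^ k0)"
      using summable_ignore_initial_segment[OF summ, of "Suc N"] by simp
    have le: "norm (c (Suc (Suc i + N)) / of_nat (Suc (Suc i + N)) ^ k) \<le>
        norm (c (Suc (Suc i + N))) / real (Suc (Suc i + N)) ^ k0 * (1 / real (Suc (Suc N)) ^ j)" for i
    proof -
      have "real (Suc (Suc N)) ^ j \<le> real (Suc (Suc i + N)) ^ j"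
        by (intro power_mono) auto
      then have "1 / real (Suc (Suc i + N)) ^ j \<le> 1 / real (Suc (Suc N)) ^ j"
        by (intro divide_left_mono) (auto intro!: mult_pos_pos)
      then have "norm (c (Suc (Suc i + N))) / real (Suc (Suc i + N)) ^ k0 * (1 / real (Suc (Suc i + N)) ^ j)
          \<le> norm (c (Suc (Suc i + N))) / real (Suc (Suc i + N)) ^ k0 * (1 / real (Suc (Suc N)) ^ j)"
        by (intro mult_left_mono) auto
      moreover have "norm (c (Suc (Suc i + N)) / of_nat (Suc (Suc i + N)) ^ k) =
          norm (c (Suc (Suc i + N))) / real (Suc (Suc i + N)) ^ k0 * (1 / real (Suc (Suc i + N)) ^ j)"
        unfolding k_def norm_divide norm_power norm_of_nat by (simp add: power_add del: of_nat_Suc)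
      ultimately show ?thesis by simp
    qed
    have "norm (?f N) = norm (\<Sum>i. c (Suc (Suc i + N)) / of_nat (Suc (Suc i + N)) ^ k)"
      using sums_unique[OF s] by (metis norm_minus_cancel)
    also have "\<dots> \<le> (\<Sum>i. norm (c (Suc (Suc i + N))) / real (Suc (Suc i + N)) ^ k0 * (1 / real (Suc (Suc N)) ^ j))"
      by (intro norm_suminf_le[OF le] summable_mult2[OF summ'])
    also have "\<dots> = (\<Sum>i. norm (c (Suc (Suc i + N))) / real (Suc (Suc i + N)) ^ k0) * (1 / real (Suc (Suc N)) ^ j)"
      by (rule suminf_mult2[OF summ', symmetric])
    also have "\<dots> \<le> K * (1 / real (Suc (Suc N)) ^ j)"
    proof (rule mult_right_mono)
      have "K = (\<Sum>i. norm (c (Suc (i + Suc N))) / real (Suc (i + Suc N)) ^ k0) + (\<Sum>i<Suc N. norm (c (Suc i)) / real (Suc i) ^ k0)"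
        unfolding K_def by (rule suminf_split_initial_segment[OF summ])
      moreover have "(\<Sum>i<Suc N. norm (c (Suc i)) / real (Suc i) ^ k0) \<ge> 0"
        by (intro sum_nonneg) auto
      ultimately show "(\<Sum>i. norm (c (Suc (Suc i + N))) / real (Suc (Suc i + N)) ^ k0) \<le> K" by simp
    qed auto
    finally have "norm (c (Suc N)) / real (Suc N) ^ k \<le> K * (1 / real (Suc (Suc N)) ^ j)"
      by (simp add: norm_divide norm_power del: of_nat_Suc)
    then have "norm (c (Suc N)) \<le> K * (1 / real (Suc (Suc N)) ^ j) * real (Suc N) ^ k"
      by (subst (asm) pos_divide_le_eq) auto
    also have "\<dots> = real (Suc N) ^ k0 * K * \<rho> ^ j"
      by (simp add: k_def \<rho>_def power_add power_divide)
    finally show ?thesis .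
  qed
  have "(\<lambda>j. real (Suc N) ^ k0 * K * \<rho> ^ j) \<longlonglongrightarrow> real (Suc N) ^ k0 * K * 0"
    by (intro tendsto_intros LIMSEQ_realpow_zero) (use \<rho> in auto)
  then have "norm (c (Suc N)) \<le> real (Suc N) ^ k0 * K * 0"
    by (rule LIMSEQ_le_const) (use bound in auto)
  then show ?case by simp
qed

text \<open>Absolute convergence permits regrouping the double sum over pairs of factors by their
  product; \<open>(n, d)\<close> corresponds to the pair \<open>(d, n div d)\<close>.\<close>

lemma dirichlet_product_sums:
  fixes f g :: "nat \<Rightarrow> complex"
  assumes f: "summable (\<lambda>n. norm (f (Suc n)) / real (Suc n) ^ k)"
    and g: "summable (\<lambda>n. norm (g (Suc n)) / real (Suc n) ^ k)"
  defines "h \<equiv> \<lambda>n. \<Sum>d | d dvd n. f d * g (n div d)"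
  shows "summable (\<lambda>n. norm (h (Suc n)) / real (Suc n) ^ k)"
    and "(\<lambda>n. h (Suc n) / of_nat (Suc n) ^ k) sums
      ((\<Sum>n. f (Suc n) / of_nat (Suc n) ^ k) * (\<Sum>n. g (Suc n) / of_nat (Suc n) ^ k))"
proof -
  define P where "P = {n::nat. n > 0}"
  have Suc_bij: "bij_betw Suc UNIV P"
    by (rule bij_betwI[of _ _ _ "\<lambda>n. n - 1"]) (auto simp: P_def)
  define u where "u \<phi> n = \<phi> n / of_nat n ^ k" for \<phi> :: "nat \<Rightarrow> complex" and n :: nat
  have abs: "(\<lambda>n. norm (u \<phi> n)) summable_on P" if "summable (\<lambda>n. norm (\<phi> (Suc n)) / real (Suc n) ^ k)" for \<phi>
  proof -
    have "(\<lambda>n. norm (u \<phi> (Suc n))) summable_on UNIV"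
      using that by (subst summable_on_UNIV_nonneg_real_iff)
        (auto simp: u_def norm_divide norm_power simp del: of_nat_Suc)
    then show ?thesis
      using summable_on_reindex_bij_betw[OF Suc_bij, of "\<lambda>n. norm (u \<phi> n)"] by simp
  qed
  have val: "(\<Sum>\<^sub>\<infinity>n\<in>P. u \<phi> n) = (\<Sum>n. u \<phi> (Suc n))" if "summable (\<lambda>n. norm (\<phi> (Suc n)) / real (Suc n) ^ k)" for \<phi>
  proof -
    have "(\<Sum>\<^sub>\<infinity>n\<in>P. u \<phi> n) = (\<Sum>\<^sub>\<infinity>n. u \<phi> (Suc n))"
      using infsum_reindex_bij_betw[OF Suc_bij, of "u \<phi>"] by simp
    also have "summable (\<lambda>n. norm (u \<phi> (Suc n)))"
      using that by (simp add: u_def norm_divide norm_power del: of_nat_Suc)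
    then have "(\<Sum>\<^sub>\<infinity>n. u \<phi> (Suc n)) = (\<Sum>n. u \<phi> (Suc n))"
      by (metis infsumI norm_summable_imp_has_sum summable_norm_cancel summable_sums)
    finally show ?thesis .
  qed
  have prod_abs: "(\<lambda>x. norm (case x of (m, n) \<Rightarrow> u f m * u g n)) summable_on P \<times> P"
    using Infinite_Set_Sum.abs_summable_on_product[of P P "u f" "u g"] abs[OF f] abs[OF g]
    by (simp add: abs_summable_equivalent[symmetric] countable_subset[OF subset_UNIV])
  have "(\<Sum>\<^sub>\<infinity>(m, n)\<in>P \<times> P. u f m * u g n) = (\<Sum>\<^sub>\<infinity>m\<in>P. \<Sum>\<^sub>\<infinity>n\<in>P. u f m * u g n)"
    by (rule infsum_Sigma'_banach[symmetric], rule abs_summable_summable, rule prod_abs)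
  also have "\<dots> = (\<Sum>\<^sub>\<infinity>n\<in>P. u f n) * (\<Sum>\<^sub>\<infinity>n\<in>P. u g n)"
    by (simp add: infsum_cmult_left' infsum_cmult_right')
  finally have prod_sum: "((\<lambda>(m, n). u f m * u g n) has_sum (\<Sum>\<^sub>\<infinity>n\<in>P. u f n) * (\<Sum>\<^sub>\<infinity>n\<in>P. u g n)) (P \<times> P)"
    using has_sum_infsum[OF abs_summable_summable[OF prod_abs]] by simp
  define D where "D = (\<lambda>n::nat. {d. d dvd n})"
  have bij: "bij_betw (\<lambda>(n, d). (d, n div d)) (Sigma P D) (P \<times> P)"
    by (rule bij_betwI[of _ _ _ "\<lambda>(m, n). (m * n, m)"]) (auto simp: P_def D_def elim!: dvdE)
  have fin: "finite (D n)" if "n \<in> P" for n using that by (auto simp: P_def D_def)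
  have uh: "(\<Sum>d\<in>D n. u f d * u g (n div d)) = u h n" if "n \<in> P" for n
  proof -
    have "u f d * u g (n div d) = f d * g (n div d) / of_nat n ^ k" if "d \<in> D n" for d
      using that by (auto simp: D_def u_def elim!: dvdE) (simp add: power_mult_distrib)
    then have "(\<Sum>d\<in>D n. u f d * u g (n div d)) = (\<Sum>d\<in>D n. f d * g (n div d) / of_nat n ^ k)"
      by (intro sum.cong refl)
    then show ?thesis by (simp add: u_def h_def D_def sum_divide_distrib)
  qed
  have "((\<lambda>(n, d). u f d * u g (n div d)) has_sum (\<Sum>\<^sub>\<infinity>n\<in>P. u f n) * (\<Sum>\<^sub>\<infinity>n\<in>P. u g n)) (Sigma P D)"
    using has_sum_reindex_bij_betw[OF bij, of "\<lambda>(m, n). u f m * u g n"] prod_sum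
    by (simp add: case_prod_unfold)
  then have hs: "(u h has_sum (\<Sum>\<^sub>\<infinity>n\<in>P. u f n) * (\<Sum>\<^sub>\<infinity>n\<in>P. u g n)) P"
    by (rule has_sum_SigmaD) (use uh fin in \<open>auto intro!: has_sum_finiteI\<close>)
  have abs_sig: "(\<lambda>(n, d). norm (u f d * u g (n div d))) summable_on (Sigma P D)"
    using summable_on_reindex_bij_betw[OF bij, of "\<lambda>(m, n). norm (u f m * u g n)"] prod_abs
    by (simp add: case_prod_unfold)
  have "(\<lambda>n. \<Sum>\<^sub>\<infinity>d\<in>D n. norm (u f d * u g (n div d))) summable_on P"
    using summable_on_Sigma_banach[of "\<lambda>n d. norm (u f d * u g (n div d))" P D] abs_sig by simp
  then have "(\<lambda>n. norm (u h n)) summable_on P"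
  proof (rule summable_on_comparison_test)
    fix n assume n: "n \<in> P"
    have "norm (u h n) \<le> (\<Sum>d\<in>D n. norm (u f d * u g (n div d)))"
      unfolding uh[OF n, symmetric] by (rule norm_sum)
    then show "norm (u h n) \<le> (\<Sum>\<^sub>\<infinity>d\<in>D n. norm (u f d * u g (n div d)))"
      using fin[OF n] by simp
  qed auto
  then have "(\<lambda>n. norm (u h (Suc n))) summable_on UNIV"
    using summable_on_reindex_bij_betw[OF Suc_bij, of "\<lambda>n. norm (u h n)"] by simp
  then have "summable (\<lambda>n. norm (u h (Suc n)))"
    by (subst (asm) summable_on_UNIV_nonneg_real_iff) auto
  then show sh: "summable (\<lambda>n. norm (h (Suc n)) / real (Suc n) ^ k)"
    by (simp add: u_def norm_divide norm_power del: of_nat_Suc)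
  have "summable (\<lambda>n. u h (Suc n))"
    using \<open>summable (\<lambda>n. norm (u h (Suc n)))\<close> by (rule summable_norm_cancel)
  moreover have "(\<Sum>n. u h (Suc n)) = (\<Sum>n. u f (Suc n)) * (\<Sum>n. u g (Suc n))"
    using val[OF sh] val[OF f] val[OF g] infsumI[OF hs] by simp
  ultimately show "(\<lambda>n. h (Suc n) / of_nat (Suc n) ^ k) sums
      ((\<Sum>n. f (Suc n) / of_nat (Suc n) ^ k) * (\<Sum>n. g (Suc n) / of_nat (Suc n) ^ k))"
    by (simp add: u_def sums_iff)
qed

text \<open>On \<open>Re s > 2\<close> coefficients of size \<open>sqrt n\<close> leave the uniform
  majorant \<open>n powr (-3/2)\<close>, which justifies differentiating term by term.\<close>

lemma dirichlet_series_deriv: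
  fixes c :: "nat \<Rightarrow> complex"
  assumes bound: "\<And>n. n > 0 \<Longrightarrow> norm (c n) \<le> K * real n powr (1/2)"
  obtains D D' where
    "\<And>s. Re s > 2 \<Longrightarrow> (\<lambda>n. c (Suc n) * of_nat (Suc n) powr (- s)) sums D s"
    "\<And>s. Re s > 2 \<Longrightarrow> (\<lambda>n. - (c (Suc n) * of_real (ln (real (Suc n)))) * of_nat (Suc n) powr (- s)) sums D' s"
    "\<And>s. Re s > 2 \<Longrightarrow> (D has_field_derivative D' s) (at s)"
proof -
  let ?S = "{s. Re s > 2}"
  have op: "open ?S" by (rule open_halfspace_Re_gt)
  have der: "((\<lambda>s. c (Suc n) * of_nat (Suc n) powr (- s)) has_field_derivative
      - (c (Suc n) * of_real (ln (real (Suc n)))) * of_nat (Suc n) powr (- s)) (at s)" for n s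
  proof -
    have "((\<lambda>s. of_nat (Suc n) powr (- s)) has_field_derivative
        (of_real (ln (real (Suc n))) * of_nat (Suc n) powr (- s)) * (- 1)) (at s)"
      using has_field_derivative_powr_right[of "of_nat (Suc n)" "- s"]
      by (intro DERIV_chain2[where f = "\<lambda>z. of_nat (Suc n) powr z" and g = uminus])
         (auto intro!: derivative_eq_intros simp: Ln_of_nat simp del: of_nat_Suc)
    from DERIV_cmult[OF this, of "c (Suc n)"] show ?thesis by (simp add: mult_ac)
  qed
  have summ: "summable (\<lambda>n. K * real (Suc n) powr (-3/2))"
  proof -
    have "summable (\<lambda>n. real n powr (-3/2))" by (simp add: summable_real_powr_iff)
    then show ?thesis by (subst (asm) summable_Suc_iff[symmetric]) (rule summable_mult)
  qed
  have le: "norm (c (Suc n) * of_nat (Suc n) powr (- s)) \<le> K * real (Suc n) powr (-3/2)" if "s \<in> ?S" for n s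
  proof -
    have "norm (c (Suc n) * of_nat (Suc n) powr (- s)) = norm (c (Suc n)) * real (Suc n) powr (- Re s)"
      using norm_powr_real_powr[of "of_nat (Suc n)" "- s"] by (simp add: norm_mult del: of_nat_Suc)
    also have "\<dots> \<le> K * real (Suc n) powr (1/2) * real (Suc n) powr (- 2)"
      using that bound[of "Suc n"] by (intro mult_mono powr_mono) (auto intro: order_trans[OF norm_ge_zero])
    also have "\<dots> = K * real (Suc n) powr (-3/2)"
      by (simp flip: powr_add)
    finally show ?thesis .
  qed
  have "K \<ge> 0" using bound[of 1] by (auto intro: order_trans[OF norm_ge_zero])
  define h where "h n = complex_of_real (K * real (Suc n) powr (-3/2))" for n
  have "summable h"
    unfolding h_def using summ by (simp only: summable_of_real_iff)
  moreover have "range h \<subseteq> \<real>\<^sub>\<ge>\<^sub>0" using \<open>K \<ge> 0\<close> by (auto simp: h_def)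
  moreover have "norm (h n) = K * real (Suc n) powr (-3/2)" for n
    unfolding h_def norm_of_real using \<open>K \<ge> 0\<close> by (simp del: of_nat_Suc)
  ultimately have "\<exists>d h. 0 < d \<and> summable h \<and> range h \<subseteq> \<real>\<^sub>\<ge>\<^sub>0 \<and>
      (\<forall>\<^sub>F n in sequentially. \<forall>y\<in>ball s d \<inter> ?S. norm (c (Suc n) * of_nat (Suc n) powr (- y)) \<le> norm (h n :: complex))"
    if "s \<in> ?S" for s
    by (intro exI[of _ "1::real"] exI[of _ h]) (use le in \<open>auto simp del: of_nat_Suc\<close>)
  from series_and_derivative_comparison_complex[OF op der this]
  obtain D D' where "\<forall>s\<in>?S. (\<lambda>n. c (Suc n) * of_nat (Suc n) powr (- s)) sums D s \<and>
     (\<lambda>n. - (c (Suc n) * of_real (ln (real (Suc n)))) * of_nat (Suc n) powr (- s)) sums D' s \<and>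
     (D has_field_derivative D' s) (at s)"
    by blast
  then show thesis by (intro that[of D D']) auto
qed

text \<open>The logarithm is estimated crudely by \<open>ln n \<le> n\<close>, which is why the
  exponent starts at 3.\<close>

lemma dirichlet_summable_norm:
  fixes c :: "nat \<Rightarrow> complex"
  assumes bound: "\<And>n. n > 0 \<Longrightarrow> norm (c n) \<le> K * real n powr (1/2)" and "k \<ge> 3"
  shows "summable (\<lambda>n. norm (of_real (ln (real (Suc n))) * c (Suc n)) / real (Suc n) ^ k)"
    and "summable (\<lambda>n. norm (c (Suc n)) / real (Suc n) ^ k)"
proof -
  have summ: "summable (\<lambda>n. K * real (Suc n) powr (-3/2))"
  proof -
    have "summable (\<lambda>n. real n powr (-3/2))" by (simp add: summable_real_powr_iff)
    then show ?thesis by (subst (asm) summable_Suc_iff[symmetric]) (rule summable_mult)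
  qed
  have K: "K \<ge> 0" using bound[of 1] by (auto intro: order_trans[OF norm_ge_zero])
  have le: "x * norm (c (Suc n)) / real (Suc n) ^ k \<le> K * real (Suc n) powr (-3/2)"
    if "0 \<le> x" "x \<le> real (Suc n)" for n x
  proof -
    have "x * norm (c (Suc n)) / real (Suc n) ^ k \<le> real (Suc n) * (K * real (Suc n) powr (1/2)) / real (Suc n) ^ 3"
      using that bound[of "Suc n"] assms(2) K by (intro frac_le mult_mono power_increasing) auto
    also have "\<dots> = K * (real (Suc n) powr 1 * real (Suc n) powr (1/2) * real (Suc n) powr (- 3))"
      by (simp add: powr_minus_divide del: of_nat_Suc)
    also have "real (Suc n) powr 1 * real (Suc n) powr (1/2) * real (Suc n) powr (- 3) = real (Suc n) powr (-3/2)"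
      by (simp only: powr_add[symmetric]) simp
    finally show ?thesis .
  qed
  show "summable (\<lambda>n. norm (of_real (ln (real (Suc n))) * c (Suc n)) / real (Suc n) ^ k)"
  proof (rule summable_comparison_test'[OF summ, of 0])
    fix n
    have "0 \<le> ln (real (Suc n))" "ln (real (Suc n)) \<le> real (Suc n)"
      using ln_le_minus_one[of "real (Suc n)"] by auto
    from le[OF this] show "norm (norm (of_real (ln (real (Suc n))) * c (Suc n)) / real (Suc n) ^ k) \<le> K * real (Suc n) powr (-3/2)"
      by (simp add: norm_mult del: of_nat_Suc)
  qed
  show "summable (\<lambda>n. norm (c (Suc n)) / real (Suc n) ^ k)"
    by (rule summable_comparison_test'[OF summ, of 0]) (use le[of 1] in \<open>simp del: of_nat_Suc\<close>)
qed

text \<open>Compares coefficients in \<open>F' = (log F)' * F\<close>. Differentiating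
  \<open>F = exp B\<close>, with \<open>B\<close> the series of the \<open>b n\<close>, makes the
  choice of branch of the logarithm irrelevant.\<close>

lemma log_recurrence:
  fixes a b :: "nat \<Rightarrow> complex"
  assumes a: "\<And>n. n > 0 \<Longrightarrow> norm (a n) \<le> Ka * real n powr (1/2)"
    and b: "\<And>n. n > 0 \<Longrightarrow> norm (b n) \<le> Kb * real n powr (1/2)"
    and exp_log: "\<And>s. Re s > 1 \<Longrightarrow> (\<lambda>n. a (Suc n) * of_nat (Suc n) powr (- s)) sums F s \<and>
       (\<exists>l. (\<lambda>n. b (Suc n) * of_nat (Suc n) powr (- s)) sums l \<and> exp l = F s)"
    and n: "n > 0"
  shows "of_real (ln (real n)) * a n = (\<Sum>d | d dvd n. of_real (ln (real d)) * b d * a (n div d))"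
proof -
  obtain A A' where A: "\<And>s. Re s > 2 \<Longrightarrow> (\<lambda>n. a (Suc n) * of_nat (Suc n) powr (- s)) sums A s"
    "\<And>s. Re s > 2 \<Longrightarrow> (\<lambda>n. - (a (Suc n) * of_real (ln (real (Suc n)))) * of_nat (Suc n) powr (- s)) sums A' s"
    "\<And>s. Re s > 2 \<Longrightarrow> (A has_field_derivative A' s) (at s)"
    by (rule dirichlet_series_deriv[OF a]) blast+
  obtain B B' where B: "\<And>s. Re s > 2 \<Longrightarrow> (\<lambda>n. b (Suc n) * of_nat (Suc n) powr (- s)) sums B s"
    "\<And>s. Re s > 2 \<Longrightarrow> (\<lambda>n. - (b (Suc n) * of_real (ln (real (Suc n)))) * of_nat (Suc n) powr (- s)) sums B' s"
    "\<And>s. Re s > 2 \<Longrightarrow> (B has_field_derivative B' s) (at s)"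
    by (rule dirichlet_series_deriv[OF b]) blast+
  have AB: "A s = exp (B s)" if s2: "Re s > 2" for s
  proof -
    obtain l where "(\<lambda>n. a (Suc n) * of_nat (Suc n) powr (- s)) sums F s"
      "(\<lambda>n. b (Suc n) * of_nat (Suc n) powr (- s)) sums l" "exp l = F s"
      using exp_log[of s] s2 by auto
    then show ?thesis
      using sums_unique2[OF A(1)[OF s2]] sums_unique2[OF B(1)[OF s2]] by metis
  qed
  have deriv: "A' s = B' s * A s" if s: "Re s > 2" for s
  proof -
    have "((\<lambda>s. exp (B s)) has_field_derivative exp (B s) * B' s) (at s)"
      by (rule DERIV_chain2[OF DERIV_exp B(3)[OF s]])
    then have "(A has_field_derivative exp (B s) * B' s) (at s)"
    proof (rule has_field_derivative_transform_within_open)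
      show "open {s. Re s > 2}" by (rule open_halfspace_Re_gt)
    qed (use s AB in auto)
    from DERIV_unique[OF A(3)[OF s] this] show ?thesis using AB[OF s] by simp
  qed
  define \<alpha> where "\<alpha> n = of_real (ln (real n)) * a n" for n
  define \<beta> where "\<beta> n = of_real (ln (real n)) * b n" for n
  define c where "c n = \<alpha> n - (\<Sum>d | d dvd n. \<beta> d * a (n div d))" for n
  have powr_nat: "x * of_nat (Suc n) powr (- of_nat k) = x / of_nat (Suc n) ^ k" for n k and x :: complex
    by (simp add: powr_minus powr_nat' divide_inverse del: of_nat_Suc)
  have k: "summable (\<lambda>n. norm (c (Suc n)) / real (Suc n) ^ k) \<and> (\<lambda>n. c (Suc n) / of_nat (Suc n) ^ k) sums 0" if "k \<ge> 3" for k
  proof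
    have Rek: "Re (of_nat k) > 2" using that by simp
    have sa: "(\<lambda>n. a (Suc n) / of_nat (Suc n) ^ k) sums A (of_nat k)"
      using A(1)[OF Rek] by (simp only: powr_nat)
    have s\<alpha>: "(\<lambda>n. \<alpha> (Suc n) / of_nat (Suc n) ^ k) sums (- A' (of_nat k))"
      using sums_minus[OF A(2)[OF Rek]] by (simp only: powr_nat \<alpha>_def) (simp add: mult.commute)
    have s\<beta>: "(\<lambda>n. \<beta> (Suc n) / of_nat (Suc n) ^ k) sums (- B' (of_nat k))"
      using sums_minus[OF B(2)[OF Rek]] by (simp only: powr_nat \<beta>_def) (simp add: mult.commute)
    note summ\<alpha> = dirichlet_summable_norm(1)[OF a that, folded \<alpha>_def]
    note summ = dirichlet_product_sums[OF dirichlet_summable_norm(1)[OF b that, folded \<beta>_def] dirichlet_summable_norm(2)[OF a that]]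
    have "(\<lambda>n. \<alpha> (Suc n) / of_nat (Suc n) ^ k - (\<Sum>d | d dvd Suc n. \<beta> d * a (Suc n div d)) / of_nat (Suc n) ^ k)
        sums (- A' (of_nat k) - (- B' (of_nat k)) * A (of_nat k))"
      using sums_diff[OF s\<alpha> summ(2)] sums_unique[OF s\<beta>] sums_unique[OF sa] by simp
    then show "(\<lambda>n. c (Suc n) / of_nat (Suc n) ^ k) sums 0"
      using deriv[OF Rek] by (simp add: c_def diff_divide_distrib)
    show "summable (\<lambda>n. norm (c (Suc n)) / real (Suc n) ^ k)"
    proof (rule summable_comparison_test'[OF summable_add[OF summ\<alpha> summ(1)], of 0])
      fix n
      show "norm (norm (c (Suc n)) / real (Suc n) ^ k) \<le> norm (\<alpha> (Suc n)) / real (Suc n) ^ k +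
          norm (\<Sum>d | d dvd Suc n. \<beta> d * a (Suc n div d)) / real (Suc n) ^ k"
        unfolding c_def add_divide_distrib[symmetric] real_norm_def abs_divide
        by (simp add: divide_right_mono norm_triangle_ineq4 del: of_nat_Suc)
    qed
  qed
  have "c (Suc m) = 0" for m
    by (rule dirichlet_coefficients_unique[of c 3]) (use k in auto)
  from this[of "n - 1"] show ?thesis using n by (simp add: c_def \<alpha>_def \<beta>_def)
qed

text \<open>A prime power dividing \<open>m * n\<close> divides \<open>m\<close> or
  \<open>n\<close>, and the divisor 1 has weight \<open>ln 1 = 0\<close>. The recurrence for
  \<open>m * n\<close> thus splits into those for \<open>m\<close> and \<open>n\<close>, and by
  induction its value is \<open>(ln m + ln n) * a m * a n\<close>.\<close>

lemma multiplicative_of_log_recurrence: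
  fixes a b :: "nat \<Rightarrow> complex"
  assumes rec: "\<And>n. n > 0 \<Longrightarrow> of_real (ln (real n)) * a n = (\<Sum>d | d dvd n. of_real (ln (real d)) * b d * a (n div d))"
    and supp: "\<And>n. b n \<noteq> 0 \<Longrightarrow> primepow n" and a1: "a 1 = 1"
    and mn: "m > 0" "n > 0" "coprime m n"
  shows "a (m * n) = a m * a n"
  using mn
proof (induction "m * n" arbitrary: m n rule: less_induct)
  case less
  define \<beta> where "\<beta> d = of_real (ln (real d)) * b d" for d
  show ?case
  proof (cases "m * n = 1")
    case False
    have dvd_cases: "d dvd m \<or> d dvd n" if "d dvd m * n" "\<beta> d \<noteq> 0" for d
    proof -
      have "primepow d" using that supp[of d] by (auto simp: \<beta>_def)
      then obtain p k where p: "prime p" "k > 0" "d = p ^ k" by (auto simp: primepow_def)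
      show ?thesis
      proof (cases "p dvd m")
        case True
        then have "coprime d n" using less.prems p
          by (metis coprime_absorb_left coprime_common_divisor_nat coprime_power_left_iff not_prime_1 prime_imp_coprime One_nat_def)
        then show ?thesis using that(1) by (simp add: coprime_dvd_mult_left_iff)
      next
        case False
        then have "coprime d m" using p by (simp add: prime_imp_coprime)
        then show ?thesis using that(1) by (simp add: coprime_dvd_mult_right_iff)
      qed
    qed
    let ?Dm = "{d. d dvd m \<and> d \<noteq> 1}" and ?Dn = "{d. d dvd n \<and> d \<noteq> 1}"
    have fin: "finite ?Dm" "finite ?Dn" "finite {d. d dvd m * n}" using less.prems by auto
    have disj: "?Dm \<inter> ?Dn = {}"
      using less.prems(3) coprime_common_divisor_nat by auto
    have \<beta>1: "\<beta> 1 = 0" by (simp add: \<beta>_def)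
    have "of_real (ln (real (m * n))) * a (m * n) = (\<Sum>d | d dvd m * n. \<beta> d * a (m * n div d))"
      using rec[of "m * n"] less.prems by (simp add: \<beta>_def)
    also have "\<dots> = (\<Sum>d\<in>?Dm \<union> ?Dn. \<beta> d * a (m * n div d))"
      by (rule sum.mono_neutral_right[OF fin(3)]) (use dvd_cases \<beta>1 in \<open>auto simp del: One_nat_def\<close>)
    also have "\<dots> = (\<Sum>d\<in>?Dm. \<beta> d * a (m * n div d)) + (\<Sum>d\<in>?Dn. \<beta> d * a (m * n div d))"
      by (rule sum.union_disjoint[OF fin(1,2) disj])
    also have "(\<Sum>d\<in>?Dm. \<beta> d * a (m * n div d)) = (\<Sum>d\<in>?Dm. \<beta> d * a (m div d)) * a n"
      unfolding sum_distrib_right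
    proof (intro sum.cong refl)
      fix d assume d: "d \<in> ?Dm"
      then obtain e where e: "m = d * e" by auto
      then have "e > 0" "d > 1" using less.prems d by (cases "d = 0", auto)
      then have "e * n < m * n" using less.prems e by simp
      from less.hyps[OF this] show "\<beta> d * a (m * n div d) = \<beta> d * a (m div d) * a n"
        using less.prems e \<open>e > 0\<close> \<open>d > 1\<close> by (simp add: mult.assoc)
    qed
    also have "(\<Sum>d\<in>?Dn. \<beta> d * a (m * n div d)) = a m * (\<Sum>d\<in>?Dn. \<beta> d * a (n div d))"
      unfolding sum_distrib_left
    proof (intro sum.cong refl)
      fix d assume d: "d \<in> ?Dn"
      then obtain e where e: "n = d * e" by auto
      then have "e > 0" "d > 1" using less.prems d by (cases "d = 0", auto)
      then have "m * e < m * n" using less.prems e by simp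
      from less.hyps[OF this] show "\<beta> d * a (m * n div d) = a m * (\<beta> d * a (n div d))"
        using less.prems e \<open>e > 0\<close> \<open>d > 1\<close> by (simp add: mult_ac)
    qed
    also have "(\<Sum>d\<in>?Dm. \<beta> d * a (m div d)) = (\<Sum>d | d dvd m. \<beta> d * a (m div d))"
      by (rule sum.mono_neutral_left) (use \<beta>1 less.prems in \<open>auto simp del: One_nat_def\<close>)
    also have "\<dots> = of_real (ln (real m)) * a m"
      using rec[of m] less.prems by (simp add: \<beta>_def)
    also have "(\<Sum>d\<in>?Dn. \<beta> d * a (n div d)) = (\<Sum>d | d dvd n. \<beta> d * a (n div d))"
      by (rule sum.mono_neutral_left) (use \<beta>1 less.prems in \<open>auto simp del: One_nat_def\<close>)
    also have "\<dots> = of_real (ln (real n)) * a n"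
      using rec[of n] less.prems by (simp add: \<beta>_def)
    finally have "of_real (ln (real (m * n))) * a (m * n) = of_real (ln (real m) + ln (real n)) * (a m * a n)"
      by (simp add: algebra_simps)
    also have "ln (real m) + ln (real n) = ln (real (m * n))"
      using less.prems by (simp add: ln_mult)
    finally have "of_real (ln (real (m * n))) * (a (m * n) - a m * a n) = 0" by (simp add: algebra_simps)
    moreover have "m * n > 1" using False less.prems by (metis less_one linorder_neqE_nat mult_is_0 not_gr0)
    then have "ln (real (m * n)) > 0" by (metis ln_gt_zero of_nat_1 of_nat_less_iff)
    ultimately show ?thesis by simp
  qed (use a1 in auto)
qed

text \<open>Restricted to powers of \<open>p\<close>, the recurrence says \<open>f' = g' * f\<close>
  for the generating functions of \<open>a (p ^ k)\<close> and \<open>b (p ^ k)\<close>. Hence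
  \<open>f = exp g\<close> on a disc where both converge, and an exponential has no zeros.\<close>

lemma local_factor_nonzero:
  fixes a b :: "nat \<Rightarrow> complex"
  assumes rec: "\<And>n. n > 0 \<Longrightarrow> of_real (ln (real n)) * a n = (\<Sum>d | d dvd n. of_real (ln (real d)) * b d * a (n div d))"
    and a1: "a 1 = 1" and p: "prime p" and \<theta>: "\<theta> < 1/2"
    and a: "\<And>n. n > 0 \<Longrightarrow> norm (a n) \<le> Ka * real n powr \<theta>"
    and b: "\<And>n. n > 0 \<Longrightarrow> norm (b n) \<le> Kb * real n powr \<theta>"
    and z: "norm z \<le> 1 / sqrt (real p)"
  shows "\<not> (\<lambda>k. a (p ^ k) * z ^ k) sums 0"
proof
  assume sums0: "(\<lambda>k. a (p ^ k) * z ^ k) sums 0"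
  have p1: "p > 1" using p prime_gt_1_nat by blast
  define f where "f = Abs_fps (\<lambda>k. a (p ^ k))"
  \<comment> \<open>The constant coefficient is set to 0 so that \<open>f\<close> and
    \<open>exp g\<close> agree at 0; the differential equation does not see it.\<close>
  define g where "g = Abs_fps (\<lambda>k. if k = 0 then 0 else b (p ^ k))"
  have coeff_rec: "of_nat k * a (p ^ k) = (\<Sum>j\<le>k. of_nat j * b (p ^ j) * a (p ^ (k - j)))" for k
  proof -
    have "of_real (ln (real (p ^ k))) * a (p ^ k) =
        (\<Sum>d | d dvd p ^ k. of_real (ln (real d)) * b d * a (p ^ k div d))"
      using p1 by (intro rec) auto
    also have "{d. d dvd p ^ k} = (\<lambda>j. p ^ j) ` {..k}"
      using p by (auto simp: divides_primepow_nat le_imp_power_dvd)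
    also have "(\<Sum>d\<in>(\<lambda>j. p ^ j) ` {..k}. of_real (ln (real d)) * b d * a (p ^ k div d)) =
        (\<Sum>j\<le>k. of_real (ln (real (p ^ j))) * b (p ^ j) * a (p ^ k div p ^ j))"
      using p1 by (subst sum.reindex) (auto simp: inj_on_def power_inject_exp)
    also have "\<dots> = of_real (ln (real p)) * (\<Sum>j\<le>k. of_nat j * b (p ^ j) * a (p ^ (k - j)))"
      unfolding sum_distrib_left using p1
      by (intro sum.cong refl) (simp add: ln_realpow power_diff[symmetric] mult_ac)
    finally have "of_real (ln (real p)) * (of_nat k * a (p ^ k)) =
        of_real (ln (real p)) * (\<Sum>j\<le>k. of_nat j * b (p ^ j) * a (p ^ (k - j)))"
      using p1 by (simp add: ln_realpow mult_ac)
    moreover have "ln (real p) > 0" using p1 by simp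
    ultimately show ?thesis by simp
  qed
  have ode: "fps_deriv f = fps_deriv g * f"
  proof (rule fps_ext)
    fix k
    have "fps_nth (fps_deriv f) k = (\<Sum>j\<le>Suc k. of_nat j * b (p ^ j) * a (p ^ (Suc k - j)))"
      using coeff_rec[of "Suc k"] by (simp add: f_def)
    also have "\<dots> = (\<Sum>j\<le>k. of_nat (Suc j) * b (p ^ Suc j) * a (p ^ (k - j)))"
      by (subst sum.atMost_Suc_shift) simp
    also have "\<dots> = fps_nth (fps_deriv g * f) k"
      by (simp add: fps_mult_nth f_def g_def atLeast0AtMost)
    finally show "fps_nth (fps_deriv f) k = fps_nth (fps_deriv g * f) k" .
  qed
  \<comment> \<open>A lower bound for both radii of convergence. It exceeds
    \<open>p powr (-1/2)\<close> exactly because \<open>\<theta> < 1/2\<close>, so it covers the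
    closed disc in which \<open>z\<close> lies.\<close>
  define R where "R = real p powr (- \<theta>)"
  have zR: "norm z < R"
  proof -
    have "1 / sqrt (real p) = real p powr (- (1/2))"
      by (simp add: powr_minus_divide powr_half_sqrt)
    also have "\<dots> < R" unfolding R_def using p1 \<theta> by (intro powr_less_mono) auto
    finally show ?thesis using z by simp
  qed
  have radius: "fps_conv_radius h \<ge> ereal R"
    if "\<And>k. norm (fps_nth h k) \<le> K * real (p ^ k) powr \<theta>" for h :: "complex fps" and K
    unfolding fps_conv_radius_def
  proof (rule conv_radius_geI_ex')
    fix r assume r: "0 < r" "ereal r < ereal R"
    have "real (p ^ k) powr \<theta> = (real p powr \<theta>) ^ k" for k
      using p1 by (simp add: powr_power powr_realpow[symmetric] powr_powr mult.commute)
    then have le: "norm (fps_nth h k * of_real r ^ k) \<le> K * (real p powr \<theta> * r) ^ k" for k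
      using mult_right_mono[OF that[of k], of "r ^ k"] r by (simp add: norm_mult norm_power power_mult_distrib mult_ac)
    have "real p powr \<theta> * r < real p powr \<theta> * R"
      using r p1 by (intro mult_strict_left_mono) auto
    also have "\<dots> = 1" using p1 by (simp add: R_def flip: powr_add)
    finally have "summable (\<lambda>k. K * (real p powr \<theta> * r) ^ k)"
      using r by (intro summable_mult summable_geometric) (simp add: abs_mult)
    then show "summable (\<lambda>k. fps_nth h k * of_real r ^ k)"
      by (rule summable_comparison_test'[of _ 0]) (use le in auto)
  qed
  have Kb: "Kb \<ge> 0" using b[of 1] by (auto intro: order_trans[OF norm_ge_zero])
  have rf: "fps_conv_radius f \<ge> ereal R"
    by (rule radius[of _ Ka]) (use a[of "p ^ k" for k] p1 in \<open>simp add: f_def\<close>)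
  have rg: "fps_conv_radius g \<ge> ereal R"
    by (rule radius[of _ Kb]) (use b[of "p ^ k" for k] p1 Kb in \<open>simp add: g_def\<close>)
  define D where "D w = eval_fps f w * exp (- eval_fps g w)" for w
  have "(D has_field_derivative 0) (at w within ball 0 R)" if w: "w \<in> ball 0 R" for w
  proof -
    have wf: "ereal (norm w) < fps_conv_radius f" "ereal (norm w) < fps_conv_radius g"
      using w rf rg by (auto intro: less_le_trans[of _ "ereal R"])
    have "eval_fps (fps_deriv f) w = eval_fps (fps_deriv g) w * eval_fps f w"
      unfolding ode using wf fps_conv_radius_deriv[of g] by (intro eval_fps_mult) auto
    moreover have "(D has_field_derivative eval_fps (fps_deriv f) w * exp (- eval_fps g w) +
        (exp (- eval_fps g w) * (- eval_fps (fps_deriv g) w)) * eval_fps f w) (at w)"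
      unfolding D_def using wf
      by (intro DERIV_mult DERIV_chain2[OF DERIV_exp] DERIV_minus has_field_derivative_eval_fps)
    ultimately have "(D has_field_derivative 0) (at w)" by (simp add: algebra_simps)
    then show ?thesis by (rule has_field_derivative_at_within)
  qed
  then obtain c where c: "\<And>w. w \<in> ball 0 R \<Longrightarrow> D w = c"
    using has_field_derivative_zero_constant[of "ball 0 R" D] by auto
  have "R > 0" using p1 by (simp add: R_def)
  then have "c = D 0" using c[of 0] by simp
  also have "\<dots> = 1" using a1 by (simp add: D_def eval_fps_at_0 f_def g_def)
  finally have "D z = 1" using c[of z] zR by simp
  moreover have "eval_fps f z = 0"
    using sums_unique[OF sums0] by (simp add: eval_fps_def f_def)
  ultimately show False by (simp add: D_def)
qed

section \<open>Integrals along vertical lines\<close>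

lemma norm_Gamma_le:
  assumes "Re z > 0"
  shows "norm (Gamma z) \<le> Gamma (Re z)"
proof -
  have "norm (integral {0..} (\<lambda>t. of_real t powr (z - 1) / of_real (exp t)))
      \<le> integral {0..} (\<lambda>t. t powr (Re z - 1) / exp t)"
  proof (rule integral_norm_bound_integral)
    show "(\<lambda>t. of_real t powr (z - 1) / of_real (exp t)) integrable_on {0..}"
      using Gamma_integral_complex[OF assms] by blast
    show "(\<lambda>t. t powr (Re z - 1) / exp t) integrable_on {0..}"
      using Gamma_integral_real[OF assms] by blast
    show "norm (of_real t powr (z - 1) / of_real (exp t)) \<le> t powr (Re z - 1) / exp t" if "t \<in> {0..}" for t
      using that norm_powr_real_powr[of "of_real t" "z - 1"]
      by (simp add: norm_divide del: of_real_exp)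
  qed
  then show ?thesis
    using Gamma_integral_complex[OF assms] Gamma_integral_real[OF assms] by (simp add: integral_unique)
qed

text \<open>Each use of \<open>Gamma (z + 1) = z * Gamma z\<close> absorbs one factor
  \<open>\<bar>Im z\<bar> \<le> norm z\<close>. Polynomial decay of every order results, and it
  takes the place of Stirling's formula.\<close>

lemma norm_Gamma_decay:
  assumes "Re z > 0"
  shows "norm (Gamma z) * \<bar>Im z\<bar> ^ n \<le> Gamma (Re z + real n)"
  using assms
proof (induction n arbitrary: z)
  case 0
  then show ?case using norm_Gamma_le by simp
next
  case (Suc n)
  have "z \<notin> \<int>\<^sub>\<le>\<^sub>0" using Suc.prems by (auto elim!: nonpos_Ints_cases)
  then have "norm (Gamma (z + 1)) = norm z * norm (Gamma z)"
    using Gamma_plus1[of z] by (simp add: norm_mult)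
  moreover have "norm (Gamma (z + 1)) * \<bar>Im z\<bar> ^ n \<le> Gamma (Re z + 1 + real n)"
    using Suc.IH[of "z + 1"] Suc.prems by simp
  moreover have "norm (Gamma z) * \<bar>Im z\<bar> ^ n * \<bar>Im z\<bar> \<le> norm (Gamma z) * \<bar>Im z\<bar> ^ n * norm z"
    by (intro mult_left_mono abs_Im_le_cmod) auto
  ultimately show ?case by (simp add: mult_ac add_ac)
qed

lemma norm_Gamma_strip:
  assumes "a > 0"
  obtains C where "C > 0" "\<And>z. a \<le> Re z \<Longrightarrow> Re z \<le> b \<Longrightarrow> norm (Gamma z) \<le> C / (1 + \<bar>Im z\<bar>) ^ n"
proof -
  have "\<exists>B. \<forall>x\<in>{a..b}. Gamma (x + real k) \<le> B" for k
  proof -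
    have "continuous_on {a..b} (\<lambda>x. Gamma (x + real k))"
      using assms
      by (intro continuous_on_compose2[OF continuous_on_Gamma[of "{0<..}"]] continuous_intros)
         (auto elim!: nonpos_Ints_cases)
    then have "bounded ((\<lambda>x. Gamma (x + real k)) ` {a..b})"
      by (intro compact_imp_bounded compact_continuous_image) auto
    then show ?thesis by (auto simp: bounded_iff intro: order_trans[OF abs_ge_self])
  qed
  then obtain B where B: "\<And>x k. x \<in> {a..b} \<Longrightarrow> Gamma (x + real k) \<le> B k" by metis
  define C where "C = 2 ^ n * (\<bar>B 0\<bar> + \<bar>B n\<bar> + 1)"
  have C: "2 ^ n * \<bar>B 0\<bar> \<le> C" "2 ^ n * \<bar>B n\<bar> \<le> C" "C > 0"
    unfolding C_def by (auto intro!: mult_pos_pos)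
  have "norm (Gamma z) \<le> C / (1 + \<bar>Im z\<bar>) ^ n" if z: "a \<le> Re z" "Re z \<le> b" for z
  proof -
    have pos: "Re z > 0" using z assms by simp
    have "norm (Gamma z) * (1 + \<bar>Im z\<bar>) ^ n \<le> C"
    proof (cases "\<bar>Im z\<bar> \<le> 1")
      case True
      have "norm (Gamma z) * (1 + \<bar>Im z\<bar>) ^ n \<le> B 0 * 2 ^ n"
        using norm_Gamma_decay[OF pos, of 0] B[of "Re z" 0] z True
        by (intro mult_mono power_mono) (auto intro: order_trans[OF norm_ge_zero[of "Gamma z"]])
      also have "\<dots> \<le> 2 ^ n * \<bar>B 0\<bar>" by (simp add: mult.commute)
      finally show ?thesis using C by linarith
    next
      case False
      have "norm (Gamma z) * (1 + \<bar>Im z\<bar>) ^ n \<le> norm (Gamma z) * (2 * \<bar>Im z\<bar>) ^ n"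
        using False by (intro mult_left_mono power_mono) auto
      also have "\<dots> = 2 ^ n * (norm (Gamma z) * \<bar>Im z\<bar> ^ n)" by (simp add: power_mult_distrib)
      also have "\<dots> \<le> 2 ^ n * \<bar>B n\<bar>"
        using norm_Gamma_decay[OF pos, of n] B[of "Re z" n] z by (intro mult_left_mono) auto
      finally show ?thesis using C by linarith
    qed
    then show ?thesis by (subst pos_le_divide_eq) auto
  qed
  with C show thesis using that by blast
qed

section \<open>Moving a line of integration\<close>

lemma integrable_inverse_quadratic: "integrable lborel (\<lambda>t::real. C / (1 + \<bar>t\<bar>)\<^sup>2)"
proof -
  have "integrable lborel (\<lambda>t::real. inverse (1 + t\<^sup>2))"
    using integrable_inverse_1_plus_square by (simp add: set_integrable_def)
  then have "integrable lborel (\<lambda>t::real. C * inverse (1 + t\<^sup>2))" by simp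
  then show ?thesis
  proof (rule Bochner_Integration.integrable_bound)
    show "AE t in lborel. norm (C / (1 + \<bar>t\<bar>)\<^sup>2) \<le> norm (C * inverse (1 + t\<^sup>2))"
    proof (rule AE_I2)
      fix t :: real
      have "1 + t\<^sup>2 \<le> (1 + \<bar>t\<bar>)\<^sup>2" by (simp add: power2_sum)
      then have "\<bar>C\<bar> / (1 + \<bar>t\<bar>)\<^sup>2 \<le> \<bar>C\<bar> / (1 + t\<^sup>2)"
        by (intro divide_left_mono mult_pos_pos) (auto simp: add_pos_nonneg)
      then show "norm (C / (1 + \<bar>t\<bar>)\<^sup>2) \<le> norm (C * inverse (1 + t\<^sup>2))"
        by (simp add: abs_mult divide_inverse)
    qed
  qed simp
qed

lemma integrable_quadratic_decay:
  fixes f :: "real \<Rightarrow> complex"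
  assumes "continuous_on UNIV f" "\<And>t. norm (f t) \<le> C / (1 + \<bar>t\<bar>)\<^sup>2"
  shows "integrable lborel f"
proof (rule Bochner_Integration.integrable_bound[OF integrable_inverse_quadratic[of C]])
  show "f \<in> borel_measurable lborel"
    using borel_measurable_continuous_onI[OF assms(1)] by simp
  show "AE t in lborel. norm (f t) \<le> norm (C / (1 + \<bar>t\<bar>)\<^sup>2)"
    by (intro AE_I2 order_trans[OF assms(2)]) (simp only: real_norm_def abs_ge_self)
qed

lemma integral_symmetric_limit:
  fixes f :: "real \<Rightarrow> complex"
  assumes "integrable lborel f"
  shows "(\<lambda>n. integral {- real n..real n} f) \<longlonglongrightarrow> (LINT t|lborel. f t)"
proof -
  have "(\<lambda>n. LINT t|lborel. indicator {- real n..real n} t *\<^sub>R f t) \<longlonglongrightarrow> (LINT t|lborel. f t)"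
  proof (rule integral_dominated_convergence[where w = "\<lambda>t. norm (f t)"])
    show "AE t in lborel. (\<lambda>n. indicator {- real n..real n} t *\<^sub>R f t) \<longlonglongrightarrow> f t"
    proof (rule AE_I2, rule tendsto_eventually)
      fix t :: real
      show "eventually (\<lambda>n. indicator {- real n..real n} t *\<^sub>R f t = f t) sequentially"
        using eventually_ge_at_top[of "nat \<lceil>\<bar>t\<bar>\<rceil>"]
      proof eventually_elim
        case (elim n)
        then have "\<bar>t\<bar> \<le> real n" by (simp add: nat_ceiling_le_eq)
        then show ?case by (auto simp: indicator_def)
      qed
    qed
  qed (use assms in \<open>auto simp: indicator_def\<close>)
  moreover have "(LINT t|lborel. indicator {- real n..real n} t *\<^sub>R f t) = integral {- real n..real n} f" for n
    using set_borel_integral_eq_integral(2)[of "{- real n..real n}" f] assms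
    by (simp add: set_lebesgue_integral_def set_integrable_def integrable_mult_indicator)
  ultimately show ?thesis by simp
qed

text \<open>On the convex rectangle \<open>f\<close> has a primitive, and the fundamental theorem of
  calculus evaluates all four sides.\<close>

lemma rectangle_integral:
  assumes "f holomorphic_on cbox (Complex c1 T1) (Complex c2 T2)" "c1 \<le> c2" "T1 \<le> T2"
  shows "\<i> * integral {T1..T2} (\<lambda>t. f (Complex c2 t)) - \<i> * integral {T1..T2} (\<lambda>t. f (Complex c1 t)) =
    integral {c1..c2} (\<lambda>x. f (Complex x T2)) - integral {c1..c2} (\<lambda>x. f (Complex x T1))"
proof -
  let ?S = "cbox (Complex c1 T1) (Complex c2 T2)"
  obtain g where g: "\<And>z. z \<in> ?S \<Longrightarrow> (g has_field_derivative f z) (at z within ?S)"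
  proof (rule holomorphic_convex_primitive[of ?S "{}" f])
    show "f field_differentiable at z" if "z \<in> interior ?S - {}" for z
      using that holomorphic_on_imp_differentiable_at[OF holomorphic_on_subset[OF assms(1) interior_subset] open_interior]
      by simp
  qed (use holomorphic_on_imp_continuous_on[OF assms(1)] in auto)
  have v: "integral {T1..T2} (\<lambda>t. \<i> * f (Complex c t)) = g (Complex c T2) - g (Complex c T1)" if "c \<in> {c1..c2}" for c
  proof (rule integral_unique, rule fundamental_theorem_of_calculus[OF assms(3)])
    fix t assume t: "t \<in> {T1..T2}"
    have "((\<lambda>t. Complex c t) has_vector_derivative \<i>) (at t within {T1..T2})"
      unfolding Complex_eq by (auto intro!: derivative_eq_intros)
    moreover have "(g has_field_derivative f (Complex c t)) (at (Complex c t) within Complex c ` {T1..T2})"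
      using that t by (intro has_field_derivative_subset[OF g]) (auto simp: in_cbox_complex_iff)
    ultimately show "((\<lambda>t. g (Complex c t)) has_vector_derivative \<i> * f (Complex c t)) (at t within {T1..T2})"
      using field_vector_diff_chain_within[of "Complex c" \<i> t "{T1..T2}" g] by (simp add: o_def)
  qed
  have h: "integral {c1..c2} (\<lambda>x. f (Complex x T)) = g (Complex c2 T) - g (Complex c1 T)" if "T \<in> {T1..T2}" for T
  proof (rule integral_unique, rule fundamental_theorem_of_calculus[OF assms(2)])
    fix x assume x: "x \<in> {c1..c2}"
    have "((\<lambda>x. Complex x T) has_vector_derivative 1) (at x within {c1..c2})"
      unfolding Complex_eq by (auto intro!: derivative_eq_intros)
    moreover have "(g has_field_derivative f (Complex x T)) (at (Complex x T) within (\<lambda>x. Complex x T) ` {c1..c2})"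
      using that x by (intro has_field_derivative_subset[OF g]) (auto simp: in_cbox_complex_iff)
    ultimately show "((\<lambda>x. g (Complex x T)) has_vector_derivative f (Complex x T)) (at x within {c1..c2})"
      using field_vector_diff_chain_within[of "\<lambda>x. Complex x T" 1 x "{c1..c2}" g] by (simp add: o_def)
  qed
  show ?thesis using v[of c1] v[of c2] h[of T1] h[of T2] assms(2,3) by simp
qed

text \<open>Below the height \<open>T0\<close> the function \<open>f\<close> may have singularities,
  and \<open>l\<close> and \<open>r\<close> may be entirely different functions. The price is the
  right-hand side: the contour integral around that part of the strip, taken over compact segments
  in place of residues.\<close>

lemma shift_line:
  fixes f :: "complex \<Rightarrow> complex" and l r :: "real \<Rightarrow> complex"
  assumes f: "f holomorphic_on {z. c1 \<le> Re z \<and> Re z \<le> c2 \<and> T0 \<le> \<bar>Im z\<bar>}"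
    and c: "c1 \<le> c2" and T0: "T0 \<ge> 0"
    and bound: "\<And>z. c1 \<le> Re z \<Longrightarrow> Re z \<le> c2 \<Longrightarrow> T0 \<le> \<bar>Im z\<bar> \<Longrightarrow> norm (f z) \<le> C / (1 + \<bar>Im z\<bar>)\<^sup>2"
    and l: "continuous_on UNIV l" "integrable lborel l" "\<And>t. T0 \<le> \<bar>t\<bar> \<Longrightarrow> l t = f (Complex c1 t)"
    and r: "continuous_on UNIV r" "integrable lborel r" "\<And>t. T0 \<le> \<bar>t\<bar> \<Longrightarrow> r t = f (Complex c2 t)"
  shows "\<i> * ((LINT t|lborel. r t) - (LINT t|lborel. l t)) =
    \<i> * (integral {-T0..T0} r - integral {-T0..T0} l) +
    integral {c1..c2} (\<lambda>x. f (Complex x (- T0))) - integral {c1..c2} (\<lambda>x. f (Complex x T0))"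
proof -
  define hor where "hor T = integral {c1..c2} (\<lambda>x. f (Complex x T))" for T
  \<comment> \<open>Cauchy's theorem on the rectangle above \<open>T0\<close> and on the one below
    \<open>-T0\<close>; the outer horizontal sides tend to 0.\<close>
  have fin: "\<i> * (integral {-real n..real n} r - integral {-real n..real n} l) =
     \<i> * (integral {-T0..T0} r - integral {-T0..T0} l) + hor (- T0) - hor T0 + (hor (real n) - hor (- real n))"
    if n: "real n \<ge> T0" for n
  proof -
    have split: "integral {-real n..real n} g = integral {-real n..-T0} g + integral {-T0..T0} g + integral {T0..real n} g"
      if "continuous_on UNIV g" for g :: "real \<Rightarrow> complex"
    proof -
      have io: "g integrable_on {a..b}" for a b
        using that by (intro integrable_continuous_real) (auto intro: continuous_on_subset)
      show ?thesis
        using Henstock_Kurzweil_Integration.integral_combine[of "-real n" "-T0" "real n" g]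
          Henstock_Kurzweil_Integration.integral_combine[of "-T0" T0 "real n" g]
          io n T0 by (simp add: add.assoc)
    qed
    have up: "\<i> * integral {T0..real n} r - \<i> * integral {T0..real n} l = hor (real n) - hor T0"
    proof -
      have "integral {T0..real n} r = integral {T0..real n} (\<lambda>t. f (Complex c2 t))"
        using r(3) T0 by (intro integral_cong) auto
      moreover have "integral {T0..real n} l = integral {T0..real n} (\<lambda>t. f (Complex c1 t))"
        using l(3) T0 by (intro integral_cong) auto
      moreover have "f holomorphic_on cbox (Complex c1 T0) (Complex c2 (real n))"
        by (rule holomorphic_on_subset[OF f]) (use T0 in \<open>auto simp: in_cbox_complex_iff\<close>)
      ultimately show ?thesis
        using rectangle_integral[of f c1 T0 c2 "real n"] n c unfolding hor_def by simp
    qed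
    have down: "\<i> * integral {-real n..-T0} r - \<i> * integral {-real n..-T0} l = hor (- T0) - hor (-real n)"
    proof -
      have "integral {-real n..-T0} r = integral {-real n..-T0} (\<lambda>t. f (Complex c2 t))"
        using r(3) T0 by (intro integral_cong) auto
      moreover have "integral {-real n..-T0} l = integral {-real n..-T0} (\<lambda>t. f (Complex c1 t))"
        using l(3) T0 by (intro integral_cong) auto
      moreover have "f holomorphic_on cbox (Complex c1 (-real n)) (Complex c2 (-T0))"
        by (rule holomorphic_on_subset[OF f]) (use T0 in \<open>auto simp: in_cbox_complex_iff\<close>)
      ultimately show ?thesis
        using rectangle_integral[of f c1 "-real n" c2 "-T0"] n c unfolding hor_def by simp
    qed
    have "\<i> * (integral {-real n..real n} r - integral {-real n..real n} l) =
        \<i> * (integral {-T0..T0} r - integral {-T0..T0} l) +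
        (\<i> * integral {T0..real n} r - \<i> * integral {T0..real n} l) +
        (\<i> * integral {-real n..-T0} r - \<i> * integral {-real n..-T0} l)"
      by (simp add: split[OF l(1)] split[OF r(1)] algebra_simps)
    then show ?thesis unfolding up down by (simp add: algebra_simps)
  qed
  have hor_le: "norm (hor T) \<le> C * (c2 - c1) / (1 + \<bar>T\<bar>)\<^sup>2" if "T0 \<le> \<bar>T\<bar>" for T
  proof -
    have "continuous_on {c1..c2} (\<lambda>x. f (Complex x T))"
      using that by (intro continuous_on_compose2[OF holomorphic_on_imp_continuous_on[OF f]])
        (auto simp: Complex_eq intro!: continuous_intros)
    then have "norm (hor T) \<le> C / (1 + \<bar>T\<bar>)\<^sup>2 * (c2 - c1)"
      unfolding hor_def using bound[of "Complex x T" for x] that by (intro integral_bound c) auto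
    then show ?thesis by (simp add: mult_ac)
  qed
  have "(\<lambda>n. 1 / (1 + real n)\<^sup>2) \<longlonglongrightarrow> 0" by real_asymp
  from tendsto_mult_right_zero[OF this, of "C * (c2 - c1)"]
  have T_lim: "(\<lambda>n. C * (c2 - c1) / (1 + \<bar>real n\<bar>)\<^sup>2) \<longlonglongrightarrow> 0" by simp
  have ev: "\<forall>\<^sub>F n in sequentially. real n \<ge> T0"
    using eventually_ge_at_top[of "nat \<lceil>T0\<rceil>"]
    by eventually_elim (simp add: nat_ceiling_le_eq)
  have hor1: "(\<lambda>n. hor (real n)) \<longlonglongrightarrow> 0"
    by (rule Lim_null_comparison[OF _ T_lim], use ev in eventually_elim) (use hor_le[of "real n" for n] in simp)
  have hor2: "(\<lambda>n. hor (- real n)) \<longlonglongrightarrow> 0"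
    by (rule Lim_null_comparison[OF _ T_lim], use ev in eventually_elim) (use hor_le[of "- real n" for n] in simp)
  from hor1 hor2 have "(\<lambda>n. \<i> * (integral {-T0..T0} r - integral {-T0..T0} l) + hor (- T0) - hor T0 + (hor (real n) - hor (- real n)))
     \<longlonglongrightarrow> \<i> * (integral {-T0..T0} r - integral {-T0..T0} l) + hor (- T0) - hor T0 + (0 - 0)"
    by (intro tendsto_intros)
  note lim1 = this
  have lim2: "(\<lambda>n. \<i> * (integral {-real n..real n} r - integral {-real n..real n} l))
     \<longlonglongrightarrow> \<i> * ((LINT t|lborel. r t) - (LINT t|lborel. l t))"
    by (intro tendsto_intros integral_symmetric_limit l r)
  have eq: "\<forall>\<^sub>F n in sequentially. \<i> * (integral {-real n..real n} r - integral {-real n..real n} l) =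
     \<i> * (integral {-T0..T0} r - integral {-T0..T0} l) + hor (- T0) - hor T0 + (hor (real n) - hor (- real n))"
    using ev by eventually_elim (rule fin)
  have "\<i> * ((LINT t|lborel. r t) - (LINT t|lborel. l t)) =
      \<i> * (integral {-T0..T0} r - integral {-T0..T0} l) + hor (- T0) - hor T0 + (0 - 0)"
    by (rule LIMSEQ_unique[OF Lim_transform_eventually[OF lim2 eq] lim1])
  then show ?thesis by (simp add: hor_def)
qed

text \<open>The comparison function is \<open>exp (- \<delta> cos (5/4 (z - 1/2)))\<close>, whose decay beats the growth
  because \<open>1 < 5/4 < \<pi> / 2\<close>.\<close>

lemma phragmen_lindelof_strip:
  assumes holo: "f holomorphic_on {z. -1/2 \<le> Re z \<and> Re z \<le> 3/2}"
    and growth: "\<And>z. -1/2 \<le> Re z \<Longrightarrow> Re z \<le> 3/2 \<Longrightarrow> norm (f z) \<le> B * exp (exp \<bar>Im z\<bar>)"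
    and left: "\<And>z. Re z = -1/2 \<Longrightarrow> norm (f z) \<le> M" and right: "\<And>z. Re z = 3/2 \<Longrightarrow> norm (f z) \<le> M"
    and w: "-1/2 \<le> Re w" "Re w \<le> 3/2"
  shows "norm (f w) \<le> M"
proof -
  define c where "c z = cos (5/4 * (z - 1/2))" for z :: complex
  \<comment> \<open>The strip has centre 1/2 and half-width 1, so the real part of the cosine's
    argument has modulus at most 5/4, and \<open>\<eta>\<close> is the least value of its real
    cosine factor.\<close>
  define \<eta> where "\<eta> = cos (5/4 :: real)"
  have \<eta>: "\<eta> > 0" unfolding \<eta>_def by (rule cos_gt_zero) (use pi_gt3 in auto)
  have Re_c: "Re (c z) \<ge> \<eta> * cosh (5/4 * Im z)" if "-1/2 \<le> Re z" "Re z \<le> 3/2" for z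
  proof -
    have "Re (c z) = cos (5/4 * (Re z - 1/2)) * cosh (5/4 * Im z)"
      by (simp add: c_def Re_cos cosh_def field_simps)
    moreover have "cos (5/4 * (Re z - 1/2)) \<ge> \<eta>"
      unfolding cos_abs_real[of "5/4 * (Re z - 1/2)", symmetric]
      unfolding \<eta>_def using that pi_gt3 by (intro cos_monotone_0_pi_le) (auto simp: abs_le_iff)
    ultimately show ?thesis by (simp add: mult_right_mono)
  qed
  have M: "M \<ge> 0" using left[of "-1/2"] by (auto intro: order_trans[OF norm_ge_zero])
  have "0 \<le> B * exp (exp \<bar>Im 0\<bar>)"
    by (rule order_trans[OF norm_ge_zero growth]) auto
  then have B: "B \<ge> 0" by (simp add: zero_le_mult_iff)
  have key: "norm (f w) * exp (- \<delta> * Re (c w)) \<le> M" if \<delta>: "\<delta> > 0" for \<delta> :: real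
  proof -
    define g where "g z = f z * exp (- of_real \<delta> * c z)" for z
    have norm_g: "norm (g z) = norm (f z) * exp (- \<delta> * Re (c z))" for z
      by (simp add: g_def norm_mult)
    have g_le_f: "norm (g z) \<le> norm (f z)" if "-1/2 \<le> Re z" "Re z \<le> 3/2" for z
    proof -
      have "Re (c z) \<ge> 0" using \<eta> by (intro order_trans[OF _ Re_c[OF that]]) simp
      then show ?thesis using \<delta> unfolding norm_g by (intro mult_left_le) auto
    qed
    \<comment> \<open>The half comes from \<open>cosh t \<ge> exp t / 2\<close>.\<close>
    define \<kappa> where "\<kappa> = \<delta> * \<eta> / 2"
    have \<kappa>: "\<kappa> > 0" using \<delta> \<eta> by (simp add: \<kappa>_def)
    then have "filterlim (\<lambda>t. exp t - \<kappa> * exp (5/4 * t)) at_bot at_top"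
      by real_asymp
    then have "((\<lambda>t. exp (exp t - \<kappa> * exp (5/4 * t))) \<longlongrightarrow> 0) at_top"
      by (rule filterlim_compose[OF exp_at_bot])
    then have "((\<lambda>t. exp (exp t) * exp (- \<kappa> * exp (5/4 * t))) \<longlongrightarrow> 0) at_top"
      by (simp add: exp_add[symmetric])
    then have lim: "((\<lambda>t. B * (exp (exp t) * exp (- \<kappa> * exp (5/4 * t)))) \<longlongrightarrow> 0) at_top"
      by (rule tendsto_mult_right_zero)
    have "norm (g w) \<le> M + e" if e: "e > 0" for e
    proof -
      have "\<forall>\<^sub>F t in at_top. B * (exp (exp t) * exp (- \<kappa> * exp (5/4 * t))) < M + e"
        by (rule order_tendstoD[OF lim]) (use M e in simp)
      from eventually_conj[OF this eventually_ge_at_top[of "\<bar>Im w\<bar>"]]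
      obtain T where T: "B * (exp (exp T) * exp (- \<kappa> * exp (5/4 * T))) < M + e" "T \<ge> \<bar>Im w\<bar>"
        by (auto dest: eventually_happens)
      let ?S = "cbox (Complex (-1/2) (-T)) (Complex (3/2) T)"
      have sub: "?S \<subseteq> {z. -1/2 \<le> Re z \<and> Re z \<le> 3/2}" by (auto simp: in_cbox_complex_iff)
      have hg: "g holomorphic_on ?S"
        unfolding g_def c_def by (intro holomorphic_intros holomorphic_on_subset[OF holo sub])
      show ?thesis
      proof (rule maximum_modulus_frontier[of g ?S])
        show "g holomorphic_on interior ?S" using hg interior_subset holomorphic_on_subset by blast
        show "continuous_on (closure ?S) g" using holomorphic_on_imp_continuous_on[OF hg] by simp
        show "w \<in> ?S" using w T by (auto simp: in_cbox_complex_iff abs_le_iff)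
        fix z assume "z \<in> frontier ?S"
        then have z: "z \<in> ?S" "z \<notin> box (Complex (-1/2) (-T)) (Complex (3/2) T)"
          by (auto simp: frontier_cbox)
        then have zs: "-1/2 \<le> Re z" "Re z \<le> 3/2" using sub by auto
        have "Re z \<le> -1/2 \<or> Re z \<ge> 3/2 \<or> Im z \<le> - T \<or> Im z \<ge> T"
          using z(2) unfolding in_box_complex_iff by (simp add: not_less)
        moreover have "- T \<le> Im z" "Im z \<le> T"
          using z(1) by (simp_all add: in_cbox_complex_iff)
        ultimately consider "Re z = -1/2" | "Re z = 3/2" | "\<bar>Im z\<bar> = T"
          using zs T(2) by fastforce
        then show "norm (g z) \<le> M + e"
        proof cases
          case 1
          then show ?thesis using g_le_f[OF zs] left[OF 1] e by linarith
        next
          case 2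
          then show ?thesis using g_le_f[OF zs] right[OF 2] e by linarith
        next
          case 3
          have ch: "cosh (5/4 * Im z) = cosh (5/4 * T)"
            using 3 cosh_minus[of "5/4 * Im z"] by (cases "Im z \<ge> 0") auto
          have "exp (5/4 * T) / 2 \<le> cosh (5/4 * T)" by (simp add: cosh_def)
          then have "\<eta> * (exp (5/4 * T) / 2) \<le> \<eta> * cosh (5/4 * T)"
            using \<eta> by (intro mult_left_mono) auto
          also have "\<dots> \<le> Re (c z)" using Re_c[OF zs] by (simp only: ch)
          finally have "\<delta> * (\<eta> * (exp (5/4 * T) / 2)) \<le> \<delta> * Re (c z)"
            using \<delta> by (intro mult_left_mono) auto
          moreover have "\<kappa> * exp (5/4 * T) = \<delta> * (\<eta> * (exp (5/4 * T) / 2))" by (simp add: \<kappa>_def)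
          ultimately have "exp (- \<delta> * Re (c z)) \<le> exp (- \<kappa> * exp (5/4 * T))"
            by (simp only: exp_le_cancel_iff mult_minus_left neg_le_iff_le)
          then have "norm (g z) \<le> (B * exp (exp T)) * exp (- \<kappa> * exp (5/4 * T))"
            unfolding norm_g using growth[OF zs] 3 B by (intro mult_mono mult_nonneg_nonneg norm_ge_zero exp_ge_zero) auto
          then show ?thesis using T(1) by (simp only: mult.assoc)
        qed
      qed simp
    qed
    then have "norm (g w) \<le> M" by (rule field_le_epsilon)
    then show ?thesis by (simp add: norm_g)
  qed
  \<comment> \<open>The point \<open>w\<close> is fixed and the damping is removed by letting
    \<open>\<delta>\<close> tend to 0.\<close>
  have "((\<lambda>\<delta>. norm (f w) * exp (- \<delta> * Re (c w))) \<longlongrightarrow> norm (f w) * exp (- 0 * Re (c w))) (at_right 0)"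
    by (intro tendsto_intros)
  then have "norm (f w) * exp (- 0 * Re (c w)) \<le> M"
  proof (rule tendsto_upperbound)
    show "\<forall>\<^sub>F \<delta> in at_right 0. norm (f w) * exp (- \<delta> * Re (c w)) \<le> M"
      using eventually_at_right_less[of "0::real"] by eventually_elim (rule key)
  qed simp
  then show ?thesis by simp
qed

section \<open>Derivatives, translates and series of line integrals\<close>

lemma norm_exp_minus_1_le: "norm (exp z - 1) \<le> norm z * exp \<bar>Re z\<bar>" for z :: complex
proof -
  have "norm (exp z - exp 0) \<le> exp \<bar>Re z\<bar> * norm (z - 0)"
  proof (rule field_differentiable_bound[of "closed_segment 0 z"])
    fix w assume "w \<in> closed_segment 0 z"
    then obtain x where x: "0 \<le> x" "x \<le> 1" "w = of_real x * z"
      by (auto simp: in_segment scaleR_conv_of_real)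
    have "Re w \<le> \<bar>Re z\<bar>"
      using x mult_left_le_one_le[of "\<bar>Re z\<bar>" x] by (simp add: abs_mult order_trans[OF abs_ge_self[of "x * Re z"]])
    then show "norm (exp w) \<le> exp \<bar>Re z\<bar>" by simp
  qed (auto intro: DERIV_exp[THEN has_field_derivative_at_within])
  then show ?thesis by (simp add: mult.commute)
qed

text \<open>Dominated convergence for the difference quotients. Differentiation brings down a factor
  of size \<open>\<bar>t\<bar>\<close>, so cubic decay leaves an integrable quadratic
  majorant.\<close>

lemma exponential_integral_has_derivative:
  fixes u :: "real \<Rightarrow> complex"
  assumes cont: "continuous_on UNIV u"
    and bound: "\<And>t. norm (u t) \<le> C / (1 + \<bar>t\<bar>) ^ 3"
  shows "((\<lambda>v. LINT t|lborel. u t * exp (of_real v * Complex c t)) has_vector_derivative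
     (LINT t|lborel. u t * Complex c t * exp (of_real v * Complex c t))) (at v)"
proof -
  define F where "F v = (LINT t|lborel. u t * exp (of_real v * Complex c t))" for v
  define D where "D = (LINT t|lborel. u t * Complex c t * exp (of_real v * Complex c t))"
  define K where "K = C * (\<bar>c\<bar> + 1) * exp (v * c) * exp \<bar>c\<bar>"
  have C: "C \<ge> 0" using bound[of 0] by (auto intro: order_trans[OF norm_ge_zero])
  have bound2: "norm (u t) * norm (Complex c t) \<le> C * (\<bar>c\<bar> + 1) / (1 + \<bar>t\<bar>)\<^sup>2" for t
  proof -
    have "norm (Complex c t) \<le> \<bar>c\<bar> + \<bar>t\<bar>" using cmod_le[of "Complex c t"] by simp
    also have "\<dots> \<le> (\<bar>c\<bar> + 1) * (1 + \<bar>t\<bar>)" by (simp add: algebra_simps)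
    finally have "norm (u t) * norm (Complex c t) \<le> C / (1 + \<bar>t\<bar>) ^ 3 * ((\<bar>c\<bar> + 1) * (1 + \<bar>t\<bar>))"
      using C by (intro mult_mono bound) auto
    also have "\<dots> = C * (\<bar>c\<bar> + 1) / (1 + \<bar>t\<bar>)\<^sup>2"
    proof -
      have "1 + \<bar>t\<bar> \<noteq> 0" by linarith
      then show ?thesis by (simp add: power2_eq_square power3_eq_cube)
    qed
    finally show ?thesis .
  qed
  have cont_exp: "continuous_on UNIV (\<lambda>t. exp (of_real x * Complex c t))" for x
    unfolding Complex_eq by (intro continuous_intros)
  have meas: "(\<lambda>t. u t * exp (of_real x * Complex c t)) \<in> borel_measurable lborel" for x
    using borel_measurable_continuous_onI[OF continuous_on_mult[OF cont cont_exp]] by simp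
  have measD: "(\<lambda>t. u t * Complex c t * exp (of_real v * Complex c t)) \<in> borel_measurable lborel"
  proof -
    have "continuous_on UNIV (\<lambda>t. u t * Complex c t * exp (of_real v * Complex c t))"
      by (intro continuous_on_mult cont cont_exp) (auto simp: Complex_eq intro!: continuous_intros)
    then show ?thesis using borel_measurable_continuous_onI by simp
  qed
  have int: "integrable lborel (\<lambda>t. u t * exp (of_real x * Complex c t))" for x
  proof (rule integrable_quadratic_decay[where C = "C * exp (x * c)"])
    show "continuous_on UNIV (\<lambda>t. u t * exp (of_real x * Complex c t))"
      by (intro continuous_on_mult cont cont_exp)
    fix t :: real
    have "C / (1 + \<bar>t\<bar>) ^ 3 \<le> C / (1 + \<bar>t\<bar>)\<^sup>2"
      using C by (intro divide_left_mono power_increasing mult_pos_pos) auto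
    then have "norm (u t) \<le> C / (1 + \<bar>t\<bar>)\<^sup>2" using bound[of t] by linarith
    from mult_right_mono[OF this, of "exp (x * c)"]
    show "norm (u t * exp (of_real x * Complex c t)) \<le> C * exp (x * c) / (1 + \<bar>t\<bar>)\<^sup>2"
      by (simp add: norm_mult)
  qed
  \<comment> \<open>The limit is tested along sequences, the form in which dominated convergence is
    stated. Each sequence is later started at an index beyond which its terms have modulus below 1,
    so that one majorant serves for all of them.\<close>
  have "((\<lambda>h. (F (v + h) - F v) / of_real h) \<longlongrightarrow> D) (at 0)"
    unfolding tendsto_at_iff_sequentially
  proof (intro allI impI)
    fix X :: "nat \<Rightarrow> real" assume X: "\<forall>i. X i \<in> UNIV - {0}" "X \<longlonglongrightarrow> 0"
    have quot: "(F (v + h) - F v) / of_real h =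
        (LINT t|lborel. (u t * exp (of_real (v + h) * Complex c t) - u t * exp (of_real v * Complex c t)) / of_real h)" for h
      unfolding F_def using int[of "v + h"] int[of v] by simp
    have factor: "(u t * exp (of_real (v + h) * Complex c t) - u t * exp (of_real v * Complex c t)) / of_real h
       = u t * exp (of_real v * Complex c t) * ((exp (of_real h * Complex c t) - 1) / of_real h)" for h t
    proof -
      have "exp (of_real (v + h) * Complex c t) = exp (of_real v * Complex c t) * exp (of_real h * Complex c t)"
        by (simp add: distrib_right exp_add)
      then show ?thesis by (simp only: right_diff_distrib mult_1_right mult.assoc times_divide_eq_right)
    qed
    obtain N where N: "\<And>n. n \<ge> N \<Longrightarrow> \<bar>X n\<bar> < 1"
      using X(2) LIMSEQ_D[of X 0 1] by auto
    have "(\<lambda>n. LINT t|lborel. (u t * exp (of_real (v + X (n + N)) * Complex c t) - u t * exp (of_real v * Complex c t)) / of_real (X (n + N)))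
       \<longlonglongrightarrow> D"
      unfolding D_def
    proof (rule integral_dominated_convergence[where w = "\<lambda>t. K / (1 + \<bar>t\<bar>)\<^sup>2"])
      show "integrable lborel (\<lambda>t. K / (1 + \<bar>t\<bar>)\<^sup>2)" by (rule integrable_inverse_quadratic)
      show "AE t in lborel. norm ((u t * exp (of_real (v + X (n + N)) * Complex c t) - u t * exp (of_real v * Complex c t)) / of_real (X (n + N)))
          \<le> K / (1 + \<bar>t\<bar>)\<^sup>2" for n
      proof (rule AE_I2)
        fix t
        define h where "h = X (n + N)"
        have h: "h \<noteq> 0" "\<bar>h\<bar> < 1" using X(1) N[of "n + N"] by (auto simp: h_def)
        have "norm (exp (of_real h * Complex c t) - 1) \<le> \<bar>h\<bar> * norm (Complex c t) * exp \<bar>h * c\<bar>"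
          using norm_exp_minus_1_le[of "of_real h * Complex c t"] by (simp add: norm_mult)
        also have "\<dots> \<le> \<bar>h\<bar> * norm (Complex c t) * exp \<bar>c\<bar>"
        proof -
          have "\<bar>h * c\<bar> \<le> \<bar>c\<bar>"
            using h mult_left_le_one_le[of "\<bar>c\<bar>" "\<bar>h\<bar>"] by (simp add: abs_mult)
          then show ?thesis by (intro mult_left_mono) auto
        qed
        finally have "norm ((exp (of_real h * Complex c t) - 1) / of_real h) \<le> norm (Complex c t) * exp \<bar>c\<bar>"
          using h by (simp add: norm_divide field_simps)
        then have "norm (u t * exp (of_real v * Complex c t) * ((exp (of_real h * Complex c t) - 1) / of_real h))
            \<le> norm (u t) * exp (v * c) * (norm (Complex c t) * exp \<bar>c\<bar>)"
          unfolding norm_mult by (intro mult_mono) auto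
        also have "\<dots> = (norm (u t) * norm (Complex c t)) * (exp (v * c) * exp \<bar>c\<bar>)" by simp
        also have "\<dots> \<le> (C * (\<bar>c\<bar> + 1) / (1 + \<bar>t\<bar>)\<^sup>2) * (exp (v * c) * exp \<bar>c\<bar>)"
          by (intro mult_right_mono bound2) auto
        also have "\<dots> = K / (1 + \<bar>t\<bar>)\<^sup>2" by (simp add: K_def)
        finally show "norm ((u t * exp (of_real (v + X (n + N)) * Complex c t) - u t * exp (of_real v * Complex c t)) / of_real (X (n + N)))
          \<le> K / (1 + \<bar>t\<bar>)\<^sup>2"
          unfolding factor h_def .
      qed
      show "AE t in lborel. (\<lambda>n. (u t * exp (of_real (v + X (n + N)) * Complex c t) - u t * exp (of_real v * Complex c t)) / of_real (X (n + N)))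
          \<longlonglongrightarrow> u t * Complex c t * exp (of_real v * Complex c t)"
      proof (rule AE_I2)
        fix t
        have "((\<lambda>z. exp (z * Complex c t)) has_field_derivative Complex c t) (at 0)"
          by (auto intro!: derivative_eq_intros)
        then have "((\<lambda>z. (exp (z * Complex c t) - 1) / z) \<longlongrightarrow> Complex c t) (at 0)"
          by (simp add: DERIV_def)
        moreover have "filterlim (\<lambda>n. of_real (X (n + N)) :: complex) (at 0) sequentially"
          unfolding filterlim_at using X(1) LIMSEQ_ignore_initial_segment[OF X(2), of N]
            tendsto_of_real[of "\<lambda>n. X (n + N)" 0 sequentially, where ?'a = complex]
          by auto
        ultimately have "(\<lambda>n. (exp (of_real (X (n + N)) * Complex c t) - 1) / of_real (X (n + N))) \<longlonglongrightarrow> Complex c t"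
          by (rule filterlim_compose)
        from tendsto_mult_left[OF this, of "u t * exp (of_real v * Complex c t)"]
        show "(\<lambda>n. (u t * exp (of_real (v + X (n + N)) * Complex c t) - u t * exp (of_real v * Complex c t)) / of_real (X (n + N)))
          \<longlonglongrightarrow> u t * Complex c t * exp (of_real v * Complex c t)"
          unfolding factor by (simp add: mult_ac)
      qed
      show "(\<lambda>t. (u t * exp (of_real (v + X (n + N)) * Complex c t) - u t * exp (of_real v * Complex c t)) / of_real (X (n + N)))
          \<in> borel_measurable lborel" for n
        by (rule borel_measurable_divide[OF borel_measurable_diff[OF meas meas]]) simp
    qed (rule measD)
    then have "(\<lambda>n. (F (v + X (n + N)) - F v) / of_real (X (n + N))) \<longlonglongrightarrow> D"
      by (simp only: quot)
    then show "((\<lambda>h. (F (v + h) - F v) / of_real h) \<circ> X) \<longlonglongrightarrow> D"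
      using LIMSEQ_offset[of "(\<lambda>h. (F (v + h) - F v) / of_real h) \<circ> X" N D] by (simp add: o_def)
  qed
  from tendsto_norm_zero[OF LIM_zero[OF this]]
  have "((\<lambda>h. norm ((F (v + h) - F v) / of_real h - D)) \<longlongrightarrow> 0) (at 0)" .
  moreover have "\<forall>\<^sub>F h in at 0. norm ((F (v + h) - F v) / of_real h - D) = norm (F (v + h) - F v - h *\<^sub>R D) / norm h"
  proof -
    have "norm ((F (v + h) - F v) / of_real h - D) = norm (F (v + h) - F v - h *\<^sub>R D) / norm h" if "h \<noteq> 0" for h
    proof -
      have "(F (v + h) - F v) / of_real h - D = (F (v + h) - F v - h *\<^sub>R D) / of_real h"
        using that by (simp add: scaleR_conv_of_real diff_divide_distrib)
      then show ?thesis by (simp add: norm_divide)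
    qed
    then show ?thesis by (auto simp: eventually_at_filter)
  qed
  ultimately have "((\<lambda>h. norm (F (v + h) - F v - h *\<^sub>R D) / norm h) \<longlongrightarrow> 0) (at 0)"
    by (rule Lim_transform_eventually)
  then have "(F has_vector_derivative D) (at v)"
    unfolding has_vector_derivative_def has_derivative_at by (simp add: bounded_linear_scaleR_left)
  then show ?thesis by (simp add: F_def[abs_def] D_def)
qed

text \<open>The inverse Mellin integral of \<open>u\<close> against \<open>y powr s\<close> along
  \<open>Re s = c\<close>, up to a constant factor. With \<open>y = exp v\<close> the power becomes
  \<open>exp (v * s)\<close>, so differentiation in \<open>v\<close> multiplies \<open>u\<close> by
  \<open>s\<close> and scaling \<open>y\<close> translates \<open>v\<close>.\<close>

definition mellin_line :: "(complex \<Rightarrow> complex) \<Rightarrow> real \<Rightarrow> real \<Rightarrow> complex" where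
  "mellin_line u c v = (LINT t|lborel. u (Complex c t) * exp (of_real v * Complex c t))"

definition line_decay :: "nat \<Rightarrow> (complex \<Rightarrow> complex) \<Rightarrow> real \<Rightarrow> bool" where
  "line_decay n u c \<longleftrightarrow> continuous_on UNIV (\<lambda>t. u (Complex c t)) \<and>
     (\<exists>C. \<forall>t. norm (u (Complex c t)) \<le> C / (1 + \<bar>t\<bar>) ^ n)"

lemma continuous_on_Complex: "continuous_on A (\<lambda>t. Complex c t)" "continuous_on A (\<lambda>x. Complex x c)"
  by (auto simp: Complex_eq intro!: continuous_intros)

lemma line_decay_continuous: "line_decay n u c \<Longrightarrow> continuous_on UNIV (\<lambda>t. u (Complex c t))"
  by (simp add: line_decay_def)

lemma line_decay_integrable:
  assumes "line_decay 2 u c"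
  shows "integrable lborel (\<lambda>t. u (Complex c t) * exp (of_real v * Complex c t))"
proof -
  from assms obtain C where C: "\<And>t. norm (u (Complex c t)) \<le> C / (1 + \<bar>t\<bar>)\<^sup>2"
    by (auto simp: line_decay_def)
  show ?thesis
  proof (rule integrable_quadratic_decay[where C = "C * exp (v * c)"])
    show "continuous_on UNIV (\<lambda>t. u (Complex c t) * exp (of_real v * Complex c t))"
      using assms by (intro continuous_intros continuous_on_Complex) (simp add: line_decay_def)
    show "norm (u (Complex c t) * exp (of_real v * Complex c t)) \<le> C * exp (v * c) / (1 + \<bar>t\<bar>)\<^sup>2" for t
      using mult_right_mono[OF C[of t], of "exp (v * c)"] by (simp add: norm_mult)
  qed
qed

lemma line_decay_mult_id:
  assumes "line_decay (Suc n) u c"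
  shows "line_decay n (\<lambda>s. u s * s) c"
proof -
  from assms obtain C where C: "\<And>t. norm (u (Complex c t)) \<le> C / (1 + \<bar>t\<bar>) ^ Suc n"
    by (auto simp: line_decay_def)
  have C0: "C \<ge> 0" using C[of 0] by (auto intro: order_trans[OF norm_ge_zero])
  have "norm (u (Complex c t) * Complex c t) \<le> C * (\<bar>c\<bar> + 1) / (1 + \<bar>t\<bar>) ^ n" for t
  proof -
    have "norm (Complex c t) \<le> \<bar>c\<bar> + \<bar>t\<bar>" using cmod_le[of "Complex c t"] by simp
    also have "\<dots> \<le> (\<bar>c\<bar> + 1) * (1 + \<bar>t\<bar>)" by (simp add: algebra_simps)
    finally have "norm (u (Complex c t)) * norm (Complex c t) \<le> C / (1 + \<bar>t\<bar>) ^ Suc n * ((\<bar>c\<bar> + 1) * (1 + \<bar>t\<bar>))"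
      using C0 by (intro mult_mono C) auto
    also have "\<dots> = C * (\<bar>c\<bar> + 1) / (1 + \<bar>t\<bar>) ^ n"
    proof -
      have "1 + \<bar>t\<bar> \<noteq> 0" by linarith
      then show ?thesis by simp
    qed
    finally show ?thesis by (simp add: norm_mult)
  qed
  then show ?thesis
    using assms by (auto simp: line_decay_def intro!: continuous_on_mult continuous_on_Complex)
qed

lemma mellin_line_has_derivative:
  assumes "line_decay 3 u c"
  shows "(mellin_line u c has_vector_derivative mellin_line (\<lambda>s. u s * s) c v) (at v)"
proof -
  from assms obtain C where "\<And>t. norm (u (Complex c t)) \<le> C / (1 + \<bar>t\<bar>) ^ 3"
    by (auto simp: line_decay_def)
  from exponential_integral_has_derivative[OF line_decay_continuous[OF assms] this, of c v]
  show ?thesis by (simp add: mellin_line_def[abs_def])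
qed

lemma mellin_line_shift:
  assumes holo: "u holomorphic_on {z. c1 \<le> Re z \<and> Re z \<le> c2}" and c: "c1 \<le> c2"
    and bound: "\<And>z. c1 \<le> Re z \<Longrightarrow> Re z \<le> c2 \<Longrightarrow> norm (u z) \<le> C / (1 + \<bar>Im z\<bar>)\<^sup>2"
  shows "mellin_line u c1 v = mellin_line u c2 v"
proof -
  define f where "f z = u z * exp (of_real v * z)" for z
  define K where "K = C * exp (\<bar>v\<bar> * (\<bar>c1\<bar> + \<bar>c2\<bar>))"
  have C: "C \<ge> 0" using bound[of "of_real c1"] c by (auto intro: order_trans[OF norm_ge_zero])
  have ld: "line_decay 2 u x" if "x \<in> {c1..c2}" for x
    unfolding line_decay_def
  proof
    show "continuous_on UNIV (\<lambda>t. u (Complex x t))"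
      using that by (intro continuous_on_compose2[OF holomorphic_on_imp_continuous_on[OF holo]] continuous_on_Complex) auto
    show "\<exists>C. \<forall>t. norm (u (Complex x t)) \<le> C / (1 + \<bar>t\<bar>)\<^sup>2"
      using bound[of "Complex x t" for t] that by (intro exI[of _ C]) auto
  qed
  have fK: "norm (f z) \<le> K / (1 + \<bar>Im z\<bar>)\<^sup>2" if "c1 \<le> Re z" "Re z \<le> c2" for z
  proof -
    have "v * Re z \<le> \<bar>v\<bar> * \<bar>Re z\<bar>" by (metis abs_ge_self abs_mult)
    also have "\<dots> \<le> \<bar>v\<bar> * (\<bar>c1\<bar> + \<bar>c2\<bar>)" using that by (intro mult_left_mono) auto
    finally have "norm (f z) \<le> C / (1 + \<bar>Im z\<bar>)\<^sup>2 * exp (\<bar>v\<bar> * (\<bar>c1\<bar> + \<bar>c2\<bar>))"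
      unfolding f_def norm_mult using C by (intro mult_mono bound that) auto
    then show ?thesis by (simp add: K_def)
  qed
  \<comment> \<open>With height 0 the exceptional part is empty: the vertical pieces have length 0
    and the two horizontal ones cancel.\<close>
  have "\<i> * ((LINT t|lborel. f (Complex c2 t)) - (LINT t|lborel. f (Complex c1 t))) =
    \<i> * (integral {-0..0} (\<lambda>t. f (Complex c2 t)) - integral {-0..0} (\<lambda>t. f (Complex c1 t))) +
    integral {c1..c2} (\<lambda>x. f (Complex x (- 0))) - integral {c1..c2} (\<lambda>x. f (Complex x 0))"
  proof (rule shift_line[where C = K])
    show "f holomorphic_on {z. c1 \<le> Re z \<and> Re z \<le> c2 \<and> 0 \<le> \<bar>Im z\<bar>}"
      unfolding f_def using holo by (intro holomorphic_intros) (simp cong: conj_cong)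
    show "continuous_on UNIV (\<lambda>t. f (Complex c1 t))" "continuous_on UNIV (\<lambda>t. f (Complex c2 t))"
      unfolding f_def using c
      by (intro continuous_on_mult continuous_on_exp line_decay_continuous[OF ld] continuous_on_const continuous_on_Complex; simp)+
    show "integrable lborel (\<lambda>t. f (Complex c1 t))" "integrable lborel (\<lambda>t. f (Complex c2 t))"
      unfolding f_def using ld c by (auto intro!: line_decay_integrable)
  qed (use fK c in auto)
  then have "(LINT t|lborel. f (Complex c2 t)) = (LINT t|lborel. f (Complex c1 t))" by simp
  then show ?thesis by (simp add: mellin_line_def f_def)
qed

lemma mellin_line_translate:
  "mellin_line u (c + d) v = exp (of_real (d * v)) * mellin_line (\<lambda>s. u (s + of_real d)) c v"
proof -
  have "Complex (c + d) t = Complex c t + of_real d" for t by (simp add: complex_eq_iff)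
  then have "mellin_line u (c + d) v =
      (LINT t|lborel. exp (of_real (d * v)) * (u (Complex c t + of_real d) * exp (of_real v * Complex c t)))"
    unfolding mellin_line_def by (simp add: distrib_left exp_add mult_ac)
  then show ?thesis by (simp add: mellin_line_def)
qed

lemma mellin_line_lincomb:
  assumes "line_decay 2 u c" "line_decay 2 w c"
    and "\<And>t. f (Complex c t) = a * u (Complex c t) + b * w (Complex c t)"
  shows "mellin_line f c v = a * mellin_line u c v + b * mellin_line w c v"
proof -
  have "mellin_line f c v = (LINT t|lborel. a * (u (Complex c t) * exp (of_real v * Complex c t)) +
      b * (w (Complex c t) * exp (of_real v * Complex c t)))"
    unfolding mellin_line_def assms(3) by (simp add: algebra_simps)
  also have "\<dots> = (LINT t|lborel. a * (u (Complex c t) * exp (of_real v * Complex c t))) +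
      (LINT t|lborel. b * (w (Complex c t) * exp (of_real v * Complex c t)))"
    using line_decay_integrable[OF assms(1), of v] line_decay_integrable[OF assms(2), of v]
    by (intro Bochner_Integration.integral_add integrable_mult_right) auto
  finally show ?thesis by (simp add: mellin_line_def)
qed

text \<open>The factor \<open>n powr (- s)\<close> only replaces \<open>v\<close> by
  \<open>v - ln n\<close>; absolute convergence on the line allows the interchange of sum and
  integral.\<close>

lemma mellin_line_series:
  fixes a :: "nat \<Rightarrow> complex"
  assumes u: "line_decay 2 u c"
    and a: "summable (\<lambda>n. norm (a (Suc n)) * real (Suc n) powr (- c))"
    and S: "\<And>t. (\<lambda>n. a (Suc n) * of_nat (Suc n) powr (- Complex c t)) sums S (Complex c t)"
  shows "(\<lambda>n. a (Suc n) * mellin_line u c (v - ln (real (Suc n)))) sums mellin_line (\<lambda>s. u s * S s) c v"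
proof -
  define f where "f n t = a (Suc n) * (u (Complex c t) * exp (of_real (v - ln (real (Suc n))) * Complex c t))" for n t
  have powr_exp: "of_nat (Suc n) powr (- s) = exp (- of_real (ln (real (Suc n))) * s)" for n and s :: complex
    by (simp add: powr_def Ln_of_nat mult.commute del: of_nat_Suc)
  have f_eq: "f n t = a (Suc n) * of_nat (Suc n) powr (- Complex c t) * (u (Complex c t) * exp (of_real v * Complex c t))" for n t
    unfolding f_def powr_exp by (simp add: algebra_simps flip: exp_add)
  have norm_f: "norm (f n t) = norm (a (Suc n)) * real (Suc n) powr (- c) * norm (u (Complex c t) * exp (of_real v * Complex c t))" for n t
    unfolding f_eq using norm_powr_real_powr[of "of_nat (Suc n)" "- Complex c t"] by (simp add: norm_mult del: of_nat_Suc)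
  have int: "integrable lborel (f n)" for n
    unfolding f_def by (intro integrable_mult_right line_decay_integrable u)
  have "(\<lambda>n. LINT t|lborel. f n t) sums (LINT t|lborel. (\<Sum>n. f n t))"
  proof (rule sums_integral[OF int])
    show "AE t in lborel. summable (\<lambda>n. norm (f n t))"
      unfolding norm_f by (intro AE_I2 summable_mult2 a)
    show "summable (\<lambda>n. LINT t|lborel. norm (f n t))"
      unfolding norm_f by (simp del: of_nat_Suc) (intro summable_mult2 a)
  qed
  moreover have "(LINT t|lborel. f n t) = a (Suc n) * mellin_line u c (v - ln (real (Suc n)))" for n
    unfolding f_def mellin_line_def by simp
  moreover have "(\<Sum>n. f n t) = u (Complex c t) * S (Complex c t) * exp (of_real v * Complex c t)" for t
    using sums_unique[OF sums_mult2[OF S[of t], of "u (Complex c t) * exp (of_real v * Complex c t)"]]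
    unfolding f_eq by (simp add: mult_ac)
  ultimately show ?thesis by (simp add: mellin_line_def)
qed

section \<open>Mellin transforms of Gamma factors\<close>

text \<open>The Gamma arguments contain \<open>s / 2\<close>, whereas decay is wanted in terms of
  \<open>t = Im s\<close>; this accounts for the factor 2.\<close>

lemma Gamma_half_strip:
  assumes "a > 0"
  obtains C where "C > 0"
    "\<And>w t. a \<le> Re w \<Longrightarrow> Re w \<le> b \<Longrightarrow> \<bar>t\<bar> = 2 * \<bar>Im w\<bar> \<Longrightarrow> norm (Gamma w) \<le> C / (1 + \<bar>t\<bar>) ^ n"
proof -
  obtain C where C: "C > 0" "\<And>z. a \<le> Re z \<Longrightarrow> Re z \<le> b \<Longrightarrow> norm (Gamma z) \<le> C / (1 + \<bar>Im z\<bar>) ^ n"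
    using norm_Gamma_strip[OF assms] by blast
  have "norm (Gamma w) \<le> C * 2 ^ n / (1 + \<bar>t\<bar>) ^ n" if w: "a \<le> Re w" "Re w \<le> b" "\<bar>t\<bar> = 2 * \<bar>Im w\<bar>" for w t
  proof -
    have "(1 + \<bar>t\<bar>) ^ n \<le> (2 * (1 + \<bar>Im w\<bar>)) ^ n"
      using w(3) by (intro power_mono) auto
    then have "C / (1 + \<bar>Im w\<bar>) ^ n \<le> C * 2 ^ n / (1 + \<bar>t\<bar>) ^ n"
    proof -
      have "C * (1 + \<bar>t\<bar>) ^ n \<le> C * 2 ^ n * (1 + \<bar>Im w\<bar>) ^ n"
        using \<open>(1 + \<bar>t\<bar>) ^ n \<le> _\<close> C(1) unfolding power_mult_distrib by (simp add: mult.assoc)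
      moreover have "(1 + \<bar>Im w\<bar>) ^ n > 0" "(1 + \<bar>t\<bar>) ^ n > 0" by (simp_all add: add_pos_nonneg)
      ultimately show ?thesis by (simp add: divide_le_eq le_divide_eq)
    qed
    then show ?thesis using C(2)[OF w(1,2)] by linarith
  qed
  then show thesis using C(1) by (intro that[of "C * 2 ^ n"]) auto
qed

text \<open>One factor supplies all the decay, and for the other boundedness, that is exponent 0, is
  enough.\<close>

lemma Gamma_product_strip:
  assumes "a > 0" "a' > 0"
  obtains C where "C > 0"
    "\<And>w w' t. a \<le> Re w \<Longrightarrow> Re w \<le> b \<Longrightarrow> a' \<le> Re w' \<Longrightarrow> Re w' \<le> b' \<Longrightarrow> \<bar>t\<bar> = 2 * \<bar>Im w\<bar> \<Longrightarrow> \<bar>t\<bar> = 2 * \<bar>Im w'\<bar>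
       \<Longrightarrow> norm (Gamma w * Gamma w') \<le> C / (1 + \<bar>t\<bar>) ^ n"
proof -
  obtain C where C: "C > 0" "\<And>w t. a \<le> Re w \<Longrightarrow> Re w \<le> b \<Longrightarrow> \<bar>t\<bar> = 2 * \<bar>Im w\<bar> \<Longrightarrow> norm (Gamma w) \<le> C / (1 + \<bar>t\<bar>) ^ n"
    by (rule Gamma_half_strip[OF assms(1)]) blast
  obtain C' where C': "C' > 0" "\<And>w t. a' \<le> Re w \<Longrightarrow> Re w \<le> b' \<Longrightarrow> \<bar>t\<bar> = 2 * \<bar>Im w\<bar> \<Longrightarrow> norm (Gamma w) \<le> C' / (1 + \<bar>t\<bar>) ^ 0"
    by (rule Gamma_half_strip[OF assms(2)]) blast
  have "norm (Gamma w * Gamma w') \<le> C * C' / (1 + \<bar>t\<bar>) ^ n"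
    if "a \<le> Re w" "Re w \<le> b" "a' \<le> Re w'" "Re w' \<le> b'" "\<bar>t\<bar> = 2 * \<bar>Im w\<bar>" "\<bar>t\<bar> = 2 * \<bar>Im w'\<bar>" for w w' t
  proof -
    have "norm (Gamma w) * norm (Gamma w') \<le> (C / (1 + \<bar>t\<bar>) ^ n) * C'"
      using C(1) C(2)[of w t] C'(2)[of w' t] that by (intro mult_mono) auto
    then show ?thesis by (simp add: norm_mult)
  qed
  then show thesis using C(1) C'(1) by (intro that[of "C * C'"]) auto
qed

lemma Re_pos_not_nonpos_Ints: "Re z > 0 \<Longrightarrow> z \<notin> \<int>\<^sub>\<le>\<^sub>0"
  by (auto elim!: nonpos_Ints_cases)

text \<open>The first factor is the one in the functional equation. The argument of the second
  exceeds that of the reflected factor \<open>Gamma ((1 - s) / 2 + \<mu>)\<close> by 1/2. As a beta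
  integral the product also has an elementary transform.\<close>

definition gamma_kernel :: "real \<Rightarrow> complex \<Rightarrow> complex" where
  "gamma_kernel \<mu> s = Gamma (s / 2 + of_real \<mu>) * Gamma (1 + of_real \<mu> - s / 2)"

lemma gamma_kernel_strip_bound:
  assumes "\<mu> \<ge> 0" "c1 > 0" "c2 < 2"
  obtains C where "\<And>s. c1 \<le> Re s \<Longrightarrow> Re s \<le> c2 \<Longrightarrow> norm (gamma_kernel \<mu> s) \<le> C / (1 + \<bar>Im s\<bar>) ^ n"
proof -
  obtain C where C: "\<And>w w' t. c1 / 2 + \<mu> \<le> Re w \<Longrightarrow> Re w \<le> c2 / 2 + \<mu> \<Longrightarrow>
      1 + \<mu> - c2 / 2 \<le> Re w' \<Longrightarrow> Re w' \<le> 1 + \<mu> - c1 / 2 \<Longrightarrow> \<bar>t\<bar> = 2 * \<bar>Im w\<bar> \<Longrightarrow> \<bar>t\<bar> = 2 * \<bar>Im w'\<bar>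
       \<Longrightarrow> norm (Gamma w * Gamma w') \<le> C / (1 + \<bar>t\<bar>) ^ n"
    by (rule Gamma_product_strip[of "c1 / 2 + \<mu>" "1 + \<mu> - c2 / 2"]) (use assms in auto)
  show thesis
    by (rule that[of C], unfold gamma_kernel_def, rule C) auto
qed

lemma gamma_kernel_holomorphic: "gamma_kernel \<mu> holomorphic_on {s. - 2 * \<mu> < Re s \<and> Re s < 2 + 2 * \<mu>}"
  unfolding gamma_kernel_def by (intro holomorphic_intros Re_pos_not_nonpos_Ints) auto

lemma gamma_kernel_line_decay:
  assumes "\<mu> \<ge> 0" "0 < c" "c < 2"
  shows "line_decay n (gamma_kernel \<mu>) c"
proof -
  obtain C where C: "\<And>s. c \<le> Re s \<Longrightarrow> Re s \<le> c \<Longrightarrow> norm (gamma_kernel \<mu> s) \<le> C / (1 + \<bar>Im s\<bar>) ^ n"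
    using gamma_kernel_strip_bound[OF assms] by blast
  have "continuous_on UNIV (\<lambda>t. gamma_kernel \<mu> (Complex c t))"
    using assms by (intro continuous_on_compose2[OF holomorphic_on_imp_continuous_on[OF gamma_kernel_holomorphic[of \<mu>]]] continuous_on_Complex) auto
  then show ?thesis
    unfolding line_decay_def using C[of "Complex c t" for t] by auto
qed

text \<open>On \<open>Re s = 1\<close> the two Gamma arguments are complex conjugates, so at
  \<open>v = 0\<close> the integrand is a positive function. This will exclude the zero solution of
  the differential equation.\<close>

lemma gamma_kernel_transform_nonzero:
  assumes \<mu>: "\<mu> \<ge> 0"
  shows "mellin_line (gamma_kernel \<mu>) 1 0 \<noteq> 0"
proof -
  define g where "g t = (norm (Gamma (Complex (1/2 + \<mu>) (t / 2))))\<^sup>2" for t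
  have eq: "gamma_kernel \<mu> (Complex 1 t) = of_real (g t)" for t
  proof -
    have "Complex 1 t / 2 + of_real \<mu> = Complex (1/2 + \<mu>) (t / 2)"
      "1 + of_real \<mu> - Complex 1 t / 2 = cnj (Complex (1/2 + \<mu>) (t / 2))"
      by (auto simp: complex_eq_iff)
    then have "gamma_kernel \<mu> (Complex 1 t) = Gamma (Complex (1/2 + \<mu>) (t / 2)) * cnj (Gamma (Complex (1/2 + \<mu>) (t / 2)))"
      unfolding gamma_kernel_def by (simp only: cnj_Gamma)
    then show ?thesis unfolding g_def complex_norm_square .
  qed
  have pos: "g t > 0" for t
    unfolding g_def using \<mu> by (simp add: Gamma_eq_zero_iff Re_pos_not_nonpos_Ints)
  have "integrable lborel (\<lambda>t. gamma_kernel \<mu> (Complex 1 t))"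
    using line_decay_integrable[OF gamma_kernel_line_decay[OF \<mu>, of 1 2], of 0] by simp
  then have int: "integrable lborel g"
    unfolding eq by (simp add: complex_of_real_integrable_eq)
  have "(LINT t|lborel. g t) \<noteq> 0"
  proof
    assume "(LINT t|lborel. g t) = 0"
    then have "AE t in lborel. g t = 0"
      using integral_nonneg_eq_0_iff_AE[OF int] pos by (simp add: less_imp_le)
    then have "AE t in (lborel :: real measure). False"
      by eventually_elim (use pos in \<open>auto simp: less_le\<close>)
    then show False
      using AE_iff_measurable[of "UNIV :: real set" lborel "\<lambda>_. False"] by simp
  qed
  moreover have "mellin_line (gamma_kernel \<mu>) 1 0 = of_real (LINT t|lborel. g t)"
    unfolding mellin_line_def eq by simp
  ultimately show ?thesis by simp
qed

text \<open>The Mellin transforms here and in \<open>Gamma_transform\<close> are found by solving the first-order differential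
  equation into which the functional equation of the Gamma function translates.\<close>

lemma gamma_kernel_transform:
  assumes \<mu>: "\<mu> \<ge> 0"
  obtains A where "A \<noteq> 0"
    "\<And>v. mellin_line (gamma_kernel \<mu>) (3/2) v = A * of_real (exp ((2 * \<mu> + 2) * v) * (1 + exp (2 * v)) powr (- 2 * \<mu> - 1))"
proof -
  define k where "k = mellin_line (gamma_kernel \<mu>) (3/2)"
  define k' where "k' = mellin_line (\<lambda>s. gamma_kernel \<mu> s * s) (3/2)"
  \<comment> \<open>Raising either Gamma argument by 1 leads to the same function:
    \<open>J s\<close> is \<open>s / 2 + \<mu>\<close> times the kernel, and
    \<open>J (s - 2)\<close> is \<open>1 + \<mu> - s / 2\<close> times the kernel. As
    \<open>J\<close> is holomorphic between the lines -1/2 and 3/2, equating its two integrals gives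
    the differential equation.\<close>
  define J where "J s = Gamma (s / 2 + of_real \<mu> + 1) * Gamma (1 + of_real \<mu> - s / 2)" for s :: complex
  have ld: "line_decay n (gamma_kernel \<mu>) (3/2)" for n using \<mu> by (intro gamma_kernel_line_decay) auto
  have ld': "line_decay n (\<lambda>s. gamma_kernel \<mu> s * s) (3/2)" for n by (intro line_decay_mult_id ld)
  have deriv: "(k has_vector_derivative k' v) (at v)" for v
    unfolding k_def k'_def by (intro mellin_line_has_derivative ld)
  have shift: "mellin_line J (-1/2) v = mellin_line J (3/2) v" for v
  proof -
    obtain C where C: "\<And>w w' t. 3/4 + \<mu> \<le> Re w \<Longrightarrow> Re w \<le> 7/4 + \<mu> \<Longrightarrow>
        1/4 + \<mu> \<le> Re w' \<Longrightarrow> Re w' \<le> 5/4 + \<mu> \<Longrightarrow> \<bar>t\<bar> = 2 * \<bar>Im w\<bar> \<Longrightarrow> \<bar>t\<bar> = 2 * \<bar>Im w'\<bar>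
         \<Longrightarrow> norm (Gamma w * Gamma w') \<le> C / (1 + \<bar>t\<bar>)\<^sup>2"
      by (rule Gamma_product_strip[of "3/4 + \<mu>" "1/4 + \<mu>"]) (use \<mu> in auto)
    show ?thesis
    proof (rule mellin_line_shift)
      show "J holomorphic_on {z. -1/2 \<le> Re z \<and> Re z \<le> 3/2}"
        unfolding J_def using \<mu> by (intro holomorphic_intros Re_pos_not_nonpos_Ints) auto
      show "norm (J z) \<le> C / (1 + \<bar>Im z\<bar>)\<^sup>2" if "-1/2 \<le> Re z" "Re z \<le> 3/2" for z
        unfolding J_def using that by (intro C) auto
    qed simp
  qed
  have J1: "mellin_line J (3/2) v = 1/2 * k' v + of_real \<mu> * k v" for v
    unfolding k_def k'_def
  proof (rule mellin_line_lincomb[OF ld' ld])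
    fix t
    have "Complex (3/2) t / 2 + of_real \<mu> \<notin> \<int>\<^sub>\<le>\<^sub>0" using \<mu> by (intro Re_pos_not_nonpos_Ints) auto
    then show "J (Complex (3/2) t) = 1/2 * (gamma_kernel \<mu> (Complex (3/2) t) * Complex (3/2) t) + of_real \<mu> * gamma_kernel \<mu> (Complex (3/2) t)"
      unfolding J_def gamma_kernel_def by (subst Gamma_plus1) (simp_all add: algebra_simps)
  qed
  have J2: "mellin_line (\<lambda>s. J (s + of_real (- 2))) (3/2) v = - 1/2 * k' v + of_real (\<mu> + 1) * k v" for v
    unfolding k_def k'_def
  proof (rule mellin_line_lincomb[OF ld' ld])
    fix t
    have nz: "1 + of_real \<mu> - Complex (3/2) t / 2 \<notin> \<int>\<^sub>\<le>\<^sub>0" using \<mu> by (intro Re_pos_not_nonpos_Ints) auto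
    have e1: "1 + of_real \<mu> - (Complex (3/2) t + of_real (- 2)) / 2 = (1 + of_real \<mu> - Complex (3/2) t / 2) + 1"
      and e2: "(Complex (3/2) t + of_real (- 2)) / 2 + of_real \<mu> + 1 = Complex (3/2) t / 2 + of_real \<mu>"
      by (simp_all add: field_simps)
    show "J (Complex (3/2) t + of_real (- 2)) = - 1/2 * (gamma_kernel \<mu> (Complex (3/2) t) * Complex (3/2) t) + of_real (\<mu> + 1) * gamma_kernel \<mu> (Complex (3/2) t)"
      unfolding J_def gamma_kernel_def e1 e2 Gamma_plus1[OF nz] by (simp add: algebra_simps)
  qed
  have ode: "of_real (1 + exp (2 * v)) * k' v = of_real (2 * (\<mu> + 1) - 2 * \<mu> * exp (2 * v)) * k v" for v
  proof -
    have "mellin_line J (-1/2) v = exp (of_real (- 2 * v)) * mellin_line (\<lambda>s. J (s + of_real (- 2))) (3/2) v"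
      using mellin_line_translate[of J "3/2" "- 2" v] by simp
    then have "1/2 * k' v + of_real \<mu> * k v = of_real (exp (- 2 * v)) * (- 1/2 * k' v + of_real (\<mu> + 1) * k v)"
      unfolding shift J1 J2 by (simp only: exp_of_real)
    then have "of_real (exp (2 * v)) * (1/2 * k' v + of_real \<mu> * k v) =
        of_real (exp (2 * v) * exp (- 2 * v)) * (- 1/2 * k' v + of_real (\<mu> + 1) * k v)"
      by (simp only: of_real_mult mult.assoc)
    also have "exp (2 * v) * exp (- 2 * v) = 1" by (simp flip: exp_add)
    finally have eq: "of_real (exp (2 * v)) * (1/2 * k' v + of_real \<mu> * k v) = - 1/2 * k' v + of_real (\<mu> + 1) * k v"
      by simp
    have "of_real (1 + exp (2 * v)) * k' v - of_real (2 * (\<mu> + 1) - 2 * \<mu> * exp (2 * v)) * k v =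
        2 * (of_real (exp (2 * v)) * (1/2 * k' v + of_real \<mu> * k v)) - 2 * (- 1/2 * k' v + of_real (\<mu> + 1) * k v)"
      by (simp add: algebra_simps)
    also have "\<dots> = 0" unfolding eq by simp
    finally show ?thesis by simp
  qed
  \<comment> \<open>The integrating factor, the reciprocal of the claimed solution.\<close>
  define \<rho> where "\<rho> v = exp (- (2 * \<mu> + 2) * v) * (1 + exp (2 * v)) powr (2 * \<mu> + 1)" for v :: real
  define \<rho>' where "\<rho>' v = \<rho> v * ((- 2 * (\<mu> + 1) + 2 * \<mu> * exp (2 * v)) / (1 + exp (2 * v)))" for v :: real
  have pos: "1 + exp (2 * v) > 0" for v :: real by (intro add_pos_pos) auto
  have d\<rho>: "(\<rho> has_real_derivative \<rho>' v) (at v)" for v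
  proof -
    have "((\<lambda>v. exp (- (2 * \<mu> + 2) * v)) has_real_derivative exp (- (2 * \<mu> + 2) * v) * (- (2 * \<mu> + 2))) (at v)"
      by (auto intro!: derivative_eq_intros)
    moreover have "((\<lambda>v. (1 + exp (2 * v)) powr (2 * \<mu> + 1)) has_real_derivative
        (2 * \<mu> + 1) * (1 + exp (2 * v)) powr (2 * \<mu> + 1 - 1) * (2 * exp (2 * v))) (at v)"
      using pos[of v] by (auto intro!: derivative_eq_intros)
    ultimately have "(\<rho> has_real_derivative exp (- (2 * \<mu> + 2) * v) * (- (2 * \<mu> + 2)) * (1 + exp (2 * v)) powr (2 * \<mu> + 1) +
       (2 * \<mu> + 1) * (1 + exp (2 * v)) powr (2 * \<mu> + 1 - 1) * (2 * exp (2 * v)) * exp (- (2 * \<mu> + 2) * v)) (at v)"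
      unfolding \<rho>_def by (rule DERIV_mult)
    also have "(1 + exp (2 * v)) powr (2 * \<mu> + 1 - 1) = (1 + exp (2 * v)) powr (2 * \<mu> + 1) / (1 + exp (2 * v))"
      using pos[of v] by (simp only: powr_diff powr_one_eq_one powr_one)
    also have "exp (- (2 * \<mu> + 2) * v) * (- (2 * \<mu> + 2)) * (1 + exp (2 * v)) powr (2 * \<mu> + 1) +
       (2 * \<mu> + 1) * ((1 + exp (2 * v)) powr (2 * \<mu> + 1) / (1 + exp (2 * v))) * (2 * exp (2 * v)) * exp (- (2 * \<mu> + 2) * v)
       = \<rho> v * (- (2 * \<mu> + 2) + (2 * \<mu> + 1) * (2 * exp (2 * v)) / (1 + exp (2 * v)))"
      unfolding \<rho>_def by (simp add: algebra_simps)
    also have "- (2 * \<mu> + 2) + (2 * \<mu> + 1) * (2 * exp (2 * v)) / (1 + exp (2 * v)) =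
        (- 2 * (\<mu> + 1) + 2 * \<mu> * exp (2 * v)) / (1 + exp (2 * v))"
      using pos[of v] by (simp add: divide_simps) (simp add: algebra_simps)
    finally show ?thesis unfolding \<rho>'_def .
  qed
  have "((\<lambda>v. of_real (\<rho> v) * k v) has_vector_derivative 0) (at v)" for v
  proof -
    have "((\<lambda>v. of_real (\<rho> v) * k v) has_vector_derivative of_real (\<rho> v) * k' v + of_real (\<rho>' v) * k v) (at v)"
      by (intro has_vector_derivative_mult deriv has_vector_derivative_of_real)
        (use d\<rho> in \<open>simp add: has_real_derivative_iff_has_vector_derivative\<close>)
    moreover have "of_real (\<rho> v) * k' v + of_real (\<rho>' v) * k v = 0"
    proof -
      have "k' v = of_real ((2 * (\<mu> + 1) - 2 * \<mu> * exp (2 * v)) / (1 + exp (2 * v))) * k v"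
      proof -
        have "complex_of_real (1 + exp (2 * v)) \<noteq> 0" using pos[of v] by (simp only: of_real_eq_0_iff)
        then have "k' v = of_real (1 + exp (2 * v)) * k' v / of_real (1 + exp (2 * v))"
          by (rule nonzero_mult_div_cancel_left[symmetric])
        then show ?thesis unfolding ode of_real_divide by (simp only: times_divide_eq_left)
      qed
      moreover have "\<rho>' v = - (\<rho> v * ((2 * (\<mu> + 1) - 2 * \<mu> * exp (2 * v)) / (1 + exp (2 * v))))"
        unfolding \<rho>'_def by (simp add: divide_simps) (simp add: algebra_simps)
      ultimately show ?thesis by simp
    qed
    ultimately show ?thesis by simp
  qed
  then obtain A where A: "\<And>v. of_real (\<rho> v) * k v = A"
    using has_vector_derivative_zero_constant[of UNIV "\<lambda>v. of_real (\<rho> v) * k v"] by auto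
  have kA: "k v = A * of_real (exp ((2 * \<mu> + 2) * v) * (1 + exp (2 * v)) powr (- 2 * \<mu> - 1))" for v
  proof -
    have "(1 + exp (2 * v)) powr (2 * \<mu> + 1) * (1 + exp (2 * v)) powr (- 2 * \<mu> - 1) = 1"
      using pos[of v] by (simp flip: powr_add)
    moreover have "exp (- (2 * \<mu> + 2) * v) * exp ((2 * \<mu> + 2) * v) = 1"
      by (subst exp_add[symmetric]) (simp add: algebra_simps)
    ultimately have "\<rho> v * (exp ((2 * \<mu> + 2) * v) * (1 + exp (2 * v)) powr (- 2 * \<mu> - 1)) = 1"
    proof -
      have "\<rho> v * (exp ((2 * \<mu> + 2) * v) * (1 + exp (2 * v)) powr (- 2 * \<mu> - 1)) =
          (exp (- (2 * \<mu> + 2) * v) * exp ((2 * \<mu> + 2) * v)) *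
          ((1 + exp (2 * v)) powr (2 * \<mu> + 1) * (1 + exp (2 * v)) powr (- 2 * \<mu> - 1))"
        unfolding \<rho>_def by (simp only: mult_ac)
      then show ?thesis
        using \<open>_ powr _ * _ powr _ = 1\<close> \<open>exp _ * exp _ = 1\<close> by (simp only: mult_1)
    qed
    then have "of_real (\<rho> v) * of_real (exp ((2 * \<mu> + 2) * v) * (1 + exp (2 * v)) powr (- 2 * \<mu> - 1)) = (1::complex)"
      by (simp only: of_real_mult[symmetric] of_real_1)
    then have "k v = (of_real (\<rho> v) * k v) * of_real (exp ((2 * \<mu> + 2) * v) * (1 + exp (2 * v)) powr (- 2 * \<mu> - 1))"
      by (simp only: mult.assoc mult.commute[of "k v"]) (simp only: mult.assoc[symmetric] mult_1)
    then show ?thesis unfolding A .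
  qed
  have "A \<noteq> 0"
  proof
    assume "A = 0"
    then have "k 0 = 0" using kA[of 0] by simp
    moreover have "mellin_line (gamma_kernel \<mu>) 1 0 = mellin_line (gamma_kernel \<mu>) (3/2) 0"
    proof -
      obtain C where C: "\<And>s. 1 \<le> Re s \<Longrightarrow> Re s \<le> 3/2 \<Longrightarrow> norm (gamma_kernel \<mu> s) \<le> C / (1 + \<bar>Im s\<bar>)\<^sup>2"
        by (rule gamma_kernel_strip_bound[OF \<mu>, of 1 "3/2" 2]) auto
      show ?thesis
        by (rule mellin_line_shift[OF holomorphic_on_subset[OF gamma_kernel_holomorphic[of \<mu>]] _ C]) (use \<mu> in auto)
    qed
    ultimately show False using gamma_kernel_transform_nonzero[OF \<mu>] by (simp add: k_def)
  qed
  then show thesis using that[of A] kA by (simp add: k_def)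
qed

lemma Gamma_line_decay:
  assumes "c > 0"
  shows "line_decay n Gamma c"
proof -
  obtain C where "\<And>z. c \<le> Re z \<Longrightarrow> Re z \<le> c \<Longrightarrow> norm (Gamma z) \<le> C / (1 + \<bar>Im z\<bar>) ^ n"
    using norm_Gamma_strip[OF assms] by blast
  from this[of "Complex c t" for t] have "\<exists>C. \<forall>t. norm (Gamma (Complex c t)) \<le> C / (1 + \<bar>t\<bar>) ^ n" by auto
  moreover have "continuous_on UNIV (\<lambda>t. Gamma (Complex c t))"
    using assms by (intro continuous_on_compose2[OF continuous_on_Gamma[of "{z. Re z > 0}"]] continuous_on_Complex) (auto dest: Re_pos_not_nonpos_Ints)
  ultimately show ?thesis unfolding line_decay_def by blast
qed

lemma Gamma_transform:
  assumes c: "c > 0"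
  obtains A where "\<And>v. mellin_line Gamma c v = A * of_real (exp (- exp (- v)))"
proof -
  define \<psi> where "\<psi> = mellin_line Gamma c"
  have shift: "mellin_line Gamma c v = mellin_line Gamma (c + 1) v" for v
  proof -
    obtain C where "\<And>z. c \<le> Re z \<Longrightarrow> Re z \<le> c + 1 \<Longrightarrow> norm (Gamma z) \<le> C / (1 + \<bar>Im z\<bar>)\<^sup>2"
      using norm_Gamma_strip[OF c] by blast
    then show ?thesis
      by (intro mellin_line_shift holomorphic_intros Re_pos_not_nonpos_Ints) (use c in auto)
  qed
  have "(\<psi> has_vector_derivative of_real (exp (- v)) * \<psi> v) (at v)" for v
  proof -
    have "mellin_line Gamma (c + 1) v = of_real (exp v) * mellin_line (\<lambda>s. Gamma (s + 1)) c v"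
      using mellin_line_translate[of Gamma c 1 v] by (simp add: exp_of_real)
    moreover have "mellin_line (\<lambda>s. Gamma (s + 1)) c v = mellin_line (\<lambda>s. Gamma s * s) c v"
      unfolding mellin_line_def using c
      by (intro Bochner_Integration.integral_cong) (auto simp: Gamma_plus1 Re_pos_not_nonpos_Ints)
    moreover have "of_real (exp (- v)) * (of_real (exp v) * z) = z" for z :: complex
      by (simp flip: mult.assoc of_real_mult exp_add)
    ultimately have "mellin_line (\<lambda>s. Gamma s * s) c v = of_real (exp (- v)) * \<psi> v"
      unfolding \<psi>_def shift by simp
    then show ?thesis
      using mellin_line_has_derivative[OF Gamma_line_decay[OF c], of v] by (simp add: \<psi>_def)
  qed
  note d\<psi> = this
  have "((\<lambda>v. of_real (exp (exp (- v))) * \<psi> v) has_vector_derivative 0) (at v)" for v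
  proof -
    have "((\<lambda>v. exp (exp (- v))) has_real_derivative - (exp (exp (- v)) * exp (- v))) (at v)" for v :: real
      by (auto intro!: derivative_eq_intros)
    then have "((\<lambda>v. of_real (exp (exp (- v))) * \<psi> v) has_vector_derivative
      of_real (exp (exp (- v))) * (of_real (exp (- v)) * \<psi> v) + of_real (- (exp (exp (- v)) * exp (- v))) * \<psi> v) (at v)"
      by (intro has_vector_derivative_mult d\<psi> has_vector_derivative_of_real)
        (simp add: has_real_derivative_iff_has_vector_derivative)
    then show ?thesis by simp
  qed
  then obtain A where A: "\<And>v. of_real (exp (exp (- v))) * \<psi> v = A"
    using has_vector_derivative_zero_constant[of UNIV "\<lambda>v. of_real (exp (exp (- v))) * \<psi> v"] by auto
  have "\<psi> v = A * of_real (exp (- exp (- v)))" for v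
  proof -
    have "of_real (exp (- exp (- v))) * (of_real (exp (exp (- v))) * \<psi> v) = \<psi> v"
      by (simp flip: mult.assoc of_real_mult exp_add)
    then show ?thesis unfolding A by (simp add: mult.commute)
  qed
  then show thesis using that by (simp add: \<psi>_def)
qed

section \<open>Two evaluations of the contour integral\<close>

text \<open>Differentiation under the integral sign over a compact interval. Every piece of the
  contour remainder has this form, so the remainder extends across the imaginary axis, where the two
  series become singular.\<close>

lemma powr_parameter_integral_holomorphic:
  fixes u w :: "real \<Rightarrow> complex"
  assumes "continuous_on {a..b} u" "continuous_on {a..b} w"
  shows "(\<lambda>y. integral {a..b} (\<lambda>x. u x * y powr w x)) holomorphic_on - \<real>\<^sub>\<le>\<^sub>0"
proof -
  have op: "open (- \<real>\<^sub>\<le>\<^sub>0 :: complex set)" by (simp add: open_Compl)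
  have "(\<lambda>y. integral {a..b} (\<lambda>x. u x * y powr w x)) field_differentiable at y0" if y0: "y0 \<in> - \<real>\<^sub>\<le>\<^sub>0" for y0
  proof -
    obtain e where e: "e > 0" "ball y0 e \<subseteq> - \<real>\<^sub>\<le>\<^sub>0" using op y0 open_contains_ball by blast
    have "(\<lambda>y. integral (cbox a b) (\<lambda>x. u x * y powr w x)) holomorphic_on ball y0 e"
    proof (rule leibniz_rule_holomorphic[where fx = "\<lambda>y x. u x * (w x * y powr (w x - 1))"])
      fix y x assume y: "y \<in> ball y0 e"
      then have "y \<notin> \<real>\<^sub>\<le>\<^sub>0" using e by auto
      then show "((\<lambda>y. u x * y powr w x) has_field_derivative u x * (w x * y powr (w x - 1))) (at y within ball y0 e)"
        by (intro DERIV_cmult has_field_derivative_at_within[OF has_field_derivative_powr])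
    next
      fix y assume y: "y \<in> ball y0 e"
      then have "y \<noteq> 0" using e(2) by (metis ComplD nonpos_Reals_zero_I subsetD)
      then show "(\<lambda>x. u x * y powr w x) integrable_on cbox a b"
        using assms by (intro integrable_continuous) (auto intro!: continuous_intros simp: powr_def)
    next
      have "continuous_on (ball y0 e \<times> cbox a b) (\<lambda>z. u (snd z) * (w (snd z) * exp ((w (snd z) - 1) * Ln (fst z))))"
        using e(2) assms
        by (intro continuous_intros continuous_on_compose2[OF assms(1)] continuous_on_compose2[OF assms(2)])
           auto
      then show "continuous_on (ball y0 e \<times> cbox a b) (\<lambda>(y, x). u x * (w x * y powr (w x - 1)))"
        by (rule continuous_on_eq) (use e(2) in \<open>auto simp: powr_def\<close>)
    qed auto
    then show ?thesis
      using e(1) by (auto intro: holomorphic_on_imp_differentiable_at simp: cbox_interval)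
  qed
  then show ?thesis by (simp add: field_differentiable_at_within holomorphic_on_def)
qed

lemma summable_powr_exp:
  assumes "\<delta> > (0::real)"
  shows "summable (\<lambda>n. real (Suc n) powr p * exp (- \<delta> * real (Suc n)))"
proof (rule summable_comparison_test_bigo[of "\<lambda>n. real (Suc n) powr (-2)"])
  have "summable (\<lambda>n. real n powr (-2))" by (simp add: summable_real_powr_iff)
  then have "summable (\<lambda>n. real (Suc n) powr (-2))" by (subst summable_Suc_iff)
  then show "summable (\<lambda>n. norm (real (Suc n) powr (-2)))" by simp
  show "(\<lambda>n. real (Suc n) powr p * exp (- \<delta> * real (Suc n))) \<in> O(\<lambda>n. real (Suc n) powr (-2))"
    using assms by real_asymp
qed

lemma Im_nonzero_not_nonpos_Ints: "Im z \<noteq> 0 \<Longrightarrow> z \<notin> \<int>\<^sub>\<le>\<^sub>0"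
  by (auto elim!: nonpos_Ints_cases)

text \<open>What remains of the hypotheses once the shift \<open>\<mu>\<close> is real:
  \<open>G\<close> is a translate of \<open>F\<close> and \<open>s0\<close> the translate of the
  point 1. Growth and functional equation are imposed from the height \<open>T0\<close> on, away
  from \<open>s0\<close> and from the real axis, so that the Gamma factors there have no poles.
  \<open>\<omega>\<close> combines the root number with the power of \<open>Q\<close> due to the
  translation.\<close>

locale degree_one =
  fixes G :: "complex \<Rightarrow> complex" and A :: "nat \<Rightarrow> complex" and \<mu> Q T0 KA CG :: real and \<omega> s0 :: complex and N :: nat
  assumes Q: "Q > 0" and \<mu>: "\<mu> \<ge> 0" and \<omega>: "\<omega> \<noteq> 0" and T0: "T0 > 0"
    and dirichlet: "Re s > 1 \<Longrightarrow> (\<lambda>n. A (Suc n) * of_nat (Suc n) powr (- s)) sums G s"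
    and coeff_bound: "n > 0 \<Longrightarrow> norm (A n) \<le> KA * real n powr (1/4)"
    and A1: "A 1 = 1"
    and holo: "G holomorphic_on - {s0}" and s0: "Re s0 = 1" "\<bar>Im s0\<bar> < T0"
    and growth: "-1/2 \<le> Re s \<Longrightarrow> Re s \<le> 3/2 \<Longrightarrow> T0 \<le> \<bar>Im s\<bar> \<Longrightarrow> norm (G s) \<le> CG * (1 + \<bar>Im s\<bar>) ^ N"
    and fe: "T0 \<le> \<bar>Im s\<bar> \<Longrightarrow> \<omega> * of_real Q powr s * Gamma (s / 2 + of_real \<mu>) * G s =
       of_real Q powr (1 - s) * Gamma ((1 - s) / 2 + of_real \<mu>) * cnj (G (cnj (1 - s)))"
begin

lemma KA: "KA \<ge> 0"
  using coeff_bound[of 1] by (auto intro: order_trans[OF norm_ge_zero])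

lemma coeff_summable: "summable (\<lambda>n. norm (A (Suc n)) * real (Suc n) powr (- (3/2)))"
proof (rule summable_comparison_test'[of "\<lambda>n. KA * real (Suc n) powr (- (5/4))" 0])
  have "summable (\<lambda>n. real n powr (- (5/4)))" by (simp add: summable_real_powr_iff)
  then show "summable (\<lambda>n. KA * real (Suc n) powr (- (5/4)))"
    by (subst (asm) summable_Suc_iff[symmetric]) (rule summable_mult)
  show "norm (norm (A (Suc n)) * real (Suc n) powr (- (3/2))) \<le> KA * real (Suc n) powr (- (5/4))" for n
  proof -
    have "norm (A (Suc n)) * real (Suc n) powr (- (3/2)) \<le> KA * real (Suc n) powr (1/4) * real (Suc n) powr (- (3/2))"
      by (intro mult_right_mono coeff_bound) auto
    also have "\<dots> = KA * real (Suc n) powr (- (5/4))"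
      by (simp flip: powr_add)
    finally show ?thesis by (simp del: of_nat_Suc)
  qed
qed

lemma G_line: obtains M where "\<And>t. norm (G (Complex (3/2) t)) \<le> M"
proof -
  have "norm (G (Complex (3/2) t)) \<le> (\<Sum>n. norm (A (Suc n)) * real (Suc n) powr (- (3/2)))" for t
  proof -
    have "norm (\<Sum>n. A (Suc n) * of_nat (Suc n) powr (- Complex (3/2) t)) \<le> (\<Sum>n. norm (A (Suc n)) * real (Suc n) powr (- (3/2)))"
    proof (rule norm_suminf_le[OF _ coeff_summable])
      show "norm (A (Suc n) * of_nat (Suc n) powr (- Complex (3/2) t)) \<le> norm (A (Suc n)) * real (Suc n) powr (- (3/2))" for n
        using norm_powr_real_powr[of "of_nat (Suc n)" "- Complex (3/2) t"] by (simp add: norm_mult del: of_nat_Suc)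
    qed
    then show ?thesis using sums_unique[OF dirichlet[of "Complex (3/2) t"]] by simp
  qed
  then show thesis by (rule that)
qed

lemma G_continuous_line: "c > 1 \<Longrightarrow> continuous_on UNIV (\<lambda>t. G (Complex c t))"
  using s0 by (intro continuous_on_compose2[OF holomorphic_on_imp_continuous_on[OF holo]] continuous_on_Complex) auto

lemma KG_line_decay: "line_decay n (\<lambda>s. gamma_kernel \<mu> s * G s) (3/2)"
proof -
  obtain M where M: "\<And>t. norm (G (Complex (3/2) t)) \<le> M" using G_line by blast
  have ld: "line_decay n (gamma_kernel \<mu>) (3/2)" using \<mu> by (intro gamma_kernel_line_decay) auto
  then obtain C where C: "\<And>t. norm (gamma_kernel \<mu> (Complex (3/2) t)) \<le> C / (1 + \<bar>t\<bar>) ^ n"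
    by (auto simp: line_decay_def)
  have "norm (gamma_kernel \<mu> (Complex (3/2) t) * G (Complex (3/2) t)) \<le> C * M / (1 + \<bar>t\<bar>) ^ n" for t
    using mult_mono[OF C[of t] M[of t]] C[of t] by (simp add: norm_mult order_trans[OF norm_ge_zero])
  then show ?thesis
    using ld G_continuous_line unfolding line_decay_def by (auto intro!: continuous_on_mult)
qed

definition Cbar :: "complex \<Rightarrow> complex" where "Cbar s = cnj (G (cnj s))"

lemma Cbar_sums: "Re s > 1 \<Longrightarrow> (\<lambda>n. cnj (A (Suc n)) * of_nat (Suc n) powr (- s)) sums Cbar s"
proof -
  assume "Re s > 1"
  then have "(\<lambda>n. cnj (A (Suc n) * of_nat (Suc n) powr (- cnj s))) sums cnj (G (cnj s))"
    by (subst sums_cnj) (rule dirichlet, simp)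
  moreover have "cnj (of_nat (Suc n) powr (- cnj s)) = of_nat (Suc n) powr (- s)" for n
    using cnj_powr[of "of_nat (Suc n)" "- cnj s"] by simp
  ultimately show ?thesis by (simp add: Cbar_def)
qed

text \<open>The functional equation times the kernel, with the Gamma factors combined by the duplication formula.\<close>

definition dual :: "complex \<Rightarrow> complex" where
  "dual s = of_real (sqrt pi) / \<omega> * of_real Q powr (1 - 2 * s) * exp ((s - 2 * of_real \<mu>) * of_real (ln 2)) *
     Gamma (1 + 2 * of_real \<mu> - s) * Cbar (1 - s)"

lemma gamma_kernel_G_eq_dual:
  assumes "T0 \<le> \<bar>Im s\<bar>"
  shows "gamma_kernel \<mu> s * G s = dual s"
proof -
  have Im: "Im s \<noteq> 0" using assms T0 by auto
  \<comment> \<open>The argument of the reflected Gamma factor; the second factor of the kernel is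
    then \<open>Gamma (z + 1/2)\<close>.\<close>
  define z where "z = (1 - s) / 2 + of_real \<mu>"
  have z: "1 + of_real \<mu> - s / 2 = z + 1/2" "2 * z = 1 + 2 * of_real \<mu> - s" "1 - 2 * z = s - 2 * of_real \<mu>"
    by (simp_all add: z_def field_simps)
  have dup: "Gamma z * Gamma (z + 1/2) = exp ((s - 2 * of_real \<mu>) * of_real (ln 2)) * of_real (sqrt pi) * Gamma (1 + 2 * of_real \<mu> - s)"
    unfolding z(2,3)[symmetric] using Im by (intro Gamma_legendre_duplication Im_nonzero_not_nonpos_Ints) (auto simp: z_def)
  have Qs: "of_real Q powr s \<noteq> 0" using Q by simp
  have Q1: "of_real Q powr (1 - s) = of_real Q powr (1 - 2 * s) * of_real Q powr s"
    by (simp flip: powr_add)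
  have "(\<omega> * of_real Q powr s) * (gamma_kernel \<mu> s * G s) =
      Gamma (z + 1/2) * (\<omega> * of_real Q powr s * Gamma (s / 2 + of_real \<mu>) * G s)"
    unfolding gamma_kernel_def z by (simp only: mult_ac)
  also have "\<dots> = of_real Q powr (1 - s) * (Gamma z * Gamma (z + 1/2)) * Cbar (1 - s)"
    unfolding fe[OF assms] z_def[symmetric] Cbar_def by (simp only: mult_ac)
  also have "\<dots> = (\<omega> * of_real Q powr s) * dual s"
    unfolding dup dual_def Q1 using \<omega> by (simp add: mult_ac)
  finally show ?thesis using \<omega> Qs by simp
qed

text \<open>Reflection sends \<open>Re s = -1/2\<close> to \<open>Re s = 3/2\<close>, where the
  Dirichlet series converges absolutely. There the decay of the single Gamma factor carries over to
  \<open>dual\<close>.\<close>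

lemma dual_line_decay: "line_decay n dual (-1/2)"
proof -
  obtain M where M: "\<And>t. norm (G (Complex (3/2) t)) \<le> M" using G_line by blast
  obtain C where C: "\<And>z. 3/2 + 2 * \<mu> \<le> Re z \<Longrightarrow> Re z \<le> 3/2 + 2 * \<mu> \<Longrightarrow> norm (Gamma z) \<le> C / (1 + \<bar>Im z\<bar>) ^ n"
  proof (rule norm_Gamma_strip[of "3/2 + 2 * \<mu>" "3/2 + 2 * \<mu>" n])
    show "3/2 + 2 * \<mu> > 0" using \<mu> by simp
  qed blast
  define B where "B = sqrt pi / norm \<omega> * Q powr 2 * exp ((-1/2 - 2 * \<mu>) * ln 2)"
  have e: "Cbar (1 - Complex (-1/2) t) = cnj (G (Complex (3/2) t))" for t
  proof -
    have "cnj (1 - Complex (-1/2) t) = Complex (3/2) t" by (simp add: complex_eq_iff)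
    then show ?thesis by (simp add: Cbar_def)
  qed
  have bound: "norm (dual (Complex (-1/2) t)) \<le> B * C * M / (1 + \<bar>t\<bar>) ^ n" for t
  proof -
    have "norm (dual (Complex (-1/2) t)) = B * (norm (Gamma (1 + 2 * of_real \<mu> - Complex (-1/2) t)) * norm (G (Complex (3/2) t)))"
    proof -
      have "norm (of_real Q powr (1 - 2 * Complex (-1/2) t)) = Q powr 2"
        using Q by (subst norm_powr_real_powr) auto
      moreover have "norm (exp ((Complex (-1/2) t - 2 * of_real \<mu>) * of_real (ln 2))) = exp ((-1/2 - 2 * \<mu>) * ln 2)"
        by simp
      moreover have "norm (of_real (sqrt pi) / \<omega>) = sqrt pi / norm \<omega>"
        by (simp add: norm_divide)
      ultimately show ?thesis
        unfolding dual_def e B_def norm_mult complex_mod_cnj by (simp only: mult.assoc)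
    qed
    also have "\<dots> \<le> B * (C / (1 + \<bar>t\<bar>) ^ n * M)"
    proof (intro mult_left_mono mult_mono M)
      show "norm (Gamma (1 + 2 * of_real \<mu> - Complex (-1/2) t)) \<le> C / (1 + \<bar>t\<bar>) ^ n"
        using C[of "1 + 2 * of_real \<mu> - Complex (-1/2) t"] by simp
      then show "0 \<le> C / (1 + \<bar>t\<bar>) ^ n" by (rule order_trans[OF norm_ge_zero])
    qed (auto simp: B_def)
    finally show ?thesis by simp
  qed
  have cont: "continuous_on UNIV (\<lambda>t. dual (Complex (-1/2) t))"
  proof -
    have c1: "continuous_on UNIV (\<lambda>t. Gamma (1 + 2 * of_real \<mu> - Complex (-1/2) t))"
    proof (rule continuous_on_compose2[OF continuous_on_Gamma[of "{z. Re z > 0}"]])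
      show "continuous_on UNIV (\<lambda>t. 1 + 2 * of_real \<mu> - Complex (-1/2) t)"
        by (intro continuous_on_diff continuous_on_const continuous_on_Complex)
    qed (use \<mu> Re_pos_not_nonpos_Ints in auto)
    have c2: "continuous_on UNIV (\<lambda>t. of_real Q powr (1 - 2 * Complex (-1/2) t))"
      unfolding powr_def using Q
      by (simp, intro continuous_on_exp continuous_on_mult continuous_on_diff continuous_on_const continuous_on_Complex)
    have c3: "continuous_on UNIV (\<lambda>t. exp ((Complex (-1/2) t - 2 * of_real \<mu>) * of_real (ln 2)))"
      by (intro continuous_on_exp continuous_on_mult continuous_on_diff continuous_on_const continuous_on_Complex)
    have c4: "continuous_on UNIV (\<lambda>t. cnj (G (Complex (3/2) t)))"
      by (intro continuous_on_cnj G_continuous_line) simp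
    show ?thesis
      unfolding dual_def e by (intro continuous_on_mult continuous_on_const c1 c2 c3 c4)
  qed
  show ?thesis unfolding line_decay_def using bound cont by (intro conjI exI[of _ "B * C * M"] allI)
qed

text \<open>Near the left edge \<open>s / 2 + \<mu>\<close> may have negative real part, outside the
  range of the Gamma estimates. It is raised by 1 at the cost of a division by a number of modulus
  at least \<open>T0 / 2\<close>. The decay order \<open>N + 2\<close> beats the growth of
  \<open>G\<close> and leaves a quadratic rate.\<close>

lemma KG_strip_bound:
  obtains C where "\<And>s. -1/2 \<le> Re s \<Longrightarrow> Re s \<le> 3/2 \<Longrightarrow> T0 \<le> \<bar>Im s\<bar> \<Longrightarrow> norm (gamma_kernel \<mu> s * G s) \<le> C / (1 + \<bar>Im s\<bar>)\<^sup>2"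
proof -
  obtain C where C: "\<And>w w' t. 3/4 + \<mu> \<le> Re w \<Longrightarrow> Re w \<le> 7/4 + \<mu> \<Longrightarrow>
      1/4 + \<mu> \<le> Re w' \<Longrightarrow> Re w' \<le> 5/4 + \<mu> \<Longrightarrow> \<bar>t\<bar> = 2 * \<bar>Im w\<bar> \<Longrightarrow> \<bar>t\<bar> = 2 * \<bar>Im w'\<bar>
       \<Longrightarrow> norm (Gamma w * Gamma w') \<le> C / (1 + \<bar>t\<bar>) ^ (N + 2)"
  proof (rule Gamma_product_strip[of "3/4 + \<mu>" "1/4 + \<mu>" "7/4 + \<mu>" "5/4 + \<mu>" "N + 2"])
    show "3/4 + \<mu> > 0" "1/4 + \<mu> > 0" using \<mu> by auto
  qed blast
  have "norm (gamma_kernel \<mu> s * G s) \<le> C * CG * 2 / T0 / (1 + \<bar>Im s\<bar>)\<^sup>2"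
    if s: "-1/2 \<le> Re s" "Re s \<le> 3/2" "T0 \<le> \<bar>Im s\<bar>" for s
  proof -
    have Im: "Im s \<noteq> 0" using s T0 by auto
    define w where "w = s / 2 + of_real \<mu>"
    have "Im w \<noteq> 0" using Im by (simp add: w_def)
    moreover have "T0 / 2 \<le> norm w" using s(3) abs_Im_le_cmod[of w] by (simp add: w_def)
    ultimately have w: "w \<notin> \<int>\<^sub>\<le>\<^sub>0" "T0 / 2 \<le> norm w" "w \<noteq> 0"
      using Im_nonzero_not_nonpos_Ints[of w] by auto
    have x: "1 + \<bar>Im s\<bar> > 0" by linarith
    have J: "norm (Gamma (w + 1) * Gamma (1 + of_real \<mu> - s / 2)) \<le> C / (1 + \<bar>Im s\<bar>) ^ (N + 2)"
      using s by (intro C) (auto simp: w_def)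
    have "gamma_kernel \<mu> s = Gamma (w + 1) * Gamma (1 + of_real \<mu> - s / 2) / w"
      unfolding gamma_kernel_def w_def[symmetric] Gamma_plus1[OF w(1)] using w(3) by simp
    then have "norm (gamma_kernel \<mu> s) = norm (Gamma (w + 1) * Gamma (1 + of_real \<mu> - s / 2)) / norm w"
      by (simp add: norm_divide)
    also have "\<dots> \<le> (C / (1 + \<bar>Im s\<bar>) ^ (N + 2)) / (T0 / 2)"
      using J w(2) T0 by (intro frac_le) (auto intro: order_trans[OF norm_ge_zero])
    finally have "norm (gamma_kernel \<mu> s) * norm (G s) \<le> (C / (1 + \<bar>Im s\<bar>) ^ (N + 2)) / (T0 / 2) * (CG * (1 + \<bar>Im s\<bar>) ^ N)"
      by (intro mult_mono growth s) (auto intro: order_trans[OF norm_ge_zero])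
    also have "\<dots> = C * CG * 2 / T0 / (1 + \<bar>Im s\<bar>)\<^sup>2"
    proof -
      define y where "y = 1 + \<bar>Im s\<bar>"
      have "y \<noteq> 0" using x by (simp add: y_def)
      then show ?thesis unfolding y_def[symmetric] by (simp add: power_add power2_eq_square field_simps)
    qed
    finally show ?thesis by (simp add: norm_mult)
  qed
  then show thesis by (rule that)
qed

text \<open>The series \<open>S\<close> of the overview; the next definition is \<open>E\<close>.
  Indexing by \<open>Suc n\<close> starts both at the first coefficient.\<close>

definition lattice_sum :: "complex \<Rightarrow> complex" where
  "lattice_sum y = (\<Sum>n. A (Suc n) * of_real (real (Suc n) powr (2 * \<mu>)) *
     ((of_nat (Suc n))\<^sup>2 + y\<^sup>2) powr of_real (- 2 * \<mu> - 1))"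

definition exp_sum :: "complex \<Rightarrow> complex" where
  "exp_sum y = (\<Sum>n. cnj (A (Suc n)) * of_real (real (Suc n) powr (2 * \<mu>)) *
     exp (- of_real (2 / Q\<^sup>2 * real (Suc n)) * y))"

text \<open>Termwise \<open>v\<close> becomes \<open>v - ln n\<close> in
  \<open>gamma_kernel_transform\<close>; the powers of \<open>n\<close> then combine to
  \<open>n powr (2 * \<mu>)\<close>, and \<open>1 + exp (2 * v)\<close> turns into the square sum
  \<open>n^2 + y^2\<close> with \<open>y = exp v\<close>.\<close>

lemma mellin_line_KG:
  obtains c where "c \<noteq> 0"
    "\<And>v. mellin_line (\<lambda>s. gamma_kernel \<mu> s * G s) (3/2) v =
      c * of_real (exp v powr (2 * \<mu> + 2)) * lattice_sum (of_real (exp v))"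
proof -
  obtain c where c: "c \<noteq> 0" "\<And>v. mellin_line (gamma_kernel \<mu>) (3/2) v =
      c * of_real (exp ((2 * \<mu> + 2) * v) * (1 + exp (2 * v)) powr (- 2 * \<mu> - 1))"
    by (rule gamma_kernel_transform[OF \<mu>]) blast
  have "mellin_line (\<lambda>s. gamma_kernel \<mu> s * G s) (3/2) v =
      c * of_real (exp v powr (2 * \<mu> + 2)) * lattice_sum (of_real (exp v))" for v
  proof -
    have ld: "line_decay 2 (gamma_kernel \<mu>) (3/2)" using \<mu> by (intro gamma_kernel_line_decay) auto
    have "(\<lambda>n. A (Suc n) * mellin_line (gamma_kernel \<mu>) (3/2) (v - ln (real (Suc n)))) sums
        mellin_line (\<lambda>s. gamma_kernel \<mu> s * G s) (3/2) v"
      by (rule mellin_line_series[OF ld coeff_summable]) (rule dirichlet, simp)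
    moreover have "A (Suc n) * mellin_line (gamma_kernel \<mu>) (3/2) (v - ln (real (Suc n))) =
       (c * of_real (exp v powr (2 * \<mu> + 2))) * (A (Suc n) * of_real (real (Suc n) powr (2 * \<mu>)) *
         ((of_nat (Suc n))\<^sup>2 + (of_real (exp v))\<^sup>2) powr of_real (- 2 * \<mu> - 1))" for n
    proof -
      define x where "x = real (Suc n)"
      have x: "x > 0" by (simp add: x_def)
      have e2: "exp (2 * (v - ln x)) = (exp v)\<^sup>2 / x\<^sup>2"
        using x by (simp add: exp_diff right_diff_distrib exp_double power_divide)
      have e3: "1 + exp (2 * (v - ln x)) = (x\<^sup>2 + (exp v)\<^sup>2) / x\<^sup>2"
        unfolding e2 using x by (simp add: field_simps)
      have p: "(x\<^sup>2 + (exp v)\<^sup>2) > 0" using x by (intro add_pos_pos) auto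
      have e4: "(1 + exp (2 * (v - ln x))) powr (- 2 * \<mu> - 1) = (x\<^sup>2 + (exp v)\<^sup>2) powr (- 2 * \<mu> - 1) * x powr (4 * \<mu> + 2)"
      proof -
        have "(1 + exp (2 * (v - ln x))) powr (- 2 * \<mu> - 1) = (x\<^sup>2 + (exp v)\<^sup>2) powr (- 2 * \<mu> - 1) / (x\<^sup>2) powr (- 2 * \<mu> - 1)"
          unfolding e3 using p x by (intro powr_divide)
        also have "(x\<^sup>2) powr (- 2 * \<mu> - 1) = x powr (- (4 * \<mu> + 2))"
          using x by (simp add: powr_powr powr_numeral[symmetric] del: powr_numeral)
        finally show ?thesis by (simp only: powr_minus_divide divide_divide_eq_right div_by_1)
      qed
      have e5: "exp ((2 * \<mu> + 2) * (v - ln x)) = exp v powr (2 * \<mu> + 2) * x powr (- (2 * \<mu> + 2))"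
        using x unfolding powr_minus_divide by (simp add: powr_def exp_diff right_diff_distrib)
      have e6: "x powr (- (2 * \<mu> + 2)) * x powr (4 * \<mu> + 2) = x powr (2 * \<mu>)"
        by (simp flip: powr_add)
      have "exp ((2 * \<mu> + 2) * (v - ln x)) * (1 + exp (2 * (v - ln x))) powr (- 2 * \<mu> - 1) =
          exp v powr (2 * \<mu> + 2) * ((x powr (- (2 * \<mu> + 2)) * x powr (4 * \<mu> + 2)) * (x\<^sup>2 + (exp v)\<^sup>2) powr (- 2 * \<mu> - 1))"
        unfolding e4 e5 by (simp only: mult_ac)
      also have "\<dots> = exp v powr (2 * \<mu> + 2) * (x powr (2 * \<mu>) * (x\<^sup>2 + (exp v)\<^sup>2) powr (- 2 * \<mu> - 1))"
        unfolding e6 ..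
      finally have e7: "exp ((2 * \<mu> + 2) * (v - ln x)) * (1 + exp (2 * (v - ln x))) powr (- 2 * \<mu> - 1) = \<dots>" .
      have e8: "((of_nat (Suc n))\<^sup>2 + (of_real (exp v))\<^sup>2) powr of_real (- 2 * \<mu> - 1) =
          complex_of_real ((x\<^sup>2 + (exp v)\<^sup>2) powr (- 2 * \<mu> - 1))"
      proof -
        have "(of_nat (Suc n))\<^sup>2 + (of_real (exp v))\<^sup>2 = complex_of_real (x\<^sup>2 + (exp v)\<^sup>2)"
          by (simp add: x_def)
        then show ?thesis using p by (simp only: powr_of_real less_imp_le)
      qed
      show ?thesis
        unfolding c(2) x_def[symmetric] e7 e8 by (simp only: of_real_mult mult_ac)
    qed
    ultimately have "(\<lambda>n. (c * of_real (exp v powr (2 * \<mu> + 2))) * (A (Suc n) * of_real (real (Suc n) powr (2 * \<mu>)) *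
         ((of_nat (Suc n))\<^sup>2 + (of_real (exp v))\<^sup>2) powr of_real (- 2 * \<mu> - 1))) sums
        mellin_line (\<lambda>s. gamma_kernel \<mu> s * G s) (3/2) v"
      by (simp only:)
    note sm = this
    have nz: "c * of_real (exp v powr (2 * \<mu> + 2)) \<noteq> 0" using c(1) by simp
    from sm have "summable (\<lambda>n. A (Suc n) * of_real (real (Suc n) powr (2 * \<mu>)) *
         ((of_nat (Suc n))\<^sup>2 + (of_real (exp v))\<^sup>2) powr of_real (- 2 * \<mu> - 1))"
      using summable_cmult_iff nz sums_summable by blast
    from suminf_mult[OF this, of "c * of_real (exp v powr (2 * \<mu> + 2))"] sums_unique[OF sm]
    show ?thesis unfolding lattice_sum_def by (simp only:)
  qed
  then show thesis using c(1) that by blast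
qed

lemma mellin_line_dual:
  obtains c where
    "\<And>v. mellin_line dual (-1/2) v = c * of_real (exp v powr (2 * \<mu> + 1)) * exp_sum (of_real (exp v))"
proof -
  \<comment> \<open>The real part of \<open>1 + 2 * \<mu> - s\<close> on \<open>Re s = -1/2\<close>.
    Taking this as the new variable turns the integral into the transform of Gamma itself, traversed
    in the opposite direction.\<close>
  define c0 where "c0 = 3/2 + 2 * \<mu>"
  have c0: "c0 > 0" using \<mu> by (simp add: c0_def)
  obtain c where c: "\<And>v. mellin_line Gamma c0 v = c * of_real (exp (- exp (- v)))"
    by (rule Gamma_transform[OF c0]) blast
  define B where "B = of_real (sqrt pi) / \<omega> * of_real (2 * Q powr (- 1 - 4 * \<mu>))"
  \<comment> \<open>Collects the exponents of \<open>y\<close>, 2 and \<open>Q\<close> in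
    \<open>dual\<close>, with the sign changed by the reflection;
    \<open>exp (- (w v - ln n))\<close> is \<open>2 / Q\<^sup>2 * n * exp v\<close>, the origin of
    the frequency \<open>2 / Q\<^sup>2\<close>.\<close>
  define w where "w v = - (v + ln 2 - 2 * ln Q)" for v :: real
  define a where "a n = cnj (A n) * of_real (real n powr (2 * \<mu>))" for n
  have "mellin_line dual (-1/2) v = (B * c) * of_real (exp v powr (2 * \<mu> + 1)) * exp_sum (of_real (exp v))" for v
  proof -
    have dual_eq: "dual (Complex (-1/2) t) * exp (of_real v * Complex (-1/2) t) =
       B * of_real (exp v powr (2 * \<mu> + 1)) * (Gamma (Complex c0 (- t)) * Cbar (Complex c0 (- t) - of_real (2 * \<mu>)) *
         exp (of_real (w v) * Complex c0 (- t)))" for t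
    proof -
      define u where "u = Complex c0 (- t)"
      have s: "Complex (-1/2) t = 1 + 2 * of_real \<mu> - u"
        by (simp add: u_def c0_def complex_eq_iff)
      have Q': "of_real Q powr z = exp (z * of_real (ln Q))" for z :: complex
        using Q by (simp add: powr_def Ln_of_real)
      have B': "B = of_real (sqrt pi) / \<omega> * exp (of_real (ln 2 + (- 1 - 4 * \<mu>) * ln Q))"
      proof -
        have "2 * Q powr (- 1 - 4 * \<mu>) = exp (ln 2 + (- 1 - 4 * \<mu>) * ln Q)"
          using Q by (simp add: powr_def exp_add)
        then show ?thesis unfolding B_def by (simp only: exp_of_real)
      qed
      have v': "complex_of_real (exp v powr (2 * \<mu> + 1)) = exp (of_real ((2 * \<mu> + 1) * v))"
      proof -
        have "exp v powr (2 * \<mu> + 1) = exp ((2 * \<mu> + 1) * v)" by (simp add: powr_def)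
        then show ?thesis by (simp only: exp_of_real)
      qed
      have args: "1 + 2 * of_real \<mu> - (1 + 2 * of_real \<mu> - u) = u" "1 - (1 + 2 * of_real \<mu> - u) = u - of_real (2 * \<mu>)"
        by simp_all
      have ex: "exp ((1 - 2 * (1 + 2 * of_real \<mu> - u)) * of_real (ln Q)) *
          (exp ((1 + 2 * of_real \<mu> - u - 2 * of_real \<mu>) * of_real (ln 2)) * exp (of_real v * (1 + 2 * of_real \<mu> - u))) =
         exp (of_real (ln 2 + (- 1 - 4 * \<mu>) * ln Q)) * (exp (of_real ((2 * \<mu> + 1) * v)) * exp (of_real (w v) * u))"
        unfolding exp_add[symmetric] by (rule arg_cong[where f = exp]) (simp add: w_def algebra_simps)
      have "dual (Complex (-1/2) t) * exp (of_real v * Complex (-1/2) t) =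
         of_real (sqrt pi) / \<omega> * (exp ((1 - 2 * (1 + 2 * of_real \<mu> - u)) * of_real (ln Q)) *
          (exp ((1 + 2 * of_real \<mu> - u - 2 * of_real \<mu>) * of_real (ln 2)) * exp (of_real v * (1 + 2 * of_real \<mu> - u)))) *
          (Gamma u * Cbar (u - of_real (2 * \<mu>)))"
        unfolding s dual_def args Q' by (simp only: mult_ac)
      also have "\<dots> = B * of_real (exp v powr (2 * \<mu> + 1)) * (Gamma u * Cbar (u - of_real (2 * \<mu>)) * exp (of_real (w v) * u))"
        unfolding ex B' v' by (simp only: mult_ac)
      finally show ?thesis by (simp only: u_def)
    qed
    have "mellin_line dual (-1/2) v = B * of_real (exp v powr (2 * \<mu> + 1)) *
        (LINT t|lborel. Gamma (Complex c0 (- t)) * Cbar (Complex c0 (- t) - of_real (2 * \<mu>)) * exp (of_real (w v) * Complex c0 (- t)))"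
      unfolding mellin_line_def dual_eq by simp
    also have "(LINT t|lborel. Gamma (Complex c0 (- t)) * Cbar (Complex c0 (- t) - of_real (2 * \<mu>)) * exp (of_real (w v) * Complex c0 (- t))) =
        mellin_line (\<lambda>u. Gamma u * Cbar (u - of_real (2 * \<mu>))) c0 (w v)"
      unfolding mellin_line_def
      using lborel_integral_real_affine[of "-1" "\<lambda>t. Gamma (Complex c0 t) * Cbar (Complex c0 t - of_real (2 * \<mu>)) * exp (of_real (w v) * Complex c0 t)" 0]
      by simp
    finally have I: "mellin_line dual (-1/2) v = B * of_real (exp v powr (2 * \<mu> + 1)) *
        mellin_line (\<lambda>u. Gamma u * Cbar (u - of_real (2 * \<mu>))) c0 (w v)" .
    have "(\<lambda>n. a (Suc n) * mellin_line Gamma c0 (w v - ln (real (Suc n)))) sums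
        mellin_line (\<lambda>u. Gamma u * Cbar (u - of_real (2 * \<mu>))) c0 (w v)"
    proof (rule mellin_line_series[OF Gamma_line_decay[OF c0]])
      have "norm (a (Suc n)) * real (Suc n) powr (- c0) = norm (A (Suc n)) * real (Suc n) powr (- (3/2))" for n
        unfolding a_def c0_def norm_mult complex_mod_cnj norm_of_real
        by (simp add: powr_add[symmetric] mult.assoc del: of_nat_Suc)
      then show "summable (\<lambda>n. norm (a (Suc n)) * real (Suc n) powr (- c0))"
        using coeff_summable by simp
      fix t
      have "(\<lambda>n. cnj (A (Suc n)) * of_nat (Suc n) powr (- (Complex c0 t - of_real (2 * \<mu>)))) sums Cbar (Complex c0 t - of_real (2 * \<mu>))"
        by (rule Cbar_sums) (simp add: c0_def)
      moreover have "cnj (A (Suc n)) * of_nat (Suc n) powr (- (Complex c0 t - of_real (2 * \<mu>))) =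
          a (Suc n) * of_nat (Suc n) powr (- Complex c0 t)" for n
      proof -
        have "of_nat (Suc n) powr (- (Complex c0 t - of_real (2 * \<mu>))) =
            of_nat (Suc n) powr of_real (2 * \<mu>) * of_nat (Suc n) powr (- Complex c0 t)"
          by (simp flip: powr_add)
        also have "of_nat (Suc n) powr of_real (2 * \<mu>) = complex_of_real (real (Suc n) powr (2 * \<mu>))"
          using powr_of_real[of "real (Suc n)" "2 * \<mu>"] by simp
        finally show ?thesis unfolding a_def by (simp only: mult.assoc)
      qed
      ultimately show "(\<lambda>n. a (Suc n) * of_nat (Suc n) powr (- Complex c0 t)) sums Cbar (Complex c0 t - of_real (2 * \<mu>))"
        by (simp only:)
    qed
    moreover have "a (Suc n) * mellin_line Gamma c0 (w v - ln (real (Suc n))) =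
        c * (cnj (A (Suc n)) * of_real (real (Suc n) powr (2 * \<mu>)) * exp (- of_real (2 / Q\<^sup>2 * real (Suc n)) * of_real (exp v)))" for n
    proof -
      have "exp (- (w v - ln (real (Suc n)))) = 2 / Q\<^sup>2 * real (Suc n) * exp v"
        using Q by (simp add: w_def exp_add exp_diff ln_mult exp_double del: of_nat_Suc) 
      then have "complex_of_real (exp (- exp (- (w v - ln (real (Suc n)))))) = exp (- of_real (2 / Q\<^sup>2 * real (Suc n)) * of_real (exp v))"
        by (simp only: exp_of_real[symmetric] of_real_minus of_real_mult mult_minus_left)
      then show ?thesis unfolding c a_def by (simp only: mult_ac)
    qed
    ultimately have sm: "(\<lambda>n. c * (cnj (A (Suc n)) * of_real (real (Suc n) powr (2 * \<mu>)) * exp (- of_real (2 / Q\<^sup>2 * real (Suc n)) * of_real (exp v)))) sums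
        mellin_line (\<lambda>u. Gamma u * Cbar (u - of_real (2 * \<mu>))) c0 (w v)"
      by (simp only:)
    have "mellin_line (\<lambda>u. Gamma u * Cbar (u - of_real (2 * \<mu>))) c0 (w v) = c * exp_sum (of_real (exp v))"
    \<comment> \<open>Summability of the undistorted series follows by cancelling \<open>c\<close>;
      for \<open>c = 0\<close> both sides are 0.\<close>
    proof (cases "c = 0")
      case True
      then show ?thesis using sums_unique[OF sm] by simp
    next
      case False
      then have "summable (\<lambda>n. cnj (A (Suc n)) * of_real (real (Suc n) powr (2 * \<mu>)) * exp (- of_real (2 / Q\<^sup>2 * real (Suc n)) * of_real (exp v)))"
        using sums_summable[OF sm] summable_cmult_iff by blast
      from suminf_mult[OF this, of c] sums_unique[OF sm] show ?thesis unfolding exp_sum_def by (simp only:)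
    qed
    then show ?thesis unfolding I by (simp only: mult_ac)
  qed
  then show thesis by (rule that)
qed

section \<open>Holomorphy of the two series in the right half-plane\<close>

lemma norm_powr_of_real: "norm (z powr of_real a) = norm z powr a" for z :: complex
  by (simp add: norm_powr_complex)

text \<open>The factor \<open>n powr (1/4 + 2 * \<mu>)\<close> against
  \<open>n powr (- 4 * \<mu> - 2)\<close> leaves at most \<open>n powr (- 7/4)\<close>, uniformly in
  all \<open>y\<close> that satisfy the lower bound.\<close>

lemma lattice_term_bound:
  assumes "\<delta> > 0" "\<delta> * real (Suc n)^2 \<le> norm ((of_nat (Suc n))\<^sup>2 + y\<^sup>2)"
  shows "norm (A (Suc n) * of_real (real (Suc n) powr (2 * \<mu>)) * ((of_nat (Suc n))\<^sup>2 + y\<^sup>2) powr of_real (- 2 * \<mu> - 1))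
    \<le> KA * \<delta> powr (- 2 * \<mu> - 1) * real (Suc n) powr (- (7/4))"
proof -
  define x where "x = real (Suc n)"
  have x: "x \<ge> 1" by (simp add: x_def)
  have "norm (((of_nat (Suc n))\<^sup>2 + y\<^sup>2) powr of_real (- 2 * \<mu> - 1)) \<le> (\<delta> * x\<^sup>2) powr (- 2 * \<mu> - 1)"
    unfolding norm_powr_of_real x_def using assms \<mu> by (intro powr_mono2') auto
  also have "\<dots> = \<delta> powr (- 2 * \<mu> - 1) * (x powr 2) powr (- 2 * \<mu> - 1)"
    using assms x by (simp add: powr_mult)
  also have "\<dots> = \<delta> powr (- 2 * \<mu> - 1) * x powr (- 4 * \<mu> - 2)"
    by (simp only: powr_powr) (simp add: algebra_simps)
  finally have "norm (A (Suc n) * of_real (real (Suc n) powr (2 * \<mu>)) * ((of_nat (Suc n))\<^sup>2 + y\<^sup>2) powr of_real (- 2 * \<mu> - 1))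
    \<le> (KA * x powr (1/4)) * x powr (2 * \<mu>) * (\<delta> powr (- 2 * \<mu> - 1) * x powr (- 4 * \<mu> - 2))"
    unfolding norm_mult using coeff_bound[of "Suc n"] KA by (intro mult_mono) (auto simp: x_def)
  also have "\<dots> = KA * \<delta> powr (- 2 * \<mu> - 1) * (x powr (1/4) * x powr (2 * \<mu>) * x powr (- 4 * \<mu> - 2))"
    by (simp only: mult_ac)
  also have "x powr (1/4) * x powr (2 * \<mu>) * x powr (- 4 * \<mu> - 2) = x powr (- (7/4) - 2 * \<mu>)"
    by (simp only: powr_add[symmetric], rule arg_cong[where f = "(powr) x"]) simp
  also have "KA * \<delta> powr (- 2 * \<mu> - 1) * x powr (- (7/4) - 2 * \<mu>) \<le> KA * \<delta> powr (- 2 * \<mu> - 1) * x powr (- (7/4))"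
    using KA \<mu> x by (intro mult_left_mono powr_mono) auto
  finally show ?thesis by (simp only: x_def)
qed

lemma lattice_bound_summable: "summable (\<lambda>n. K * real (Suc n) powr (- (7/4)))"
proof -
  have "summable (\<lambda>n. real n powr (- (7/4)))" by (simp add: summable_real_powr_iff)
  then show ?thesis by (subst (asm) summable_Suc_iff[symmetric]) (rule summable_mult)
qed

text \<open>Keeps the principal branch of each summand of \<open>lattice_sum\<close> holomorphic on
  the right half-plane.\<close>

lemma sq_add_sq_not_nonpos:
  assumes "Re y > 0" "x > 0"
  shows "(of_real x)\<^sup>2 + y\<^sup>2 \<notin> \<real>\<^sub>\<le>\<^sub>0"
proof
  assume "(of_real x)\<^sup>2 + y\<^sup>2 \<in> \<real>\<^sub>\<le>\<^sub>0"
  then have *: "Re ((of_real x)\<^sup>2 + y\<^sup>2) \<le> 0" "Im ((of_real x)\<^sup>2 + y\<^sup>2) = 0"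
    by (auto simp: complex_nonpos_Reals_iff)
  from *(2) have "Re y * Im y = 0" by (auto simp: power2_eq_square)
  then have "Im y = 0" using assms by simp
  with *(1) have "x\<^sup>2 + (Re y)\<^sup>2 \<le> 0" by (simp add: power2_eq_square)
  moreover have "x\<^sup>2 > 0" "(Re y)\<^sup>2 > 0" using assms by auto
  ultimately show False by linarith
qed

lemma lattice_sum_holomorphic: "lattice_sum holomorphic_on {y. Re y > 0}"
proof -
  let ?S = "{y. Re y > 0}"
  let ?f = "\<lambda>n y. A (Suc n) * of_real (real (Suc n) powr (2 * \<mu>)) * ((of_nat (Suc n))\<^sup>2 + y\<^sup>2) powr of_real (- 2 * \<mu> - 1)"
  have op: "open ?S" by (rule open_halfspace_Re_gt)
  have fd: "?f n field_differentiable at y" if "y \<in> ?S" for n y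
  proof -
    have "?f n holomorphic_on ?S"
      using sq_add_sq_not_nonpos[of _ "real (Suc n)"]
      by (intro holomorphic_intros) (simp del: of_nat_Suc)
    then show ?thesis using op that by (rule holomorphic_on_imp_differentiable_at)
  qed
  define h where "h n = complex_of_real (KA * (1/2) powr (- 2 * \<mu> - 1) * real (Suc n) powr (- (7/4)))" for n
  have hn: "norm (h n) = KA * (1/2) powr (- 2 * \<mu> - 1) * real (Suc n) powr (- (7/4))" for n
    unfolding h_def norm_of_real using KA by simp
  have cmp: "\<exists>d h. 0 < d \<and> summable h \<and> range h \<subseteq> \<real>\<^sub>\<ge>\<^sub>0 \<and>
      (\<forall>\<^sub>F n in sequentially. \<forall>y\<in>ball y0 d \<inter> ?S. norm (?f n y) \<le> norm (h n :: complex))" if "y0 \<in> ?S" for y0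
  proof (intro exI[of _ "1::real"] exI[of _ h] conjI)
    show "summable h" unfolding h_def summable_of_real_iff by (rule lattice_bound_summable)
    show "range h \<subseteq> \<real>\<^sub>\<ge>\<^sub>0" using KA by (auto simp: h_def)
    \<comment> \<open>Near \<open>y0\<close> one has \<open>norm y \<le> M\<close>, so from
      \<open>n \<ge> 2 * M\<^sup>2\<close> on the term \<open>y\<^sup>2\<close> is at most half of
      \<open>(Suc n)\<^sup>2\<close>.\<close>
    define M where "M = norm y0 + 1"
    show "\<forall>\<^sub>F n in sequentially. \<forall>y\<in>ball y0 1 \<inter> ?S. norm (?f n y) \<le> norm (h n)"
      using eventually_ge_at_top[of "nat \<lceil>2 * M\<^sup>2\<rceil>"]
    proof eventually_elim
      case (elim n)
      then have n: "2 * M\<^sup>2 \<le> real n" by (simp add: nat_ceiling_le_eq)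
      show ?case
      proof (intro ballI)
        fix y assume y: "y \<in> ball y0 1 \<inter> ?S"
        have "norm y \<le> M" using y norm_triangle_ineq2[of y y0] by (auto simp: M_def dist_norm norm_minus_commute)
        then have "norm (y\<^sup>2) \<le> M\<^sup>2" by (simp add: norm_power power_mono)
        also have "M\<^sup>2 \<le> 1/2 * (real (Suc n))\<^sup>2"
        proof -
          note n
          also have "real n \<le> real (Suc n)" by simp
          also have "real (Suc n) \<le> (real (Suc n))\<^sup>2" by (rule self_le_power) auto
          finally show ?thesis by (simp del: of_nat_Suc)
        qed
        finally have "1/2 * (real (Suc n))\<^sup>2 \<le> norm ((of_nat (Suc n))\<^sup>2 + y\<^sup>2)"
          using norm_diff_ineq[of "(of_nat (Suc n))\<^sup>2" "y\<^sup>2"] by (simp add: norm_power del: of_nat_Suc)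
        then show "norm (?f n y) \<le> norm (h n)"
          unfolding hn by (intro lattice_term_bound) auto
      qed
    qed
  qed auto
  obtain g where g: "\<forall>y\<in>?S. (\<lambda>n. ?f n y) sums g y \<and> g field_differentiable at y"
    by (rule series_differentiable_comparison_complex[OF op fd cmp])
  then have "g holomorphic_on ?S"
    by (auto simp: holomorphic_on_def intro: field_differentiable_at_within)
  then show ?thesis
    by (rule holomorphic_transform) (use g in \<open>auto simp: lattice_sum_def sums_iff\<close>)
qed

lemma exp_term_bound:
  assumes "\<eta> \<le> Re y"
  shows "norm (cnj (A (Suc n)) * of_real (real (Suc n) powr (2 * \<mu>)) * exp (- of_real (2 / Q\<^sup>2 * real (Suc n)) * y))
     \<le> KA * (real (Suc n) powr (1/4 + 2 * \<mu>) * exp (- (2 / Q\<^sup>2 * \<eta>) * real (Suc n)))"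
proof -
  have "2 / Q\<^sup>2 * real (Suc n) * \<eta> \<le> 2 / Q\<^sup>2 * real (Suc n) * Re y"
    using assms by (intro mult_left_mono) auto
  then have "norm (exp (- of_real (2 / Q\<^sup>2 * real (Suc n)) * y)) \<le> exp (- (2 / Q\<^sup>2 * \<eta>) * real (Suc n))"
    by (simp add: mult_ac del: of_nat_Suc)
  then have "norm (cnj (A (Suc n)) * of_real (real (Suc n) powr (2 * \<mu>)) * exp (- of_real (2 / Q\<^sup>2 * real (Suc n)) * y))
     \<le> (KA * real (Suc n) powr (1/4)) * real (Suc n) powr (2 * \<mu>) * exp (- (2 / Q\<^sup>2 * \<eta>) * real (Suc n))"
    unfolding norm_mult complex_mod_cnj using coeff_bound[of "Suc n"] KA by (intro mult_mono) auto
  also have "\<dots> = KA * (real (Suc n) powr (1/4 + 2 * \<mu>) * exp (- (2 / Q\<^sup>2 * \<eta>) * real (Suc n)))"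
    by (simp only: powr_add mult_ac)
  finally show ?thesis .
qed

lemma exp_sum_holomorphic: "exp_sum holomorphic_on {y. Re y > 0}"
proof -
  let ?S = "{y. Re y > 0}"
  let ?f = "\<lambda>n y. cnj (A (Suc n)) * of_real (real (Suc n) powr (2 * \<mu>)) * exp (- of_real (2 / Q\<^sup>2 * real (Suc n)) * y)"
  have op: "open ?S" by (rule open_halfspace_Re_gt)
  have fd: "?f n field_differentiable at y" if "y \<in> ?S" for n y
  proof -
    have "?f n holomorphic_on ?S" by (intro holomorphic_intros)
    then show ?thesis using op that by (rule holomorphic_on_imp_differentiable_at)
  qed
  have cmp: "\<exists>d h. 0 < d \<and> summable h \<and> range h \<subseteq> \<real>\<^sub>\<ge>\<^sub>0 \<and>
      (\<forall>\<^sub>F n in sequentially. \<forall>y\<in>ball y0 d \<inter> ?S. norm (?f n y) \<le> norm (h n :: complex))" if y0: "y0 \<in> ?S" for y0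
  proof -
    define \<eta> where "\<eta> = Re y0 / 2"
    have \<eta>: "\<eta> > 0" using y0 by (simp add: \<eta>_def)
    define h where "h n = complex_of_real (KA * (real (Suc n) powr (1/4 + 2 * \<mu>) * exp (- (2 / Q\<^sup>2 * \<eta>) * real (Suc n))))" for n
    show ?thesis
    proof (intro exI[of _ \<eta>] exI[of _ h] conjI always_eventually allI ballI)
      show "summable h" unfolding h_def summable_of_real_iff
        using \<eta> Q by (intro summable_mult summable_powr_exp) auto
      show "range h \<subseteq> \<real>\<^sub>\<ge>\<^sub>0" using KA by (auto simp: h_def)
      fix n y assume y: "y \<in> ball y0 \<eta> \<inter> ?S"
      have "\<bar>Re (y0 - y)\<bar> < \<eta>" using y abs_Re_le_cmod[of "y0 - y"] by (auto simp: dist_norm)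
      then have "\<eta> \<le> Re y" unfolding \<eta>_def minus_complex.sel by linarith
      moreover have "norm (h n) = KA * (real (Suc n) powr (1/4 + 2 * \<mu>) * exp (- (2 / Q\<^sup>2 * \<eta>) * real (Suc n)))"
        unfolding h_def norm_of_real using KA by simp
      ultimately show "norm (?f n y) \<le> norm (h n)" by (simp only: exp_term_bound)
    qed (rule \<eta>)
  qed
  obtain g where g: "\<forall>y\<in>?S. (\<lambda>n. ?f n y) sums g y \<and> g field_differentiable at y"
    by (rule series_differentiable_comparison_complex[OF op fd cmp])
  then have "g holomorphic_on ?S"
    by (auto simp: holomorphic_on_def intro: field_differentiable_at_within)
  then show ?thesis
    by (rule holomorphic_transform) (use g in \<open>auto simp: exp_sum_def sums_iff\<close>)
qed

lemma summation_identity: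
  obtains c R where "R holomorphic_on - \<real>\<^sub>\<le>\<^sub>0"
    "\<And>y. Re y > 0 \<Longrightarrow> y * lattice_sum y = c * exp_sum y + R y"
proof -
  define KG where "KG s = gamma_kernel \<mu> s * G s" for s
  obtain c1 where c1: "c1 \<noteq> 0" "\<And>v. mellin_line KG (3/2) v = c1 * of_real (exp v powr (2 * \<mu> + 2)) * lattice_sum (of_real (exp v))"
    unfolding KG_def using mellin_line_KG by blast
  obtain c2 where c2: "\<And>v. mellin_line dual (-1/2) v = c2 * of_real (exp v powr (2 * \<mu> + 1)) * exp_sum (of_real (exp v))"
    using mellin_line_dual by blast
  obtain C where C: "\<And>s. -1/2 \<le> Re s \<Longrightarrow> Re s \<le> 3/2 \<Longrightarrow> T0 \<le> \<bar>Im s\<bar> \<Longrightarrow> norm (KG s) \<le> C / (1 + \<bar>Im s\<bar>)\<^sup>2"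
    unfolding KG_def using KG_strip_bound by blast
  have C0: "C \<ge> 0"
  proof -
    have "0 \<le> C / (1 + \<bar>Im (Complex 0 T0)\<bar>)\<^sup>2"
      by (rule order_trans[OF norm_ge_zero C]) (use T0 in auto)
    then show ?thesis using T0 by (simp add: zero_le_divide_iff)
  qed
  define I1 where "I1 y = integral {-T0..T0} (\<lambda>t. KG (Complex (3/2) t) * y powr Complex (3/2) t)" for y
  \<comment> \<open>On the left side below the height \<open>T0\<close> the integrand is
    \<open>dual\<close>: the functional equation, which equates it with \<open>KG\<close>, is
    available only above that height.\<close>
  define I2 where "I2 y = integral {-T0..T0} (\<lambda>t. dual (Complex (-1/2) t) * y powr Complex (-1/2) t)" for y
  define I3 where "I3 y = integral {-1/2..3/2} (\<lambda>x. KG (Complex x (- T0)) * y powr Complex x (- T0))" for y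
  define I4 where "I4 y = integral {-1/2..3/2} (\<lambda>x. KG (Complex x T0) * y powr Complex x T0)" for y
  define R0 where "R0 y = I1 y - I2 y + (I3 y - I4 y) / \<i>" for y
  have KG_holo: "KG holomorphic_on {s. Im s \<noteq> 0 \<and> s \<noteq> s0}"
    unfolding KG_def gamma_kernel_def
    by (intro holomorphic_intros holomorphic_on_subset[OF holo] Im_nonzero_not_nonpos_Ints) auto
  have KG_holo': "KG holomorphic_on {z. -1/2 \<le> Re z \<and> Re z \<le> 3/2 \<and> T0 \<le> \<bar>Im z\<bar>}"
    by (rule holomorphic_on_subset[OF KG_holo]) (use T0 s0 in auto)
  have cont_h: "continuous_on {-1/2..3/2} (\<lambda>x. KG (Complex x T))" if "T0 \<le> \<bar>T\<bar>" for T
    using that by (intro continuous_on_compose2[OF holomorphic_on_imp_continuous_on[OF KG_holo']] continuous_on_Complex) auto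
  have ld: "line_decay 2 KG (3/2)" "line_decay 2 dual (-1/2)"
    unfolding KG_def[abs_def] by (rule KG_line_decay, rule dual_line_decay)
  have R0_holo: "R0 holomorphic_on - \<real>\<^sub>\<le>\<^sub>0"
    unfolding R0_def I1_def I2_def I3_def I4_def
    by (intro holomorphic_intros powr_parameter_integral_holomorphic continuous_on_Complex cont_h
        continuous_on_subset[OF line_decay_continuous[OF ld(1)]] continuous_on_subset[OF line_decay_continuous[OF ld(2)]])
      (use T0 in auto)
  have R0_eq: "mellin_line KG (3/2) v - mellin_line dual (-1/2) v = R0 (of_real (exp v))" for v
  proof -
    have pw: "of_real (exp v) powr z = exp (of_real v * z)" for z :: complex
      by (simp add: powr_def Ln_of_real mult.commute del: of_real_exp)
    define K where "K = C * exp (\<bar>v\<bar> * 2)"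
    have "\<i> * ((LINT t|lborel. KG (Complex (3/2) t) * exp (of_real v * Complex (3/2) t)) - (LINT t|lborel. dual (Complex (-1/2) t) * exp (of_real v * Complex (-1/2) t))) =
      \<i> * (integral {-T0..T0} (\<lambda>t. KG (Complex (3/2) t) * exp (of_real v * Complex (3/2) t)) - integral {-T0..T0} (\<lambda>t. dual (Complex (-1/2) t) * exp (of_real v * Complex (-1/2) t))) +
      integral {-1/2..3/2} (\<lambda>x. KG (Complex x (- T0)) * exp (of_real v * Complex x (- T0))) - integral {-1/2..3/2} (\<lambda>x. KG (Complex x T0) * exp (of_real v * Complex x T0))"
    proof (rule shift_line[where f = "\<lambda>z. KG z * exp (of_real v * z)" and C = K])
      show "(\<lambda>z. KG z * exp (of_real v * z)) holomorphic_on {z. -1/2 \<le> Re z \<and> Re z \<le> 3/2 \<and> T0 \<le> \<bar>Im z\<bar>}"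
        by (intro holomorphic_intros KG_holo')
      show "norm (KG z * exp (of_real v * z)) \<le> K / (1 + \<bar>Im z\<bar>)\<^sup>2" if z: "-1/2 \<le> Re z" "Re z \<le> 3/2" "T0 \<le> \<bar>Im z\<bar>" for z
      proof -
        have "v * Re z \<le> \<bar>v * Re z\<bar>" by (rule abs_ge_self)
        also have "\<dots> = \<bar>v\<bar> * \<bar>Re z\<bar>" by (rule abs_mult)
        also have "\<dots> \<le> \<bar>v\<bar> * 2" using z by (intro mult_left_mono) auto
        finally have "norm (KG z) * norm (exp (of_real v * z)) \<le> C / (1 + \<bar>Im z\<bar>)\<^sup>2 * exp (\<bar>v\<bar> * 2)"
          using C0 by (intro mult_mono C z) auto
        then show ?thesis by (simp add: norm_mult K_def)
      qed
      show "continuous_on UNIV (\<lambda>t. dual (Complex (-1/2) t) * exp (of_real v * Complex (-1/2) t))"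
        "continuous_on UNIV (\<lambda>t. KG (Complex (3/2) t) * exp (of_real v * Complex (3/2) t))"
        by (intro continuous_on_mult continuous_on_exp continuous_on_const continuous_on_Complex line_decay_continuous[OF ld(1)] line_decay_continuous[OF ld(2)])+
      show "integrable lborel (\<lambda>t. dual (Complex (-1/2) t) * exp (of_real v * Complex (-1/2) t))"
        "integrable lborel (\<lambda>t. KG (Complex (3/2) t) * exp (of_real v * Complex (3/2) t))"
        by (intro line_decay_integrable ld)+
      show "dual (Complex (-1/2) t) * exp (of_real v * Complex (-1/2) t) = KG (Complex (-1/2) t) * exp (of_real v * Complex (-1/2) t)"
        if "T0 \<le> \<bar>t\<bar>" for t
        using gamma_kernel_G_eq_dual[of "Complex (-1/2) t"] that by (simp add: KG_def)
    qed (use T0 in auto)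
    then have "\<i> * (mellin_line KG (3/2) v - mellin_line dual (-1/2) v) =
        \<i> * (I1 (of_real (exp v)) - I2 (of_real (exp v))) + I3 (of_real (exp v)) - I4 (of_real (exp v))"
      unfolding mellin_line_def I1_def I2_def I3_def I4_def pw .
    note eq = this
    have "mellin_line KG (3/2) v - mellin_line dual (-1/2) v =
        (\<i> * (I1 (of_real (exp v)) - I2 (of_real (exp v))) + I3 (of_real (exp v)) - I4 (of_real (exp v))) / \<i>"
      unfolding eq[symmetric] by (rule nonzero_mult_div_cancel_left[symmetric]) simp
    also have "\<dots> = R0 (of_real (exp v))"
      unfolding R0_def
      by (simp only: add_diff_eq[symmetric] add_divide_distrib nonzero_mult_div_cancel_left[OF complex_i_not_zero])
    finally show ?thesis .
  qed
  \<comment> \<open>The transforms carry the powers \<open>2 * \<mu> + 2\<close> and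
    \<open>2 * \<mu> + 1\<close> of \<open>y\<close>; dividing by the latter leaves the factor
    \<open>y\<close> in front of \<open>lattice_sum\<close>.\<close>
  define R where "R y = R0 y * y powr of_real (- (2 * \<mu> + 1)) / c1" for y
  have R_holo: "R holomorphic_on - \<real>\<^sub>\<le>\<^sub>0"
    unfolding R_def using c1(1) by (intro holomorphic_intros R0_holo) auto
  have real_case: "of_real x * lattice_sum (of_real x) = c2 / c1 * exp_sum (of_real x) + R (of_real x)" if x: "x > 0" for x :: real
  proof -
    define v where "v = ln x"
    have ev: "exp v = x" using x by (simp add: v_def)
    define P where "P = complex_of_real (x powr (2 * \<mu> + 1))"
    have P: "P \<noteq> 0" using x by (simp add: P_def)
    have "x powr (2 * \<mu> + 2) = x powr (2 * \<mu> + 1) * x"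
      using x powr_add[of x "2 * \<mu> + 1" 1] by (simp add: algebra_simps)
    then have P2: "complex_of_real (x powr (2 * \<mu> + 2)) = P * of_real x" unfolding P_def by (simp only: of_real_mult)
    have P3: "of_real x powr of_real (- (2 * \<mu> + 1)) = 1 / P"
    proof -
      have "complex_of_real x powr of_real (- (2 * \<mu> + 1)) = of_real (x powr (- (2 * \<mu> + 1)))"
        using x by (intro powr_of_real) simp
      then show ?thesis unfolding P_def by (simp only: powr_minus_divide of_real_divide of_real_1)
    qed
    have "c1 * (P * of_real x) * lattice_sum (of_real x) - c2 * P * exp_sum (of_real x) = R0 (of_real x)"
      using R0_eq[of v] unfolding c1(2) c2 ev P2 P_def[symmetric] .
    then have "R (of_real x) = (c1 * (P * of_real x) * lattice_sum (of_real x) - c2 * P * exp_sum (of_real x)) / P / c1"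
      unfolding R_def P3 by simp
    also have "\<dots> = of_real x * lattice_sum (of_real x) - c2 / c1 * exp_sum (of_real x)"
      using P c1(1) by (simp add: diff_divide_distrib)
    finally show ?thesis by simp
  qed
  have "y * lattice_sum y = c2 / c1 * exp_sum y + R y" if y: "Re y > 0" for y
  proof -
    let ?S = "{y. Re y > 0}"
    have "y * lattice_sum y - (c2 / c1 * exp_sum y + R y) = 0"
    proof (rule analytic_continuation[of "\<lambda>y. y * lattice_sum y - (c2 / c1 * exp_sum y + R y)" ?S "of_real ` {0<..}" 1])
      show "(\<lambda>y. y * lattice_sum y - (c2 / c1 * exp_sum y + R y)) holomorphic_on ?S"
        by (intro holomorphic_intros lattice_sum_holomorphic exp_sum_holomorphic holomorphic_on_subset[OF R_holo])
          (auto simp: complex_nonpos_Reals_iff)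
      show "open ?S" by (rule open_halfspace_Re_gt)
      show "connected ?S" by (intro convex_connected convex_halfspace_Re_gt)
      show "(1::complex) islimpt of_real ` {0<..}"
        unfolding islimpt_approachable
      proof (intro allI impI)
        fix e :: real assume "e > 0"
        then show "\<exists>x'\<in>of_real ` {0<..}. x' \<noteq> (1::complex) \<and> dist x' 1 < e"
          by (intro bexI[of _ "of_real (1 + e / 2)"]) (auto simp: dist_norm complex_eq_iff)
      qed
    qed (use y real_case in auto)
    then show ?thesis by simp
  qed
  then show thesis using R_holo that by blast
qed

end

section \<open>Behaviour at the imaginary axis\<close>

lemma powr_exp_half_bounded:
  assumes "p \<ge> (0::real)"
  obtains C where "C > 0" "\<And>x. x > 0 \<Longrightarrow> x powr p * exp (- x) \<le> C * exp (- x / 2)"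
proof -
  define N where "N = Suc (nat \<lceil>p\<rceil>)"
  have N: "p \<le> real N" "N > 0" using real_nat_ceiling_ge[of p] by (auto simp: N_def)
  define C where "C = 1 + (2 * real N) ^ N"
  have C: "C \<ge> 1" "(2 * real N) ^ N \<le> C" by (simp_all add: C_def)
  have "x powr p * exp (- x) \<le> C * exp (- x / 2)" if x: "x > 0" for x
  proof -
    have "x powr p \<le> C * exp (x / 2)"
    proof (cases "x \<le> 1")
      case True
      have "x powr p \<le> 1 powr p" using True x assms by (intro powr_mono2) auto
      moreover have "1 * 1 \<le> C * exp (x / 2)"
        using x C by (intro mult_mono) auto
      ultimately show ?thesis by simp
    next
      case False
      define y where "y = x / (2 * real N)"
      have y: "y \<ge> 0" "x = 2 * real N * y" "real N * y = x / 2" using x N by (auto simp: y_def)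
      have "x powr p \<le> x powr real N" using False N by (intro powr_mono) auto
      also have "\<dots> = x ^ N" using x by (rule powr_realpow)
      also have "\<dots> = (2 * real N) ^ N * y ^ N" unfolding y(2) by (rule power_mult_distrib)
      also have "\<dots> \<le> (2 * real N) ^ N * exp y ^ N"
      proof (intro mult_left_mono power_mono)
        show "y \<le> exp y" using exp_ge_add_one_self[of y] by linarith
      qed (use y in auto)
      also have "exp y ^ N = exp (x / 2)" unfolding y(3)[symmetric] by (rule exp_of_nat_mult[symmetric])
      also have "(2 * real N) ^ N * exp (x / 2) \<le> C * exp (x / 2)" using C by (intro mult_right_mono) auto
      finally show ?thesis .
    qed
    then have "x powr p * exp (- x) \<le> C * exp (x / 2) * exp (- x)" by (intro mult_right_mono) auto
    also have "\<dots> = C * (exp (x / 2) * exp (- x))" by (rule mult.assoc)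
    also have "exp (x / 2) * exp (- x) = exp (- x / 2)" unfolding exp_add[symmetric] by (rule arg_cong[where f = exp]) simp
    finally show ?thesis .
  qed
  moreover have "C > 0" using C by linarith
  ultimately show thesis using that by blast
qed

text \<open>The size of the terms of \<open>exp_sum\<close> at \<open>y = \<epsilon> + i v\<close>,
  apart from the coefficient, when \<open>p = 2 * \<mu>\<close> and
  \<open>d = 2 / Q\<^sup>2 * \<epsilon>\<close>.\<close>

definition weight :: "real \<Rightarrow> real \<Rightarrow> nat \<Rightarrow> real" where
  "weight p d n = real (Suc n) powr p * exp (- d * real (Suc n))"

lemma weight_pos: "weight p d n > 0"
  by (simp add: weight_def)

lemma weight_summable: "d > 0 \<Longrightarrow> summable (weight p d)"
  unfolding weight_def[abs_def] by (rule summable_powr_exp)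

text \<open>The sum resembles \<open>Gamma (p + 1) * d powr (- p - 1)\<close>. Its order of
  magnitude is obtained by giving up half of the exponential to absorb the power; what remains is a
  geometric series of ratio \<open>exp (- d / 2)\<close>.\<close>

lemma weight_sum_bounded:
  assumes "p \<ge> 0"
  obtains C where "\<And>d. d > 0 \<Longrightarrow> d powr (p + 1) * (\<Sum>n. weight p d n) \<le> C"
proof -
  obtain C where C: "C > 0" "\<And>x. x > 0 \<Longrightarrow> x powr p * exp (- x) \<le> C * exp (- x / 2)"
    using powr_exp_half_bounded[OF assms] by blast
  have "d powr (p + 1) * (\<Sum>n. weight p d n) \<le> 2 * C" if d: "d > 0" for d
  proof -
    define z where "z = exp (- d / 2)"
    have z: "0 < z" "z < 1" using d by (auto simp: z_def)
    have term_le: "d powr p * weight p d n \<le> C * z * z ^ n" for n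
    proof -
      have "d powr p * weight p d n = (d * real (Suc n)) powr p * exp (- (d * real (Suc n)))"
        using d by (simp add: weight_def powr_mult mult.assoc del: of_nat_Suc)
      also have "\<dots> \<le> C * exp (- (d * real (Suc n)) / 2)"
        using d by (intro C(2)) auto
      also have "- (d * real (Suc n)) / 2 = real (Suc n) * (- d / 2)" by (simp add: field_simps)
      also have "exp (real (Suc n) * (- d / 2)) = z ^ Suc n" unfolding z_def by (rule exp_of_nat_mult)
      finally show ?thesis by simp
    qed
    have sg: "summable (\<lambda>n. C * z * z ^ n)" using z by (intro summable_mult summable_geometric) auto
    have "d powr p * (\<Sum>n. weight p d n) = (\<Sum>n. d powr p * weight p d n)"
      by (rule suminf_mult[OF weight_summable[OF d], symmetric])
    also have "\<dots> \<le> (\<Sum>n. C * z * z ^ n)"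
      by (intro suminf_le term_le sg summable_mult weight_summable d)
    also have "\<dots> = C * z * (1 / (1 - z))"
      using z by (simp add: suminf_mult summable_geometric suminf_geometric)
    finally have le: "d powr p * (\<Sum>n. weight p d n) \<le> C * z / (1 - z)" by simp
    have "1 + d / 2 \<le> exp (d / 2)" by (rule exp_ge_add_one_self)
    then have "z * (1 + d / 2) \<le> z * exp (d / 2)" using z by (intro mult_left_mono) auto
    also have "z * exp (d / 2) = 1" by (simp add: z_def flip: exp_add)
    finally have "z * (d / 2) \<le> 1 - z" by (simp add: algebra_simps)
    then have "d * z \<le> 2 * (1 - z)" by (simp add: mult.commute)
    then have dz: "d * z / (1 - z) \<le> 2" using z by (simp add: divide_le_eq)
    have "d powr (p + 1) * (\<Sum>n. weight p d n) = d * (d powr p * (\<Sum>n. weight p d n))"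
      using d by (simp add: powr_add)
    also have "\<dots> \<le> d * (C * z / (1 - z))" using le d by (intro mult_left_mono) auto
    also have "\<dots> = C * (d * z / (1 - z))" by simp
    also have "\<dots> \<le> C * 2" using dz C by (intro mult_left_mono) auto
    finally show ?thesis by simp
  qed
  then show thesis by (rule that)
qed

text \<open>Summation by parts; the weights have total variation at most \<open>2 d\<close> times their sum.\<close>

lemma weighted_sum_bound:
  fixes e :: "nat \<Rightarrow> complex"
  assumes p: "p \<ge> 0" and d: "d > 0" and B: "\<And>n. norm (\<Sum>k<n. e k) \<le> B" and e: "\<And>n. norm (e n) \<le> B'"
  shows "norm (\<Sum>n. e n * of_real (weight p d n)) \<le> 2 * B * d * (\<Sum>n. weight p d n)"
    and "summable (\<lambda>n. e n * of_real (weight p d n))"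
proof -
  define h where "h = weight p d"
  define S where "S n = (\<Sum>k<n. e k)" for n
  \<comment> \<open>The increment of the weight is \<open>u - w\<close>: \<open>u\<close> stems from
    the growing power, \<open>w\<close> from the decaying exponential, and both are nonnegative.
    Telescoping shows that the sum of \<open>u\<close> is at most that of \<open>w\<close>, so twice
    the latter bounds the total variation.\<close>
  define u where "u n = (real (Suc (Suc n)) powr p - real (Suc n) powr p) * exp (- d * real (Suc (Suc n)))" for n
  define w where "w n = (1 - exp (- d)) * h n" for n
  have B0: "B \<ge> 0" using B[of 0] by simp
  have h: "summable h" "\<And>n. h n > 0" using weight_summable[OF d] weight_pos by (auto simp: h_def)
  show summ: "summable (\<lambda>n. e n * of_real (weight p d n))"
  proof (rule summable_comparison_test'[OF summable_mult[OF h(1), of B'], of 0])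
    show "norm (e n * of_real (weight p d n)) \<le> B' * h n" for n
      using e[of n] h(2)[of n] by (simp add: norm_mult h_def mult_right_mono)
  qed
  have diff: "h (Suc n) - h n = u n - w n" for n
  proof -
    have "exp (- d * real (Suc (Suc n))) = exp (- d) * exp (- d * real (Suc n))"
      by (simp add: algebra_simps flip: exp_add)
    then show ?thesis by (simp add: h_def weight_def u_def w_def algebra_simps)
  qed
  have u0: "u n \<ge> 0" for n unfolding u_def using p by (intro mult_nonneg_nonneg) (auto intro!: powr_mono2)
  have w0: "w n \<ge> 0" for n unfolding w_def using d h(2)[of n] by (intro mult_nonneg_nonneg) auto
  have w_sums: "w sums ((1 - exp (- d)) * suminf h)"
    unfolding w_def by (intro sums_mult summable_sums h)
  have h_lim: "h \<longlonglongrightarrow> 0" by (rule summable_LIMSEQ_zero[OF h(1)])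
  have "(\<lambda>n. h (Suc n) - h n) sums (0 - h 0)" by (rule telescope_sums[OF h_lim])
  from sums_add[OF this w_sums] have u_sums: "u sums (0 - h 0 + (1 - exp (- d)) * suminf h)"
    by (simp add: diff)
  have "(\<Sum>n<M. e n * of_real (h n)) = S M * of_real (h M) + (\<Sum>n<M. S (Suc n) * of_real (h n - h (Suc n)))" for M
    by (induction M) (auto simp: S_def algebra_simps)
  note parts = this
  have bound: "norm (\<Sum>n<M. e n * of_real (h n)) \<le> B * h M + B * (2 * (1 - exp (- d)) * suminf h)" for M
  proof -
    have "norm (S M * of_real (h M)) \<le> B * h M"
      using B[of M] h(2)[of M] by (simp add: S_def norm_mult mult_right_mono)
    moreover have "norm (\<Sum>n<M. S (Suc n) * of_real (h n - h (Suc n))) \<le> B * (2 * (1 - exp (- d)) * suminf h)"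
    proof -
      have "norm (\<Sum>n<M. S (Suc n) * of_real (h n - h (Suc n))) \<le> (\<Sum>n<M. B * (u n + w n))"
      proof (rule sum_norm_le)
        fix n
        have "\<bar>h n - h (Suc n)\<bar> \<le> u n + w n" using diff[of n] u0[of n] w0[of n] by linarith
        then show "norm (S (Suc n) * of_real (h n - h (Suc n))) \<le> B * (u n + w n)"
          using B[of "Suc n"] B0 unfolding norm_mult norm_of_real S_def by (intro mult_mono) auto
      qed
      also have "\<dots> = B * (\<Sum>n<M. u n + w n)" by (simp add: sum_distrib_left)
      also have "(\<Sum>n<M. u n + w n) \<le> (\<Sum>n. u n + w n)"
        by (intro sum_le_suminf summable_add sums_summable[OF u_sums] sums_summable[OF w_sums]) (auto intro: add_nonneg_nonneg u0 w0)
      also have "(\<Sum>n. u n + w n) = (0 - h 0 + (1 - exp (- d)) * suminf h) + (1 - exp (- d)) * suminf h"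
        using sums_unique[OF sums_add[OF u_sums w_sums]] by simp
      also have "\<dots> \<le> 2 * (1 - exp (- d)) * suminf h" using h(2)[of 0] by (simp add: algebra_simps)
      finally show ?thesis using B0 by (simp add: mult_left_mono)
    qed
    ultimately show ?thesis unfolding parts by (intro norm_triangle_le) auto
  qed
  have "(\<lambda>M. norm (\<Sum>n<M. e n * of_real (h n))) \<longlonglongrightarrow> norm (\<Sum>n. e n * of_real (h n))"
    using summable_LIMSEQ[OF summ] by (intro tendsto_norm) (simp add: h_def)
  moreover have "(\<lambda>M. B * h M + B * (2 * (1 - exp (- d)) * suminf h)) \<longlonglongrightarrow> B * 0 + B * (2 * (1 - exp (- d)) * suminf h)"
    by (intro tendsto_intros h_lim)
  ultimately have "norm (\<Sum>n. e n * of_real (h n)) \<le> B * 0 + B * (2 * (1 - exp (- d)) * suminf h)"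
    by (rule LIMSEQ_le) (use bound in auto)
  also have "\<dots> \<le> B * (2 * d * suminf h)"
  proof -
    have "1 - exp (- d) \<le> d" using exp_ge_add_one_self[of "- d"] by simp
    moreover have "suminf h \<ge> 0" using h by (intro suminf_nonneg) (auto intro: less_imp_le)
    ultimately show ?thesis using B0 by (simp add: mult_left_mono mult_right_mono)
  qed
  finally show "norm (\<Sum>n. e n * of_real (weight p d n)) \<le> 2 * B * d * (\<Sum>n. weight p d n)"
    by (simp add: h_def mult_ac)
qed

text \<open>With zero sum over a period, the partial sums are themselves periodic.\<close>

lemma zero_mean_partial_sums_bounded:
  fixes e :: "nat \<Rightarrow> complex"
  assumes q: "q > 0" and per: "\<And>n. e (n + q) = e n" and zero: "(\<Sum>k<q. e k) = 0"
  obtains B where "\<And>n. norm (\<Sum>k<n. e k) \<le> B" "\<And>n. norm (e n) \<le> B"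
proof -
  have S_per: "(\<Sum>k<n + q. e k) = (\<Sum>k<n. e k)" for n
  proof (induction n)
    case (Suc n)
    then show ?case using per[of n] by simp
  qed (use zero in simp)
  define B where "B = Max ((\<lambda>n. norm (\<Sum>k<n. e k)) ` {..<q}) + Max ((\<lambda>n. norm (e n)) ` {..<q})"
  have le: "norm (\<Sum>k<n. e k) \<le> Max ((\<lambda>n. norm (\<Sum>k<n. e k)) ` {..<q})" "norm (e n) \<le> Max ((\<lambda>n. norm (e n)) ` {..<q})" for n
  proof (induction n rule: less_induct)
    case (less n)
    {
      case 1
      show ?case
      proof (cases "n < q")
        case False
        then show ?thesis using less(1)[of "n - q"] S_per[of "n - q"] q by simp
      qed auto
    next
      case 2
      show ?case
      proof (cases "n < q")
        case False
        then show ?thesis using less(2)[of "n - q"] per[of "n - q"] q by simp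
      qed auto
    }
  qed
  have "0 \<le> Max ((\<lambda>n. norm (\<Sum>k<n. e k)) ` {..<q})" "0 \<le> Max ((\<lambda>n. norm (e n)) ` {..<q})"
    using order_trans[OF norm_ge_zero le(1)] order_trans[OF norm_ge_zero le(2)] by auto
  then show thesis using le by (intro that[of B]) (auto simp: B_def intro: add_increasing add_increasing2)
qed

context degree_one
begin

text \<open>Extending the coefficients by 0 to real positions makes a shift by
  \<open>pi * Q\<^sup>2\<close> meaningful before that number is known to be an integer.\<close>

definition coeff_at :: "real \<Rightarrow> complex" where
  "coeff_at v = (if v \<in> \<nat> then A (nat \<lfloor>v\<rfloor>) else 0)"

lemma coeff_at_of_nat [simp]: "coeff_at (real n) = A n"
  by (simp add: coeff_at_def)

text \<open>At \<open>y = \<epsilon> + i v\<close> only the term with \<open>n = v\<close> is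
  singular, since there \<open>n^2 + y^2\<close> equals \<open>\<epsilon>\<close> times
  \<open>y + i v\<close>. All other terms stay bounded and are killed by the power of
  \<open>\<epsilon>\<close>. The powers of \<open>v\<close> cancel in the limit, so the factor of
  the coefficient is the same for every \<open>v\<close>.\<close>

lemma lattice_sum_limit:
  assumes v: "v > 0"
  shows "((\<lambda>\<epsilon>. of_real (\<epsilon> powr (2 * \<mu> + 1)) * (Complex \<epsilon> v * lattice_sum (Complex \<epsilon> v))) \<longlongrightarrow>
    \<i> * (2 * \<i>) powr of_real (- 2 * \<mu> - 1) * coeff_at v) (at_right 0)"
proof -
  define f where "f n y = A (Suc n) * of_real (real (Suc n) powr (2 * \<mu>)) * ((of_nat (Suc n))\<^sup>2 + y\<^sup>2) powr of_real (- 2 * \<mu> - 1)" for n y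
  define f' where "f' n y = (if real (Suc n) = v then 0 else f n y)" for n y
  \<comment> \<open>The singular term. Its index is one less than \<open>v\<close>, because
    \<open>f n\<close> belongs to the coefficient \<open>Suc n\<close>.\<close>
  define F where "F y = (if v \<in> \<nat> then f (nat \<lfloor>v\<rfloor> - 1) y else 0)" for y
  define X where "X = {n. real (Suc n) \<le> 2 * v \<and> real (Suc n) \<noteq> v}"
  \<comment> \<open>Beyond \<open>2 * v\<close> the gap \<open>n^2 - v^2\<close> is at least 3/4 of
    \<open>n^2\<close>; the finitely many smaller \<open>n\<close> contribute their own ratios to
    the minimum.\<close>
  define \<delta> where "\<delta> = Min (insert (3/4) ((\<lambda>n. \<bar>(real (Suc n))\<^sup>2 - v\<^sup>2\<bar> / (real (Suc n))\<^sup>2) ` X))"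
  have "X \<subseteq> {..nat \<lceil>2 * v\<rceil>}" by (auto simp: X_def) linarith
  then have fin: "finite X" by (rule finite_subset) simp
  have sq_ne: "(real (Suc n))\<^sup>2 \<noteq> v\<^sup>2" if "real (Suc n) \<noteq> v" for n
    using that v power2_eq_imp_eq[of "real (Suc n)" v] by (auto simp del: of_nat_Suc)
  have \<delta>: "\<delta> > 0"
    unfolding \<delta>_def using fin sq_ne by (subst Min_gr_iff) (auto simp: X_def simp del: of_nat_Suc)
  have gap: "\<delta> * (real (Suc n))\<^sup>2 \<le> \<bar>(real (Suc n))\<^sup>2 - v\<^sup>2\<bar>" if "real (Suc n) \<noteq> v" for n
  proof (cases "real (Suc n) \<le> 2 * v")
    case True
    then have "\<delta> \<le> \<bar>(real (Suc n))\<^sup>2 - v\<^sup>2\<bar> / (real (Suc n))\<^sup>2"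
      unfolding \<delta>_def using fin that by (intro Min_le) (auto simp: X_def)
    then show ?thesis by (subst (asm) pos_le_divide_eq) auto
  next
    case False
    then have "(2 * v)\<^sup>2 \<le> (real (Suc n))\<^sup>2" using v by (intro power_mono) auto
    then have "4 * v\<^sup>2 \<le> (real (Suc n))\<^sup>2" by (simp add: power_mult_distrib del: of_nat_Suc)
    then have "3/4 * (real (Suc n))\<^sup>2 \<le> \<bar>(real (Suc n))\<^sup>2 - v\<^sup>2\<bar>"
      using abs_ge_self[of "(real (Suc n))\<^sup>2 - v\<^sup>2"] by linarith
    moreover have "\<delta> \<le> 3/4" unfolding \<delta>_def using fin by (intro Min_le) auto
    then have "\<delta> * (real (Suc n))\<^sup>2 \<le> 3/4 * (real (Suc n))\<^sup>2" by (intro mult_right_mono) auto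
    ultimately show ?thesis by linarith
  qed
  define B where "B = (\<Sum>n. KA * \<delta> powr (- 2 * \<mu> - 1) * real (Suc n) powr (- (7/4)))"
  have f'_le: "norm (f' n (Complex \<epsilon> v)) \<le> KA * \<delta> powr (- 2 * \<mu> - 1) * real (Suc n) powr (- (7/4))" if \<epsilon>: "\<epsilon> > 0" for n \<epsilon>
  proof (cases "real (Suc n) = v")
    case False
    define x where "x = real (Suc n)"
    \<comment> \<open>The factorisation of \<open>x^2 + y^2\<close> into \<open>x + i y\<close> and
      \<open>x - i y\<close>; each modulus is bounded below by the real part.\<close>
    have "(of_nat (Suc n))\<^sup>2 + (Complex \<epsilon> v)\<^sup>2 = Complex (x - v) \<epsilon> * Complex (x + v) (- \<epsilon>)"
      by (simp add: x_def complex_eq_iff power2_eq_square algebra_simps)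
    moreover have "\<bar>x - v\<bar> * \<bar>x + v\<bar> \<le> norm (Complex (x - v) \<epsilon>) * norm (Complex (x + v) (- \<epsilon>))"
      using abs_Re_le_cmod[of "Complex (x - v) \<epsilon>"] abs_Re_le_cmod[of "Complex (x + v) (- \<epsilon>)"]
      by (intro mult_mono) auto
    moreover have "\<bar>x - v\<bar> * \<bar>x + v\<bar> = \<bar>x\<^sup>2 - v\<^sup>2\<bar>"
      by (simp add: power2_eq_square algebra_simps flip: abs_mult)
    ultimately have "\<bar>x\<^sup>2 - v\<^sup>2\<bar> \<le> norm ((of_nat (Suc n))\<^sup>2 + (Complex \<epsilon> v)\<^sup>2)"
      by (simp add: norm_mult)
    then have "\<delta> * (real (Suc n))\<^sup>2 \<le> norm ((of_nat (Suc n))\<^sup>2 + (Complex \<epsilon> v)\<^sup>2)"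
      using gap[OF False] unfolding x_def by (rule order_trans[rotated])
    from lattice_term_bound[OF \<delta> this] show ?thesis using False by (simp only: f'_def f_def if_False)
  qed (use KA in \<open>simp add: f'_def\<close>)
  have f'_sum: "summable (\<lambda>n. f' n (Complex \<epsilon> v))" "norm (\<Sum>n. f' n (Complex \<epsilon> v)) \<le> B" if "\<epsilon> > 0" for \<epsilon>
  proof -
    show "summable (\<lambda>n. f' n (Complex \<epsilon> v))"
      by (rule summable_comparison_test'[OF lattice_bound_summable, of 0]) (rule f'_le[OF that])
    show "norm (\<Sum>n. f' n (Complex \<epsilon> v)) \<le> B"
      unfolding B_def by (rule norm_suminf_le[OF f'_le[OF that] lattice_bound_summable])
  qed
  have split: "lattice_sum (Complex \<epsilon> v) = F (Complex \<epsilon> v) + (\<Sum>n. f' n (Complex \<epsilon> v))" if "\<epsilon> > 0" for \<epsilon>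
  proof (cases "v \<in> \<nat>")
    case True
    then obtain m where m: "v = real m" by (auto elim: Nats_cases)
    with v obtain n0 where n0: "v = real (Suc n0)" by (cases m) auto
    have "(\<lambda>n. (if n = n0 then f n (Complex \<epsilon> v) else 0) + f' n (Complex \<epsilon> v)) sums (f n0 (Complex \<epsilon> v) + (\<Sum>n. f' n (Complex \<epsilon> v)))"
      by (intro sums_add summable_sums f'_sum that sums_single)
    moreover have "(if n = n0 then f n (Complex \<epsilon> v) else 0) + f' n (Complex \<epsilon> v) = f n (Complex \<epsilon> v)" for n
      by (auto simp: f'_def n0)
    ultimately have "(\<lambda>n. f n (Complex \<epsilon> v)) sums (f n0 (Complex \<epsilon> v) + (\<Sum>n. f' n (Complex \<epsilon> v)))" by simp
    moreover have "F (Complex \<epsilon> v) = f n0 (Complex \<epsilon> v)"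
    proof -
      have "nat \<lfloor>v\<rfloor> - 1 = n0" unfolding n0 by simp
      then show ?thesis using True by (simp add: F_def)
    qed
    ultimately show ?thesis unfolding lattice_sum_def f_def[symmetric] by (simp add: sums_iff)
  next
    case False
    then have "f' n (Complex \<epsilon> v) = f n (Complex \<epsilon> v)" for n
      by (auto simp: f'_def simp del: of_nat_Suc)
    then show ?thesis unfolding lattice_sum_def f_def[symmetric] using False by (simp add: F_def)
  qed
  have p0: "((\<lambda>\<epsilon>::real. \<epsilon> powr (2 * \<mu> + 1)) \<longlongrightarrow> 0) (at_right 0)"
  proof -
    have "((\<lambda>\<epsilon>::real. \<epsilon> powr (2 * \<mu> + 1)) \<longlongrightarrow> 0 powr (2 * \<mu> + 1)) (at_right 0)"
      using \<mu> by (intro tendsto_powr' tendsto_ident_at tendsto_const) (auto simp: eventually_at_filter)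
    then show ?thesis by simp
  qed
  have cpx: "((\<lambda>\<epsilon>. Complex \<epsilon> v) \<longlongrightarrow> Complex 0 v) (at_right 0)"
    by (intro tendsto_Complex tendsto_const tendsto_ident_at)
  have rest: "((\<lambda>\<epsilon>. of_real (\<epsilon> powr (2 * \<mu> + 1)) * (Complex \<epsilon> v * (\<Sum>n. f' n (Complex \<epsilon> v)))) \<longlongrightarrow> 0) (at_right 0)"
  proof (rule Lim_null_comparison)
    show "\<forall>\<^sub>F \<epsilon> in at_right 0. norm (of_real (\<epsilon> powr (2 * \<mu> + 1)) * (Complex \<epsilon> v * (\<Sum>n. f' n (Complex \<epsilon> v)))) \<le> \<epsilon> powr (2 * \<mu> + 1) * (norm (Complex \<epsilon> v) * B)"
      using eventually_at_right_less[of "0::real"]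
      by eventually_elim (auto simp: norm_mult intro!: mult_left_mono f'_sum)
    have "((\<lambda>\<epsilon>. \<epsilon> powr (2 * \<mu> + 1) * (norm (Complex \<epsilon> v) * B)) \<longlongrightarrow> 0 * (norm (Complex 0 v) * B)) (at_right 0)"
      by (intro tendsto_mult p0 tendsto_norm cpx tendsto_const)
    then show "((\<lambda>\<epsilon>. \<epsilon> powr (2 * \<mu> + 1) * (norm (Complex \<epsilon> v) * B)) \<longlongrightarrow> 0) (at_right 0)" by simp
  qed
  have main: "((\<lambda>\<epsilon>. of_real (\<epsilon> powr (2 * \<mu> + 1)) * (Complex \<epsilon> v * F (Complex \<epsilon> v))) \<longlongrightarrow> \<i> * (2 * \<i>) powr of_real (- 2 * \<mu> - 1) * coeff_at v) (at_right 0)"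
  proof (cases "v \<in> \<nat>")
    case True
    then obtain m where m: "v = real m" by (auto elim: Nats_cases)
    with v obtain n where n: "v = real (Suc n)" by (cases m) auto
    have nf: "nat \<lfloor>v\<rfloor> - 1 = n" unfolding n by simp
    define a where "a = complex_of_real (- 2 * \<mu> - 1)"
    define L where "L y = y * (A (Suc n) * of_real (v powr (2 * \<mu>)) * (y + \<i> * of_real v) powr a)" for y
    have ev: "of_real (\<epsilon> powr (2 * \<mu> + 1)) * (Complex \<epsilon> v * F (Complex \<epsilon> v)) = L (Complex \<epsilon> v)" if \<epsilon>: "\<epsilon> > 0" for \<epsilon>
    proof -
      \<comment> \<open>Here \<open>n = v\<close>, so one of the two factors is the positive real
        \<open>\<epsilon>\<close> and its power splits off without a branch correction.\<close>
      have "(of_nat (Suc n))\<^sup>2 + (Complex \<epsilon> v)\<^sup>2 = of_real \<epsilon> * (Complex \<epsilon> v + \<i> * of_real v)"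
        unfolding n by (simp add: complex_eq_iff power2_eq_square algebra_simps)
      moreover have "(of_real \<epsilon> * (Complex \<epsilon> v + \<i> * of_real v)) powr a = of_real \<epsilon> powr a * (Complex \<epsilon> v + \<i> * of_real v) powr a"
        using \<epsilon> by (intro powr_times_real_left) auto
      moreover have "of_real \<epsilon> powr a = complex_of_real (\<epsilon> powr (- 2 * \<mu> - 1))"
        unfolding a_def using \<epsilon> by (intro powr_of_real) auto
      ultimately have "F (Complex \<epsilon> v) = A (Suc n) * of_real (v powr (2 * \<mu>)) * (complex_of_real (\<epsilon> powr (- 2 * \<mu> - 1)) * (Complex \<epsilon> v + \<i> * of_real v) powr a)"
        using True unfolding F_def nf f_def a_def[symmetric] by (simp only: if_True n)
      then have "of_real (\<epsilon> powr (2 * \<mu> + 1)) * (Complex \<epsilon> v * F (Complex \<epsilon> v)) =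
          (of_real (\<epsilon> powr (2 * \<mu> + 1)) * of_real (\<epsilon> powr (- 2 * \<mu> - 1))) * L (Complex \<epsilon> v)"
        unfolding L_def by (simp only: mult_ac)
      also have "of_real (\<epsilon> powr (2 * \<mu> + 1)) * of_real (\<epsilon> powr (- 2 * \<mu> - 1)) = complex_of_real 1"
        unfolding of_real_mult[symmetric] using \<epsilon> by (simp flip: powr_add)
      finally show ?thesis by simp
    qed
    have slit: "Complex 0 v + \<i> * of_real v \<notin> \<real>\<^sub>\<le>\<^sub>0" using v by (auto simp: complex_nonpos_Reals_iff)
    have "((\<lambda>\<epsilon>. L (Complex \<epsilon> v)) \<longlongrightarrow> L (Complex 0 v)) (at_right 0)"
      unfolding L_def using slit by (intro tendsto_intros cpx tendsto_powr_complex) auto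
    moreover have "L (Complex 0 v) = \<i> * (2 * \<i>) powr a * coeff_at v"
    proof -
      have "Complex 0 v + \<i> * of_real v = of_real v * (2 * \<i>)" by (simp add: complex_eq_iff)
      moreover have "(of_real v * (2 * \<i>)) powr a = of_real v powr a * (2 * \<i>) powr a"
        using v by (intro powr_times_real_left) auto
      moreover have "of_real v powr a = complex_of_real (v powr (- 2 * \<mu> - 1))"
        unfolding a_def using v by (intro powr_of_real) auto
      moreover have "Complex 0 v = \<i> * of_real v" by (simp add: complex_eq_iff)
      moreover have "coeff_at v = A (Suc n)" unfolding n by (rule coeff_at_of_nat)
      ultimately have "L (Complex 0 v) = \<i> * (2 * \<i>) powr a * coeff_at v * (of_real v * (of_real (v powr (2 * \<mu>)) * of_real (v powr (- 2 * \<mu> - 1))))"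
        unfolding L_def by (simp only: mult_ac)
      also have "of_real v * (of_real (v powr (2 * \<mu>)) * of_real (v powr (- 2 * \<mu> - 1))) = complex_of_real 1"
      proof -
        have "v powr (2 * \<mu>) * v powr (- 2 * \<mu> - 1) = v powr (- 1)" by (simp flip: powr_add)
        then have "v * (v powr (2 * \<mu>) * v powr (- 2 * \<mu> - 1)) = 1" using v by (simp add: powr_minus_divide)
        then show ?thesis by (simp only: of_real_mult[symmetric])
      qed
      finally show ?thesis by simp
    qed
    ultimately have "((\<lambda>\<epsilon>. L (Complex \<epsilon> v)) \<longlongrightarrow> \<i> * (2 * \<i>) powr a * coeff_at v) (at_right 0)" by simp
    moreover have "\<forall>\<^sub>F \<epsilon> in at_right 0. L (Complex \<epsilon> v) = of_real (\<epsilon> powr (2 * \<mu> + 1)) * (Complex \<epsilon> v * F (Complex \<epsilon> v))"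
      using eventually_at_right_less[of "0::real"] by eventually_elim (simp only: ev)
    ultimately show ?thesis unfolding a_def by (rule Lim_transform_eventually)
  qed (simp add: F_def coeff_at_def)
  from tendsto_add[OF main rest]
  have "((\<lambda>\<epsilon>. of_real (\<epsilon> powr (2 * \<mu> + 1)) * (Complex \<epsilon> v * F (Complex \<epsilon> v)) + of_real (\<epsilon> powr (2 * \<mu> + 1)) * (Complex \<epsilon> v * (\<Sum>n. f' n (Complex \<epsilon> v)))) \<longlongrightarrow>
      \<i> * (2 * \<i>) powr of_real (- 2 * \<mu> - 1) * coeff_at v) (at_right 0)" by simp
  moreover have "\<forall>\<^sub>F \<epsilon> in at_right 0. of_real (\<epsilon> powr (2 * \<mu> + 1)) * (Complex \<epsilon> v * F (Complex \<epsilon> v)) + of_real (\<epsilon> powr (2 * \<mu> + 1)) * (Complex \<epsilon> v * (\<Sum>n. f' n (Complex \<epsilon> v)))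
      = of_real (\<epsilon> powr (2 * \<mu> + 1)) * (Complex \<epsilon> v * lattice_sum (Complex \<epsilon> v))"
    using eventually_at_right_less[of "0::real"] by eventually_elim (simp only: split distrib_left)
  ultimately show ?thesis by (rule Lim_transform_eventually)
qed

text \<open>The remainder is continuous at \<open>i v\<close> for \<open>v > 0\<close>, so the
  scaling by a positive power of \<open>\<epsilon>\<close> removes it from
  \<open>summation_identity\<close>.\<close>

lemma exp_sum_limit:
  obtains c where
    "\<And>v. v > 0 \<Longrightarrow> ((\<lambda>\<epsilon>. of_real (\<epsilon> powr (2 * \<mu> + 1)) * (c * exp_sum (Complex \<epsilon> v))) \<longlongrightarrow>
    \<i> * (2 * \<i>) powr of_real (- 2 * \<mu> - 1) * coeff_at v) (at_right 0)"
proof -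
  obtain c R where R: "R holomorphic_on - \<real>\<^sub>\<le>\<^sub>0"
    and id: "\<And>y. Re y > 0 \<Longrightarrow> y * lattice_sum y = c * exp_sum y + R y"
    using summation_identity by blast
  have "((\<lambda>\<epsilon>. of_real (\<epsilon> powr (2 * \<mu> + 1)) * (c * exp_sum (Complex \<epsilon> v))) \<longlongrightarrow>
    \<i> * (2 * \<i>) powr of_real (- 2 * \<mu> - 1) * coeff_at v) (at_right 0)" if v: "v > 0" for v
  proof -
    have "isCont R (Complex 0 v)"
    proof (intro field_differentiable_imp_continuous_at holomorphic_on_imp_differentiable_at[OF R])
      show "open (- \<real>\<^sub>\<le>\<^sub>0 :: complex set)" by (simp add: open_Compl)
      show "Complex 0 v \<in> - \<real>\<^sub>\<le>\<^sub>0" using v by (simp add: complex_nonpos_Reals_iff)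
    qed
    moreover have "((\<lambda>\<epsilon>. Complex \<epsilon> v) \<longlongrightarrow> Complex 0 v) (at_right 0)"
      by (intro tendsto_Complex tendsto_const tendsto_ident_at)
    ultimately have R_lim: "((\<lambda>\<epsilon>. R (Complex \<epsilon> v)) \<longlongrightarrow> R (Complex 0 v)) (at_right 0)"
      by (rule isCont_tendsto_compose)
    have p0: "((\<lambda>\<epsilon>. complex_of_real (\<epsilon> powr (2 * \<mu> + 1))) \<longlongrightarrow> of_real 0) (at_right 0)"
    proof (intro tendsto_of_real)
      have "((\<lambda>\<epsilon>::real. \<epsilon> powr (2 * \<mu> + 1)) \<longlongrightarrow> 0 powr (2 * \<mu> + 1)) (at_right 0)"
        using \<mu> by (intro tendsto_powr' tendsto_ident_at tendsto_const) (auto simp: eventually_at_filter)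
      then show "((\<lambda>\<epsilon>::real. \<epsilon> powr (2 * \<mu> + 1)) \<longlongrightarrow> 0) (at_right 0)" by simp
    qed
    have "((\<lambda>\<epsilon>. of_real (\<epsilon> powr (2 * \<mu> + 1)) * (Complex \<epsilon> v * lattice_sum (Complex \<epsilon> v)) - of_real (\<epsilon> powr (2 * \<mu> + 1)) * R (Complex \<epsilon> v)) \<longlongrightarrow>
        \<i> * (2 * \<i>) powr of_real (- 2 * \<mu> - 1) * coeff_at v - of_real 0 * R (Complex 0 v)) (at_right 0)"
      by (intro tendsto_diff tendsto_mult lattice_sum_limit[OF v] p0 R_lim)
    moreover have "\<forall>\<^sub>F \<epsilon> in at_right 0. of_real (\<epsilon> powr (2 * \<mu> + 1)) * (Complex \<epsilon> v * lattice_sum (Complex \<epsilon> v)) - of_real (\<epsilon> powr (2 * \<mu> + 1)) * R (Complex \<epsilon> v)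
          = of_real (\<epsilon> powr (2 * \<mu> + 1)) * (c * exp_sum (Complex \<epsilon> v))"
      using eventually_at_right_less[of "0::real"]
    proof eventually_elim
      case (elim \<epsilon>)
      then have "Complex \<epsilon> v * lattice_sum (Complex \<epsilon> v) = c * exp_sum (Complex \<epsilon> v) + R (Complex \<epsilon> v)"
        by (intro id) simp
      then show ?case by (simp only: distrib_left add_diff_cancel_right')
    qed
    ultimately have "((\<lambda>\<epsilon>. of_real (\<epsilon> powr (2 * \<mu> + 1)) * (c * exp_sum (Complex \<epsilon> v))) \<longlongrightarrow>
        \<i> * (2 * \<i>) powr of_real (- 2 * \<mu> - 1) * coeff_at v - of_real 0 * R (Complex 0 v)) (at_right 0)"
      by (rule Lim_transform_eventually)
    then show ?thesis by (simp only: of_real_0 mult_zero_left diff_zero)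
  qed
  then show thesis by (rule that)
qed

lemma limit_factor_nonzero: "\<i> * (2 * \<i>) powr of_real (- 2 * \<mu> - 1) \<noteq> 0"
  by simp

section \<open>The conductor and self-duality of the coefficients\<close>

lemma exp_sum_periodic: "exp_sum (Complex \<epsilon> (v + pi * Q\<^sup>2)) = exp_sum (Complex \<epsilon> v)"
proof -
  have "exp (- of_real (2 / Q\<^sup>2 * real (Suc n)) * Complex \<epsilon> (v + pi * Q\<^sup>2)) = exp (- of_real (2 / Q\<^sup>2 * real (Suc n)) * Complex \<epsilon> v)" for n
    unfolding exp_eq
  proof (intro exI[of _ "- int (Suc n)"])
    have "2 / Q\<^sup>2 * real (Suc n) * (v + pi * Q\<^sup>2) = 2 / Q\<^sup>2 * real (Suc n) * v + 2 * real (Suc n) * pi"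
      using Q by (simp add: distrib_left del: of_nat_Suc)
    then show "- of_real (2 / Q\<^sup>2 * real (Suc n)) * Complex \<epsilon> (v + pi * Q\<^sup>2) =
        - of_real (2 / Q\<^sup>2 * real (Suc n)) * Complex \<epsilon> v + of_real (of_int (2 * - int (Suc n)) * pi) * \<i>"
      by (simp add: complex_eq_iff del: of_nat_Suc)
  qed
  then show ?thesis unfolding exp_sum_def by (simp only:)
qed

lemma coeff_at_periodic:
  assumes "v > 0"
  shows "coeff_at (v + pi * Q\<^sup>2) = coeff_at v"
proof -
  obtain c where c: "\<And>v. v > 0 \<Longrightarrow> ((\<lambda>\<epsilon>. of_real (\<epsilon> powr (2 * \<mu> + 1)) * (c * exp_sum (Complex \<epsilon> v))) \<longlongrightarrow>
    \<i> * (2 * \<i>) powr of_real (- 2 * \<mu> - 1) * coeff_at v) (at_right 0)"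
    using exp_sum_limit by blast
  have "v + pi * Q\<^sup>2 > 0" using assms Q by (simp add: add_pos_pos)
  from tendsto_unique[OF _ c[OF this, unfolded exp_sum_periodic] c[OF assms]] show ?thesis
    using limit_factor_nonzero by simp
qed

text \<open>At \<open>v = 1\<close> the coefficient is 1, so by periodicity the value at
  \<open>1 + pi * Q\<^sup>2\<close> is nonzero, which happens only at natural numbers.\<close>

lemma conductor:
  obtains q where "q > 0" "real q = pi * Q\<^sup>2" "\<And>n. n > 0 \<Longrightarrow> A (n + q) = A n"
proof -
  have qpos: "pi * Q\<^sup>2 > 0" using Q by simp
  have "coeff_at (1 + pi * Q\<^sup>2) = 1"
    using coeff_at_periodic[of 1] coeff_at_of_nat[of 1] A1 by simp
  then have "1 + pi * Q\<^sup>2 \<in> \<nat>" by (auto simp: coeff_at_def split: if_splits)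
  then obtain k where k: "1 + pi * Q\<^sup>2 = real k" by (auto elim: Nats_cases)
  with qpos have "k > 1" by (metis less_add_same_cancel1 of_nat_1 of_nat_less_iff)
  then obtain q where q: "k = Suc q" "q > 0" by (cases k) auto
  with k have eq: "real q = pi * Q\<^sup>2" by simp
  have "A (n + q) = A n" if "n > 0" for n
    using coeff_at_periodic[of "real n"] coeff_at_of_nat[of "n + q"] coeff_at_of_nat[of n] that
    by (simp add: eq del: coeff_at_of_nat)
  then show thesis using that q eq by blast
qed

text \<open>At \<open>y = \<epsilon> + i m\<close> the exponentials are weights times roots of
  unity, because \<open>2 / Q\<^sup>2 = 2 * pi / q\<close>. So the coefficients of the weights form
  a sequence of period \<open>q\<close>. Its mean gives the main term; the deviation from the mean
  has bounded partial sums and gains a factor \<open>\<epsilon>\<close>.\<close>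

lemma exp_sum_average:
  assumes q: "q > 0" "real q = pi * Q\<^sup>2" and per: "\<And>n. n > 0 \<Longrightarrow> A (n + q) = A n"
  shows "((\<lambda>\<epsilon>. of_real (\<epsilon> powr (2 * \<mu> + 1)) * exp_sum (Complex \<epsilon> (real m)) -
      cnj (\<Sum>r<q. A (Suc r) * unity_root q (Suc r * m)) / of_nat q *
        of_real (\<epsilon> powr (2 * \<mu> + 1) * (\<Sum>n. weight (2 * \<mu>) (2 / Q\<^sup>2 * \<epsilon>) n))) \<longlongrightarrow> 0) (at_right 0)"
proof -
  define k where "k = 2 / Q\<^sup>2"
  have k: "k > 0" using Q by (simp add: k_def)
  have kq: "k = 2 * pi / real q" using Q by (simp add: k_def q)
  define c where "c n = cnj (A (Suc n) * unity_root q (Suc n * m))" for n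
  define mean where "mean = (\<Sum>r<q. c r) / of_nat q"
  define e where "e n = c n - mean" for n
  have c_per: "c (n + q) = c n" for n
  proof -
    have "unity_root q (Suc (n + q) * m) = unity_root q (Suc n * m)"
    proof (rule unity_root_cong[OF q(1)])
      have "Suc (n + q) * m = Suc n * m + m * q" by (simp add: algebra_simps)
      then show "[Suc (n + q) * m = Suc n * m] (mod q)" by (simp only: cong_def mod_mult_self1)
    qed
    moreover have "A (Suc (n + q)) = A (Suc n)" using per[of "Suc n"] by simp
    ultimately show ?thesis by (simp only: c_def)
  qed
  have e_per: "e (n + q) = e n" for n by (simp add: e_def c_per)
  have e_zero: "(\<Sum>r<q. e r) = 0" using q(1) by (simp add: e_def sum_subtractf mean_def)
  obtain B where B: "\<And>n. norm (\<Sum>k<n. e k) \<le> B" "\<And>n. norm (e n) \<le> B"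
    using zero_mean_partial_sums_bounded[OF q(1) e_per e_zero] by blast
  have p: "2 * \<mu> \<ge> 0" using \<mu> by simp
  obtain C where C: "\<And>d. d > 0 \<Longrightarrow> d powr (2 * \<mu> + 1) * (\<Sum>n. weight (2 * \<mu>) d n) \<le> C"
    using weight_sum_bounded[OF p] by blast
  have B0: "B \<ge> 0" using B(1)[of 0] by simp
  have eq: "exp_sum (Complex \<epsilon> (real m)) - mean * of_real (\<Sum>n. weight (2 * \<mu>) (k * \<epsilon>) n) = (\<Sum>n. e n * of_real (weight (2 * \<mu>) (k * \<epsilon>) n))"
    if \<epsilon>: "\<epsilon> > 0" for \<epsilon>
  proof -
    define d where "d = k * \<epsilon>"
    have d: "d > 0" using k \<epsilon> by (simp add: d_def)
    have term_eq: "cnj (A (Suc n)) * of_real (real (Suc n) powr (2 * \<mu>)) * exp (- of_real (2 / Q\<^sup>2 * real (Suc n)) * Complex \<epsilon> (real m))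
        = c n * of_real (weight (2 * \<mu>) d n)" for n
    proof -
      have "- of_real (2 / Q\<^sup>2 * real (Suc n)) * Complex \<epsilon> (real m) =
          of_real (- d * real (Suc n)) + \<i> * of_real (- (2 * pi * real (Suc n * m) / real q))"
        unfolding k_def[symmetric] d_def using kq
        by (simp add: complex_eq_iff algebra_simps)
      then have "exp (- of_real (2 / Q\<^sup>2 * real (Suc n)) * Complex \<epsilon> (real m)) =
          of_real (exp (- d * real (Suc n))) * cis (- (2 * pi * real (Suc n * m) / real q))"
        by (simp only: exp_add exp_of_real cis_conv_exp)
      moreover have "cis (- (2 * pi * real (Suc n * m) / real q)) = cnj (unity_root q (Suc n * m))"
        unfolding unity_root_def by (simp only: cis_cnj)
      ultimately show ?thesis
        unfolding c_def weight_def by (simp only: complex_cnj_mult of_real_mult mult_ac)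
    qed
    have "(\<lambda>n. e n * of_real (weight (2 * \<mu>) d n) + mean * of_real (weight (2 * \<mu>) d n)) sums
        ((\<Sum>n. e n * of_real (weight (2 * \<mu>) d n)) + mean * of_real (\<Sum>n. weight (2 * \<mu>) d n))"
      by (intro sums_add sums_mult sums_of_real summable_sums weighted_sum_bound(2)[OF p d B] weight_summable d)
    moreover have "e n * of_real (weight (2 * \<mu>) d n) + mean * of_real (weight (2 * \<mu>) d n) = c n * of_real (weight (2 * \<mu>) d n)" for n
      by (simp add: e_def left_diff_distrib)
    ultimately have "exp_sum (Complex \<epsilon> (real m)) = (\<Sum>n. e n * of_real (weight (2 * \<mu>) d n)) + mean * of_real (\<Sum>n. weight (2 * \<mu>) d n)"
      unfolding exp_sum_def term_eq by (simp add: sums_iff)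
    then show ?thesis by (simp add: d_def)
  qed
  have le: "norm (of_real (\<epsilon> powr (2 * \<mu> + 1)) * (\<Sum>n. e n * of_real (weight (2 * \<mu>) (k * \<epsilon>) n))) \<le> 2 * B * k * C / k powr (2 * \<mu> + 1) * \<epsilon>"
    if \<epsilon>: "\<epsilon> > 0" for \<epsilon>
  proof -
    have d: "k * \<epsilon> > 0" using k \<epsilon> by simp
    \<comment> \<open>Restores the power of the decay rate \<open>k * \<epsilon>\<close>, in which
      \<open>weight_sum_bounded\<close> is stated; the extra rate from summation by parts is the
      factor that tends to 0.\<close>
    have pw: "\<epsilon> powr (2 * \<mu> + 1) = (k * \<epsilon>) powr (2 * \<mu> + 1) / k powr (2 * \<mu> + 1)"
      using k \<epsilon> by (simp add: powr_mult)
    have "norm (of_real (\<epsilon> powr (2 * \<mu> + 1)) * (\<Sum>n. e n * of_real (weight (2 * \<mu>) (k * \<epsilon>) n))) \<le>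
        \<epsilon> powr (2 * \<mu> + 1) * (2 * B * (k * \<epsilon>) * (\<Sum>n. weight (2 * \<mu>) (k * \<epsilon>) n))"
      unfolding norm_mult using weighted_sum_bound(1)[OF p d B] by (simp add: mult_left_mono)
    also have "\<dots> = (2 * B * (k * \<epsilon>) / k powr (2 * \<mu> + 1)) * ((k * \<epsilon>) powr (2 * \<mu> + 1) * (\<Sum>n. weight (2 * \<mu>) (k * \<epsilon>) n))"
      unfolding pw by simp
    also have "\<dots> \<le> (2 * B * (k * \<epsilon>) / k powr (2 * \<mu> + 1)) * C"
      using B0 d by (intro mult_left_mono C) auto
    finally show ?thesis by (simp add: mult_ac)
  qed
  have "((\<lambda>\<epsilon>. of_real (\<epsilon> powr (2 * \<mu> + 1)) * (\<Sum>n. e n * of_real (weight (2 * \<mu>) (k * \<epsilon>) n))) \<longlongrightarrow> 0) (at_right 0)"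
  proof (rule Lim_null_comparison)
    show "\<forall>\<^sub>F \<epsilon> in at_right 0. norm (of_real (\<epsilon> powr (2 * \<mu> + 1)) * (\<Sum>n. e n * of_real (weight (2 * \<mu>) (k * \<epsilon>) n))) \<le> 2 * B * k * C / k powr (2 * \<mu> + 1) * \<epsilon>"
      using eventually_at_right_less[of "0::real"] by eventually_elim (rule le)
    show "((\<lambda>\<epsilon>. 2 * B * k * C / k powr (2 * \<mu> + 1) * \<epsilon>) \<longlongrightarrow> 0) (at_right 0)"
      by (rule tendsto_mult_right_zero[OF tendsto_ident_at])
  qed
  then show ?thesis
  proof (rule Lim_transform_eventually)
    show "\<forall>\<^sub>F \<epsilon> in at_right 0. of_real (\<epsilon> powr (2 * \<mu> + 1)) * (\<Sum>n. e n * of_real (weight (2 * \<mu>) (k * \<epsilon>) n)) =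
      of_real (\<epsilon> powr (2 * \<mu> + 1)) * exp_sum (Complex \<epsilon> (real m)) -
      cnj (\<Sum>r<q. A (Suc r) * unity_root q (Suc r * m)) / of_nat q *
        of_real (\<epsilon> powr (2 * \<mu> + 1) * (\<Sum>n. weight (2 * \<mu>) (2 / Q\<^sup>2 * \<epsilon>) n))"
      using eventually_at_right_less[of "0::real"]
    proof eventually_elim
      case (elim \<epsilon>)
      have mean_eq: "cnj (\<Sum>r<q. A (Suc r) * unity_root q (Suc r * m)) / of_nat q = mean"
        unfolding mean_def c_def cnj_sum ..
      show ?case
        unfolding eq[OF elim, symmetric] k_def[symmetric] mean_eq
        by (simp only: right_diff_distrib of_real_mult mult.left_commute)
    qed
  qed
qed

text \<open>The singular part at \<open>i m\<close> gives \<open>A m\<close> as the limit of the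
  Fourier coefficient \<open>T m\<close> times a quantity independent of \<open>m\<close>. That
  quantity is never evaluated: the case \<open>m = 1\<close>, where \<open>A 1 = 1\<close>, shows
  \<open>T 1\<close> to be nonzero and determines the ratio.\<close>

lemma fourier_self_dual:
  assumes q: "q > 0" "real q = pi * Q\<^sup>2" and per: "\<And>n. n > 0 \<Longrightarrow> A (n + q) = A n"
  obtains \<kappa> where "\<And>m. m > 0 \<Longrightarrow> A m = \<kappa> * cnj (\<Sum>r<q. A (Suc r) * unity_root q (Suc r * m))"
proof -
  define K where "K = \<i> * (2 * \<i>) powr of_real (- 2 * \<mu> - 1)"
  define T where "T m = cnj (\<Sum>r<q. A (Suc r) * unity_root q (Suc r * m))" for m
  define W where "W \<epsilon> = complex_of_real (\<epsilon> powr (2 * \<mu> + 1) * (\<Sum>n. weight (2 * \<mu>) (2 / Q\<^sup>2 * \<epsilon>) n))" for \<epsilon>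
  have K: "K \<noteq> 0" unfolding K_def by (rule limit_factor_nonzero)
  obtain c where c: "\<And>v. v > 0 \<Longrightarrow> ((\<lambda>\<epsilon>. of_real (\<epsilon> powr (2 * \<mu> + 1)) * (c * exp_sum (Complex \<epsilon> v))) \<longlongrightarrow> K * coeff_at v) (at_right 0)"
    unfolding K_def using exp_sum_limit by blast
  have lim: "((\<lambda>\<epsilon>. c * (T m / of_nat q * W \<epsilon>)) \<longlongrightarrow> K * A m) (at_right 0)" if m: "m > 0" for m
  proof -
    have "((\<lambda>\<epsilon>. of_real (\<epsilon> powr (2 * \<mu> + 1)) * (c * exp_sum (Complex \<epsilon> (real m))) -
        c * (of_real (\<epsilon> powr (2 * \<mu> + 1)) * exp_sum (Complex \<epsilon> (real m)) - T m / of_nat q * W \<epsilon>)) \<longlongrightarrow> K * coeff_at (real m) - c * 0) (at_right 0)"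
      unfolding T_def W_def using m
      by (intro tendsto_diff tendsto_mult tendsto_const exp_sum_average[OF q per] c) auto
    then show ?thesis by (simp add: algebra_simps)
  qed
  have T1: "T 1 \<noteq> 0"
  proof
    assume "T 1 = 0"
    then have "((\<lambda>\<epsilon>::real. 0::complex) \<longlongrightarrow> K * A 1) (at_right 0)" using lim[of 1] by simp
    from tendsto_unique[OF _ this tendsto_const] show False using K A1 by simp
  qed
  have "A m = 1 / T 1 * T m" if m: "m > 0" for m
  proof -
    have "((\<lambda>\<epsilon>. T m / T 1 * (c * (T 1 / of_nat q * W \<epsilon>))) \<longlongrightarrow> T m / T 1 * (K * A 1)) (at_right 0)"
      by (intro tendsto_mult tendsto_const lim) simp
    moreover have "T m / T 1 * (c * (T 1 / of_nat q * W \<epsilon>)) = c * (T m / of_nat q * W \<epsilon>)" for \<epsilon>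
      using T1 by simp
    ultimately have "((\<lambda>\<epsilon>. c * (T m / of_nat q * W \<epsilon>)) \<longlongrightarrow> T m / T 1 * (K * A 1)) (at_right 0)"
      by (simp only:)
    from tendsto_unique[OF _ lim[OF m] this] have "K * A m = T m / T 1 * (K * A 1)" by simp
    also have "\<dots> = K * (1 / T 1 * T m)" unfolding A1 by (simp add: mult.commute)
    finally show ?thesis using K by (simp only: mult_cancel_left) simp
  qed
  then show thesis unfolding T_def by (rule that)
qed

end

section \<open>Growth in vertical strips\<close>

lemma powr_le_exp_eventually:
  obtains t0 where "t0 \<ge> 1" "\<And>t. t \<ge> t0 \<Longrightarrow> (2 + t) powr \<rho> \<le> exp (t::real)"
proof -
  have "((\<lambda>t::real. (2 + t) powr \<rho> / exp t) \<longlongrightarrow> 0) at_top" by real_asymp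
  then have "\<forall>\<^sub>F t in at_top. (2 + t) powr \<rho> / exp t < 1" by (rule order_tendstoD) simp
  then obtain t1 where t1: "\<And>t. t \<ge> t1 \<Longrightarrow> (2 + t) powr \<rho> / exp t < 1"
    by (auto simp: eventually_at_top_linorder)
  have "(2 + t) powr \<rho> \<le> exp t" if "t \<ge> max 1 t1" for t
    using t1[of t] that by (simp add: divide_less_eq)
  then show thesis by (intro that[of "max 1 t1"]) auto
qed

text \<open>In the strip \<open>norm z\<close> is at most \<open>2 + \<bar>Im z\<bar>\<close>, so
  finite order is far below the double exponential growth that
  \<open>phragmen_lindelof_strip\<close> admits.\<close>

lemma finite_order_strip_bound:
  assumes "entire_of_finite_order g"
  obtains B where "\<And>z. -1/2 \<le> Re z \<Longrightarrow> Re z \<le> 3/2 \<Longrightarrow> norm (g z) \<le> B * exp (exp \<bar>Im z\<bar>)"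
proof -
  obtain \<rho> where g: "g holomorphic_on UNIV" and O: "(\<lambda>z. norm (g z)) \<in> O[at_infinity](\<lambda>z. exp (norm z powr \<rho>))"
    using assms by (auto simp: entire_of_finite_order_def)
  obtain C where C: "C > 0" "\<forall>\<^sub>F z in at_infinity. norm (norm (g z)) \<le> C * norm (exp (norm z powr \<rho>))"
    by (rule landau_o.bigE[OF O])
  then obtain b where b: "\<And>z. b \<le> norm z \<Longrightarrow> norm (g z) \<le> C * exp (norm z powr \<rho>)"
    by (auto simp: eventually_at_infinity)
  \<comment> \<open>The exponent \<open>\<rho>\<close> may be negative; \<open>max \<rho> 0\<close>
    makes the power monotone in its base.\<close>
  obtain t0 where t0: "t0 \<ge> 1" "\<And>t. t \<ge> t0 \<Longrightarrow> (2 + t) powr (max \<rho> 0) \<le> exp t"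
    by (rule powr_le_exp_eventually[of "max \<rho> 0"]) blast
  define T where "T = max t0 b"
  let ?K = "cbox (Complex (-1/2) (-T)) (Complex (3/2) T)"
  have cpt: "compact (g ` ?K)"
    by (intro compact_continuous_image holomorphic_on_imp_continuous_on compact_cbox holomorphic_on_subset[OF g]) simp
  obtain M where "\<And>x. x \<in> g ` ?K \<Longrightarrow> norm x \<le> M"
    using compact_imp_bounded[OF cpt] unfolding bounded_iff by blast
  then have M: "\<And>z. z \<in> ?K \<Longrightarrow> norm (g z) \<le> M" by blast
  have "norm (g z) \<le> (max M C) * exp (exp \<bar>Im z\<bar>)" if z: "-1/2 \<le> Re z" "Re z \<le> 3/2" for z
  proof (cases "\<bar>Im z\<bar> \<le> T")
    case True
    then have "norm (g z) \<le> max M C" using M[of z] z by (auto simp: in_cbox_complex_iff abs_le_iff)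
    also have "max M C \<le> max M C * exp (exp \<bar>Im z\<bar>)"
      using C(1) mult_left_mono[of 1 "exp (exp \<bar>Im z\<bar>)" "max M C"] by simp
    finally show ?thesis .
  next
    case False
    then have big: "\<bar>Im z\<bar> \<ge> t0" "\<bar>Im z\<bar> \<ge> b" by (auto simp: T_def)
    have nz: "1 \<le> norm z" "b \<le> norm z" using big t0(1) abs_Im_le_cmod[of z] by linarith+
    have "norm z \<le> 2 + \<bar>Im z\<bar>" using cmod_le[of z] z by linarith
    have "norm z powr \<rho> \<le> norm z powr (max \<rho> 0)" using nz by (intro powr_mono) auto
    also have "\<dots> \<le> (2 + \<bar>Im z\<bar>) powr (max \<rho> 0)" using \<open>norm z \<le> 2 + \<bar>Im z\<bar>\<close> by (intro powr_mono2) auto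
    also have "\<dots> \<le> exp \<bar>Im z\<bar>" by (rule t0(2)[OF big(1)])
    finally have "exp (norm z powr \<rho>) \<le> exp (exp \<bar>Im z\<bar>)" by simp
    then have "C * exp (norm z powr \<rho>) \<le> max M C * exp (exp \<bar>Im z\<bar>)" using C(1) by (intro mult_mono) auto
    then show ?thesis using b[OF nz(2)] by linarith
  qed
  then show thesis by (rule that)
qed

lemma dirichlet_line_bound:
  assumes a: "\<And>n. n > 0 \<Longrightarrow> norm (a n) \<le> K * real n powr (1/4)"
    and F: "\<And>s. Re s > 1 \<Longrightarrow> (\<lambda>n. a (Suc n) * of_nat (Suc n) powr (- s)) sums F s"
  obtains M where "\<And>s. Re s = 3/2 \<Longrightarrow> norm (F s) \<le> M"
proof -
  have summ: "summable (\<lambda>n. K * real (Suc n) powr (- (5/4)))"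
  proof -
    have "summable (\<lambda>n. real n powr (- (5/4)))" by (simp add: summable_real_powr_iff)
    then show ?thesis by (subst (asm) summable_Suc_iff[symmetric]) (rule summable_mult)
  qed
  have "norm (F s) \<le> (\<Sum>n. K * real (Suc n) powr (- (5/4)))" if s: "Re s = 3/2" for s
  proof -
    have "norm (\<Sum>n. a (Suc n) * of_nat (Suc n) powr (- s)) \<le> (\<Sum>n. K * real (Suc n) powr (- (5/4)))"
    proof (rule norm_suminf_le[OF _ summ])
      fix n
      have "norm (a (Suc n) * of_nat (Suc n) powr (- s)) = norm (a (Suc n)) * real (Suc n) powr (- (3/2))"
        using norm_powr_real_powr[of "of_nat (Suc n)" "- s"] s by (simp add: norm_mult del: of_nat_Suc)
      also have "\<dots> \<le> K * real (Suc n) powr (1/4) * real (Suc n) powr (- (3/2))"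
        by (intro mult_right_mono a) auto
      also have "\<dots> = K * real (Suc n) powr (- (5/4))"
        by (simp flip: powr_add)
      finally show "norm (a (Suc n) * of_nat (Suc n) powr (- s)) \<le> K * real (Suc n) powr (- (5/4))" .
    qed
    then show ?thesis using sums_unique[OF F[of s]] s by simp
  qed
  then show thesis by (rule that)
qed

text \<open>On \<open>Re s = -1/2\<close> the quotient of the two Gamma factors is exactly \<open>s / 2 + \<mu>\<close> in modulus, so no
  asymptotics of the Gamma function are needed.\<close>

lemma functional_equation_left_line:
  assumes fe: "functional_equation \<epsilon> Q [\<mu>] F"
    and M: "\<And>s. Re s = 3/2 \<Longrightarrow> norm (F s) \<le> M"
    and z: "Re z = -1/2" "Im (z / 2 + \<mu>) \<noteq> 0"
  shows "norm (F z) \<le> Q\<^sup>2 * norm (z / 2 + \<mu>) * M"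
proof -
  from fe have \<epsilon>: "norm \<epsilon> = 1" and Q: "Q > 0"
    by (auto simp: functional_equation_def)
  define w where "w = z / 2 + \<mu>"
  have cnj_w: "(1 - z) / 2 + cnj \<mu> = cnj (w + 1)"
    using z(1) by (simp add: w_def complex_eq_iff)
  have w: "w \<notin> \<int>\<^sub>\<le>\<^sub>0" "cnj (w + 1) \<notin> \<int>\<^sub>\<le>\<^sub>0"
    using z(2) by (auto intro!: Im_nonzero_not_nonpos_Ints simp: w_def)
  have w2: "(1 - z) / 2 + cnj \<mu> \<notin> \<int>\<^sub>\<le>\<^sub>0" unfolding cnj_w by (rule w(2))
  have "z \<noteq> 0" "z \<noteq> 1" using z(1) by auto
  then have "\<epsilon>\<^sup>2 * of_real Q powr z * Gamma (z / 2 + \<mu>) * F z =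
      of_real Q powr (1 - z) * Gamma ((1 - z) / 2 + cnj \<mu>) * cnj (F (cnj (1 - z)))"
    using fe w(1) w2 unfolding w_def functional_equation_def by auto
  then have "\<epsilon>\<^sup>2 * of_real Q powr z * Gamma w * F z = of_real Q powr (1 - z) * Gamma (cnj (w + 1)) * cnj (F (cnj (1 - z)))"
    unfolding cnj_w w_def[symmetric] .
  then have "norm (\<epsilon>\<^sup>2 * of_real Q powr z * Gamma w * F z) = norm (of_real Q powr (1 - z) * Gamma (cnj (w + 1)) * cnj (F (cnj (1 - z))))"
    by simp
  moreover have "norm (of_real Q powr z) = Q powr (-1/2)" "norm (of_real Q powr (1 - z)) = Q powr (3/2)"
    using Q z(1) by (simp_all add: norm_powr_real_powr)
  moreover have "norm (Gamma (cnj (w + 1))) = norm w * norm (Gamma w)"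
    unfolding cnj_Gamma[symmetric] complex_mod_cnj Gamma_plus1[OF w(1)] by (rule norm_mult)
  ultimately have "(Q powr (-1/2) * norm (Gamma w)) * norm (F z) = (Q powr (-1/2) * norm (Gamma w)) * (Q\<^sup>2 * norm w * norm (F (cnj (1 - z))))"
    using \<epsilon> Q powr_add[of Q "-1/2" 2] by (simp add: norm_mult norm_power mult_ac)
  moreover have "Gamma w \<noteq> 0" using w(1) by (simp add: Gamma_eq_zero_iff)
  ultimately have "norm (F z) = Q\<^sup>2 * norm w * norm (F (cnj (1 - z)))" using Q by simp
  also have "\<dots> \<le> Q\<^sup>2 * norm w * M" using z(1) by (intro mult_left_mono M) auto
  finally show ?thesis by (simp add: w_def)
qed

text \<open>Dividing \<open>g\<close> by \<open>(z + 2) ^ Suc m\<close> makes it bounded on both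
  edges: \<open>m\<close> powers offset \<open>(z - 1) ^ m\<close>, and one more offsets the linear
  factor of \<open>functional_equation_left_line\<close>. The zero -2 of the divisor lies outside
  the strip. The maximum principle then bounds the quotient inside.\<close>

lemma strip_growth:
  assumes fe: "functional_equation \<epsilon> Q [\<mu>] F"
    and M: "\<And>s. Re s = 3/2 \<Longrightarrow> norm (F s) \<le> M"
    and g: "entire_of_finite_order g" "\<And>s. s \<noteq> 1 \<Longrightarrow> g s = (s - 1) ^ m * F s"
  obtains C where "\<And>s. -1/2 \<le> Re s \<Longrightarrow> Re s \<le> 3/2 \<Longrightarrow> 1 \<le> \<bar>Im s\<bar> \<Longrightarrow> norm (F s) \<le> C * (1 + \<bar>Im s\<bar>) ^ Suc m"
proof -
  have holo: "g holomorphic_on UNIV" using g(1) by (simp add: entire_of_finite_order_def)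
  define f where "f z = g z / (z + 2) ^ Suc m" for z
  have n2: "norm (z + 2) \<ge> 1" "norm (z - 1) \<le> norm (z + 2)" "norm z \<le> norm (z + 2)" if "-1/2 \<le> Re z" for z
  proof -
    show "norm (z + 2) \<ge> 1" using that abs_Re_le_cmod[of "z + 2"] by simp
    have "(Re z - 1)\<^sup>2 \<le> (Re z + 2)\<^sup>2" "(Re z)\<^sup>2 \<le> (Re z + 2)\<^sup>2" using that by (simp_all add: power2_eq_square algebra_simps)
    then show "norm (z - 1) \<le> norm (z + 2)" "norm z \<le> norm (z + 2)" by (simp_all add: cmod_def)
  qed
  have M0: "M \<ge> 0" using M[of "3/2"] by (auto intro: order_trans[OF norm_ge_zero])
  obtain B where B: "\<And>z. -1/2 \<le> Re z \<Longrightarrow> Re z \<le> 3/2 \<Longrightarrow> norm (g z) \<le> B * exp (exp \<bar>Im z\<bar>)"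
    using finite_order_strip_bound[OF g(1)] by blast
  have f_le_g: "norm (f z) \<le> norm (g z)" if "-1/2 \<le> Re z" for z
  proof -
    have "1 \<le> norm (z + 2) ^ Suc m" using n2(1)[OF that] by (rule one_le_power)
    then show ?thesis unfolding f_def norm_divide norm_power
      by (intro divide_le_eq[THEN iffD2]) (auto intro!: mult_left_le simp: mult_le_cancel_left1)
  qed
  have f_le: "norm (f z) \<le> K" if "-1/2 \<le> Re z" "z \<noteq> 1" "norm (F z) \<le> K * norm (z + 2)" for z K
  proof -
    have pos: "norm (z + 2) > 0" using n2(1)[OF that(1)] by linarith
    have "norm (g z) \<le> norm (z + 2) ^ m * (K * norm (z + 2))"
      unfolding g(2)[OF that(2)] norm_mult norm_power using n2[OF that(1)] that(3)
      by (intro mult_mono power_mono) auto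
    then show ?thesis unfolding f_def norm_divide norm_power using pos by (simp add: divide_le_eq mult_ac)
  qed
  \<comment> \<open>Above this height \<open>z / 2 + \<mu>\<close> has nonzero imaginary part, as
    the estimate on the left edge requires; the part of that edge below it is compact.\<close>
  define T1 where "T1 = 1 + 2 * \<bar>Im \<mu>\<bar>"
  let ?K = "cbox (Complex (-1/2) (-T1)) (Complex (-1/2) T1)"
  have cpt: "compact (g ` ?K)"
    by (intro compact_continuous_image holomorphic_on_imp_continuous_on compact_cbox holomorphic_on_subset[OF holo]) simp
  obtain M1 where "\<And>x. x \<in> g ` ?K \<Longrightarrow> norm x \<le> M1"
    using compact_imp_bounded[OF cpt] unfolding bounded_iff by blast
  then have M1: "\<And>z. z \<in> ?K \<Longrightarrow> norm (g z) \<le> M1" by blast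
  define M2 where "M2 = max M1 (max M (Q\<^sup>2 * (1 + norm \<mu>) * M))"
  have right: "norm (f z) \<le> M2" if z: "Re z = 3/2" for z
  proof -
    have "norm (F z) \<le> M * norm (z + 2)"
      using M[OF z] n2(1)[of z] z mult_left_mono[of 1 "norm (z + 2)" M] M0 by simp
    moreover have "z \<noteq> 1" "-1/2 \<le> Re z" using z by auto
    ultimately have "norm (f z) \<le> M" by (intro f_le)
    then show ?thesis by (simp add: M2_def)
  qed
  have left: "norm (f z) \<le> M2" if z: "Re z = -1/2" for z
  proof (cases "\<bar>Im z\<bar> \<le> T1")
    case True
    then have "norm (g z) \<le> M1" using z by (intro M1) (auto simp: in_cbox_complex_iff abs_le_iff)
    then show ?thesis using f_le_g[of z] z by (simp add: M2_def)
  next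
    case False
    then have "Im (z / 2 + \<mu>) \<noteq> 0" by (auto simp: T1_def)
    from functional_equation_left_line[OF fe M z this]
    have "norm (F z) \<le> Q\<^sup>2 * norm (z / 2 + \<mu>) * M" .
    also have "\<dots> \<le> Q\<^sup>2 * ((1 + norm \<mu>) * norm (z + 2)) * M"
    proof (intro mult_right_mono mult_left_mono M0)
      have "norm (z / 2 + \<mu>) \<le> norm (z / 2) + norm \<mu> * 1" using norm_triangle_ineq[of "z / 2" \<mu>] by simp
      also have "\<dots> \<le> norm (z + 2) + norm \<mu> * norm (z + 2)"
        using n2[of z] z by (intro add_mono mult_left_mono) (auto simp: norm_divide)
      finally show "norm (z / 2 + \<mu>) \<le> (1 + norm \<mu>) * norm (z + 2)" by (simp add: algebra_simps)
    qed auto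
    finally have "norm (F z) \<le> (Q\<^sup>2 * (1 + norm \<mu>) * M) * norm (z + 2)" by (simp add: mult_ac)
    moreover have "z \<noteq> 1" "-1/2 \<le> Re z" using z by auto
    ultimately have "norm (f z) \<le> Q\<^sup>2 * (1 + norm \<mu>) * M" by (intro f_le)
    then show ?thesis by (simp add: M2_def)
  qed
  have strip: "norm (f z) \<le> M2" if "-1/2 \<le> Re z" "Re z \<le> 3/2" for z
  proof (rule phragmen_lindelof_strip[of f B])
    have "z + 2 \<noteq> 0" if "-1/2 \<le> Re z" for z using n2(1)[OF that] by auto
    then show "f holomorphic_on {z. -1/2 \<le> Re z \<and> Re z \<le> 3/2}"
      unfolding f_def by (intro holomorphic_intros holomorphic_on_subset[OF holo]) auto
    show "norm (f z) \<le> B * exp (exp \<bar>Im z\<bar>)" if "-1/2 \<le> Re z" "Re z \<le> 3/2" for z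
      using f_le_g[OF that(1)] B[OF that] by linarith
  qed (use left right that in auto)
  have M20: "M2 \<ge> 0" using M0 by (simp add: M2_def)
  have "norm (F s) \<le> M2 * 4 ^ Suc m * (1 + \<bar>Im s\<bar>) ^ Suc m" if s: "-1/2 \<le> Re s" "Re s \<le> 3/2" "1 \<le> \<bar>Im s\<bar>" for s
  proof -
    have s1: "norm (s - 1) \<ge> 1" using s(3) abs_Im_le_cmod[of "s - 1"] by simp
    have pos: "norm (s + 2) ^ Suc m > 0" using n2(1)[OF s(1)] by (intro zero_less_power) linarith
    have "s \<noteq> 1" using s(3) by auto
    have "norm (F s) \<le> norm (s - 1) ^ m * norm (F s)"
      using one_le_power[OF s1, of m] mult_right_mono[of 1 "norm (s - 1) ^ m" "norm (F s)"] by simp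
    also have "\<dots> = norm (g s)" unfolding g(2)[OF \<open>s \<noteq> 1\<close>] by (simp add: norm_mult norm_power)
    also have "\<dots> = norm (f s) * norm (s + 2) ^ Suc m"
      using pos by (simp only: f_def norm_divide norm_power times_divide_eq_left nonzero_mult_div_cancel_right[OF less_imp_neq[symmetric]])
    also have "\<dots> \<le> M2 * (4 * (1 + \<bar>Im s\<bar>)) ^ Suc m"
    proof (intro mult_mono power_mono)
      show "norm (s + 2) \<le> 4 * (1 + \<bar>Im s\<bar>)" using cmod_le[of "s + 2"] s by simp
    qed (use strip[OF s(1,2)] M20 in auto)
    also have "\<dots> = M2 * 4 ^ Suc m * (1 + \<bar>Im s\<bar>) ^ Suc m" by (simp only: power_mult_distrib mult.assoc)
    finally show ?thesis .
  qed
  then show thesis by (rule that)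
qed

section \<open>Translation, the character, and the conclusion\<close>

lemma nicely_meromorphic_translate:
  assumes "F nicely_meromorphic_on UNIV"
  shows "(\<lambda>s. F (s + c)) nicely_meromorphic_on UNIV"
  unfolding nicely_meromorphic_on_def
proof
  have F: "F meromorphic_on UNIV" and lim: "\<And>z. (is_pole F z \<and> F z = 0) \<or> F \<midarrow>z\<rightarrow> F z"
    using assms by (auto simp: nicely_meromorphic_on_def)
  show "(\<lambda>s. F (s + c)) meromorphic_on UNIV"
    by (rule meromorphic_on_compose[OF F]) (auto intro!: analytic_intros)
  have flt: "filtermap (\<lambda>s. s + c) (at z) = at (z + c)" for z
    using filtermap_at_shift[of "- c" z] by simp
  show "\<forall>z\<in>UNIV. (is_pole (\<lambda>s. F (s + c)) z \<and> F (z + c) = 0) \<or> (\<lambda>s. F (s + c)) \<midarrow>z\<rightarrow> F (z + c)"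
  proof
    fix z
    show "(is_pole (\<lambda>s. F (s + c)) z \<and> F (z + c) = 0) \<or> (\<lambda>s. F (s + c)) \<midarrow>z\<rightarrow> F (z + c)"
      using lim[of "z + c"] unfolding is_pole_def flt[symmetric] filterlim_filtermap .
  qed
qed

text \<open>Dirichlet coefficients start at 1, so \<open>A 0\<close> is arbitrary and the residue 0
  must receive the value \<open>A q\<close>. With this value the sum over \<open>1, ..., q\<close>
  becomes the sum over \<open>0, ..., q - 1\<close>.\<close>

lemma primitive_character_of_coefficients:
  fixes A :: "nat \<Rightarrow> complex"
  assumes q: "q > 0" and per: "\<And>n. n > 0 \<Longrightarrow> A (n + q) = A n" and A1: "A 1 = 1"
    and mult: "\<And>m n. m > 0 \<Longrightarrow> n > 0 \<Longrightarrow> coprime m n \<Longrightarrow> A (m * n) = A m * A n"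
    and dual: "\<And>m. m > 0 \<Longrightarrow> A m = \<kappa> * cnj (\<Sum>r<q. A (Suc r) * unity_root q (Suc r * m))"
    and nonvanishing: "\<And>p z. prime p \<Longrightarrow> norm z \<le> 1 / sqrt (real p) \<Longrightarrow> \<not> (\<lambda>k. A (p ^ k) * z ^ k) sums 0"
  shows "primitive_character q (\<lambda>n. A (if n = 0 then q else n))"
proof -
  define chi where "chi n = A (if n = 0 then q else n)" for n
  interpret periodic_multiplicative q chi
  proof
    show "chi (n + q) = chi n" for n using q per[of n] by (simp add: chi_def)
    show "chi (m * n) = chi m * chi n" if "coprime m n" for m n
      using that mult[of m n] A1 by (auto simp: chi_def)
  qed (use q A1 in \<open>auto simp: chi_def\<close>)
  have shift: "(\<Sum>r<q. A (Suc r) * unity_root q (Suc r * m)) = (\<Sum>r<q. chi r * unity_root q (r * m))" for m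
  proof -
    define \<phi> where "\<phi> r = chi r * unity_root q (r * m)" for r
    have "(\<Sum>r<Suc q. \<phi> r) = \<phi> 0 + (\<Sum>r<q. \<phi> (Suc r))" by (rule sum.lessThan_Suc_shift)
    moreover have "\<phi> q = \<phi> 0"
      using q by (simp add: \<phi>_def chi_def unity_root_power)
    ultimately have "(\<Sum>r<q. \<phi> (Suc r)) = (\<Sum>r<q. \<phi> r)" by simp
    then show ?thesis by (simp add: \<phi>_def chi_def)
  qed
  have "chi m = \<kappa> * cnj (\<Sum>r<q. chi r * unity_root q (r * m))" for m
  proof (cases "m = 0")
    case True
    have "unity_root q (r * q) = unity_root q (r * 0)" for r
      using q by (intro unity_root_cong) (auto simp: cong_def)
    then have "(\<Sum>r<q. chi r * unity_root q (r * q)) = (\<Sum>r<q. chi r * unity_root q (r * 0))" by (simp only:)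
    moreover have "chi m = A q" using True by (simp add: chi_def)
    ultimately show ?thesis using dual[OF q] shift[of q] True by (simp only:)
  next
    case False
    then show ?thesis using dual[of m] unfolding shift by (simp add: chi_def)
  qed
  then have "primitive_character q chi"
  proof (rule primitive_of_self_dual)
    fix p :: nat and z :: complex assume p: "prime p" "norm z \<le> 1 / sqrt (real p)"
    have "chi (p ^ k) = A (p ^ k)" for k using p(1) by (auto simp: chi_def)
    then show "\<not> (\<lambda>k. chi (p ^ k) * z ^ k) sums 0" using nonvanishing[OF p] by (simp only: not_False_eq_True)
  qed
  then show ?thesis by (simp add: chi_def[abs_def])
qed

theorem theorem5p1:
  fixes F :: "complex \<Rightarrow> complex" and \<epsilon> \<mu> :: complex and Q :: real
  assumes "F \<in> S_star 1"
    and "functional_equation \<epsilon> Q [\<mu>] F"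
  shows "\<exists>q::nat. q > 0 \<and> real q = pi * Q\<^sup>2 \<and>
           (\<exists>chi (\<alpha>::real). primitive_character q chi \<and>
              (\<forall>s. F s = dirichlet_L chi (s + \<i> * of_real \<alpha>)))"
proof -
  from assms(1) obtain a m g b \<theta> where F: "continues_dirichlet_series F a"
    and g: "entire_of_finite_order g" "\<forall>s. s \<noteq> 1 \<longrightarrow> g s = (s - 1) ^ m * F s"
    and a: "\<forall>\<delta>>0::real. (\<lambda>n. norm (a n)) \<in> O(\<lambda>n. real n powr \<delta>)" and a1: "a 1 = 1"
    and b: "\<forall>n. b n \<noteq> 0 \<longrightarrow> primepow n"
    and \<theta>: "\<theta> < 1/2" "(\<lambda>n. norm (b n)) \<in> O(\<lambda>n. real n powr \<theta>)"
    and log: "\<forall>s. Re s > 1 \<longrightarrow> (\<exists>l. (\<lambda>n. b (Suc n) * of_nat (Suc n) powr (- s)) sums l \<and> exp l = F s)"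
    unfolding S_star_def by (elim CollectE exE conjE) (rule that)
  note g = g(1) g(2)[rule_format] and b = b[rule_format] and log = log[rule_format]
  have F_sums: "(\<lambda>n. a (Suc n) * of_nat (Suc n) powr (- s)) sums F s" if "Re s > 1" for s
    using F that by (simp add: continues_dirichlet_series_def)
  \<comment> \<open>The exponent 1/4 is below 1/2, as absolute convergence on
    \<open>Re s = 3/2\<close> and the zero-free disc of the Euler factors both require.\<close>
  obtain Ka where Ka: "\<And>n. n > 0 \<Longrightarrow> norm (a n) \<le> Ka * real n powr (1/4)"
    using bigo_powr_bound[OF a[rule_format, of "1/4"]] by auto
  obtain Kb where Kb: "Kb > 0" "\<And>n. n > 0 \<Longrightarrow> norm (b n) \<le> Kb * real n powr \<theta>"
    using bigo_powr_bound[OF \<theta>(2)] by auto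
  have Ka0: "Ka \<ge> 0" using Ka[of 1] by (auto intro: order_trans[OF norm_ge_zero])
  have pw: "K * real n powr x \<le> K * real n powr y" if "n > 0" "x \<le> y" "K \<ge> 0" for n x y and K :: real
    using that by (intro mult_left_mono powr_mono) auto
  have rec: "of_real (ln (real n)) * a n = (\<Sum>d | d dvd n. of_real (ln (real d)) * b d * a (n div d))" if "n > 0" for n
  proof (rule log_recurrence[where F = F and Ka = Ka and Kb = Kb])
    show "norm (a n) \<le> Ka * real n powr (1/2)" if "n > 0" for n
      using Ka[OF that] pw[OF that, of "1/4" "1/2" Ka] Ka0 by linarith
    show "norm (b n) \<le> Kb * real n powr (1/2)" if "n > 0" for n
      using Kb(2)[OF that] pw[OF that, of \<theta> "1/2" Kb] Kb(1) \<theta>(1) by linarith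
  qed (use F_sums log that in auto)
  have amult: "a (m * n) = a m * a n" if "m > 0" "n > 0" "coprime m n" for m n
    using multiplicative_of_log_recurrence[OF rec b a1 that] .
  \<comment> \<open>With \<open>s - i \<beta>\<close> in place of \<open>s\<close>, the argument
    \<open>s / 2 + \<mu>\<close> becomes \<open>s / 2 + Re \<mu>\<close>.\<close>
  define \<beta> where "\<beta> = 2 * Im \<mu>"
  define G where "G s = F (s - \<i> * of_real \<beta>)" for s
  \<comment> \<open>Translation twists the coefficients by \<open>w\<close>, which is completely
    multiplicative and unimodular; multiplicativity, coefficient bounds and zero-free discs
    therefore carry over.\<close>
  define w where "w n = of_nat n powr (\<i> * of_real \<beta>)" for n
  define A where "A n = a n * w n" for n
  have norm_w: "norm (w n) = 1" if "n > 0" for n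
    using that by (simp add: w_def norm_powr_real_powr)
  have w_mult: "w (m * n) = w m * w n" for m n
    using powr_times_real[of "of_nat m" "of_nat n" "\<i> * of_real \<beta>"] by (simp add: w_def)
  have norm_A: "norm (A n) = norm (a n)" if "n > 0" for n
    using norm_w[OF that] by (simp add: A_def norm_mult)
  have A1: "A 1 = 1" using a1 by (simp add: A_def w_def)
  have A_mult: "A (m * n) = A m * A n" if "m > 0" "n > 0" "coprime m n" for m n
    using amult[OF that] by (simp add: A_def w_mult)
  have A_nonvanishing: "\<not> (\<lambda>k. A (p ^ k) * z ^ k) sums 0" if p: "prime p" "norm z \<le> 1 / sqrt (real p)" for p z
  proof
    assume s0: "(\<lambda>k. A (p ^ k) * z ^ k) sums 0"
    have p0: "p > 0" using p(1) by (rule prime_gt_0_nat)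
    have "w (p ^ k) = w p ^ k" for k
      by (induction k) (simp_all add: w_mult, simp add: w_def)
    then have "(\<lambda>k. a (p ^ k) * (w p * z) ^ k) sums 0"
      using s0 by (simp add: A_def power_mult_distrib mult_ac)
    moreover have "norm (w p * z) \<le> 1 / sqrt (real p)" using p norm_w[OF p0] by (simp add: norm_mult)
    \<comment> \<open>\<open>local_factor_nonzero\<close> wants one exponent below 1/2 for both
      coefficient sequences, and \<open>\<theta>\<close> itself may be too small for
      \<open>a\<close>.\<close>
    moreover have "norm (a n) \<le> Ka * real n powr (max \<theta> (1/4))" if "n > 0" for n
      using Ka[OF that] pw[OF that, of "1/4" "max \<theta> (1/4)" Ka] Ka0 by linarith
    moreover have "norm (b n) \<le> Kb * real n powr (max \<theta> (1/4))" if "n > 0" for n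
      using Kb(2)[OF that] pw[OF that, of \<theta> "max \<theta> (1/4)" Kb] Kb(1) by linarith
    ultimately show False
      using local_factor_nonzero[OF rec a1 p(1), of "max \<theta> (1/4)" Ka Kb "w p * z"] \<theta>(1) by simp
  qed
  obtain M where M: "\<And>s. Re s = 3/2 \<Longrightarrow> norm (F s) \<le> M"
    using dirichlet_line_bound[OF Ka F_sums] by blast
  obtain C where C: "\<And>s. -1/2 \<le> Re s \<Longrightarrow> Re s \<le> 3/2 \<Longrightarrow> 1 \<le> \<bar>Im s\<bar> \<Longrightarrow> norm (F s) \<le> C * (1 + \<bar>Im s\<bar>) ^ Suc m"
    using strip_growth[OF assms(2) M g] by blast
  have C0: "C \<ge> 0"
  proof -
    have "0 \<le> C * (1 + \<bar>Im (Complex 0 1)\<bar>) ^ Suc m" by (rule order_trans[OF norm_ge_zero C]) auto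
    moreover have "(1 + \<bar>Im (Complex 0 1)\<bar>) ^ Suc m > 0" by simp
    ultimately show ?thesis using zero_le_mult_iff by (metis not_less)
  qed
  have F_holo: "F holomorphic_on - {1}"
  proof -
    have "(\<lambda>s. g s / (s - 1) ^ m) holomorphic_on - {1}"
      using g(1) by (intro holomorphic_intros) (auto simp: entire_of_finite_order_def intro: holomorphic_on_subset)
    then show ?thesis by (rule holomorphic_transform) (simp add: g(2))
  qed
  define s0 where "s0 = 1 + \<i> * of_real \<beta>"
  \<comment> \<open>Exceeds \<open>\<bar>Im s0\<bar> = \<bar>\<beta>\<bar>\<close> by 1, so that
    height \<open>T0\<close> for \<open>G\<close> means height at least 1 for \<open>F\<close>,
    where \<open>strip_growth\<close> applies.\<close>
  define T0 where "T0 = 1 + \<bar>\<beta>\<bar>"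
  have Qpos: "Q > 0" and \<epsilon>: "norm \<epsilon> = 1" and \<mu>: "Re \<mu> \<ge> 0"
    using assms(2) by (auto simp: functional_equation_def)
  have feq: "\<epsilon>\<^sup>2 * of_real Q powr s * Gamma (s / 2 + \<mu>) * F s =
      of_real Q powr (1 - s) * Gamma ((1 - s) / 2 + cnj \<mu>) * cnj (F (cnj (1 - s)))"
    if "s \<noteq> 0" "s \<noteq> 1" "s / 2 + \<mu> \<notin> \<int>\<^sub>\<le>\<^sub>0" "(1 - s) / 2 + cnj \<mu> \<notin> \<int>\<^sub>\<le>\<^sub>0" for s
    using assms(2) that by (auto simp: functional_equation_def)
  \<comment> \<open>The translation multiplies \<open>Q powr s\<close> on the left by
    \<open>Q powr (- i \<beta>)\<close> and \<open>Q powr (1 - s)\<close> on the right by its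
    inverse; \<open>\<omega>\<close> collects both.\<close>
  define \<omega> where "\<omega> = \<epsilon>\<^sup>2 * of_real Q powr (- 2 * \<i> * of_real \<beta>)"
  have G_sums: "(\<lambda>n. A (Suc n) * of_nat (Suc n) powr (- s)) sums G s" if "Re s > 1" for s
  proof -
    have "(\<lambda>n. a (Suc n) * of_nat (Suc n) powr (- (s - \<i> * of_real \<beta>))) sums G s"
      unfolding G_def by (rule F_sums) (use that in simp)
    moreover have "of_nat (Suc n) powr (- (s - \<i> * of_real \<beta>)) = w (Suc n) * of_nat (Suc n) powr (- s)" for n
      unfolding w_def by (simp flip: powr_add)
    ultimately show ?thesis by (simp only: A_def mult.assoc)
  qed
  interpret degree_one G A "Re \<mu>" Q T0 Ka "C * (1 + \<bar>\<beta>\<bar>) ^ Suc m" \<omega> s0 "Suc m"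
  proof
    show "Q > 0" "Re \<mu> \<ge> 0" by fact+
    show "\<omega> \<noteq> 0" using \<epsilon> Qpos by (auto simp: \<omega>_def)
    show "T0 > 0" by (simp add: T0_def add_pos_nonneg)
    show "(\<lambda>n. A (Suc n) * of_nat (Suc n) powr (- s)) sums G s" if "Re s > 1" for s by (rule G_sums[OF that])
    show "norm (A n) \<le> Ka * real n powr (1/4)" if "n > 0" for n using Ka[OF that] norm_A[OF that] by simp
    show "A 1 = 1" by (rule A1)
    have "(\<lambda>s. F (s - \<i> * of_real \<beta>)) holomorphic_on - {s0}"
      by (rule holomorphic_on_compose_gen[OF _ F_holo, of "\<lambda>s. s - \<i> * of_real \<beta>" "- {s0}", unfolded o_def])
        (auto intro!: holomorphic_intros simp: s0_def algebra_simps)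
    then show "G holomorphic_on - {s0}" by (simp add: G_def[abs_def])
    show "Re s0 = 1" "\<bar>Im s0\<bar> < T0" by (auto simp: s0_def T0_def)
    show "norm (G s) \<le> C * (1 + \<bar>\<beta>\<bar>) ^ Suc m * (1 + \<bar>Im s\<bar>) ^ Suc m"
      if s: "-1/2 \<le> Re s" "Re s \<le> 3/2" "T0 \<le> \<bar>Im s\<bar>" for s
    proof -
      define z where "z = s - \<i> * of_real \<beta>"
      have z: "Re z = Re s" "Im z = Im s - \<beta>" by (simp_all add: z_def)
      have "norm (F z) \<le> C * (1 + \<bar>Im z\<bar>) ^ Suc m"
        by (rule C) (use s in \<open>auto simp: z T0_def\<close>)
      also have "\<dots> \<le> C * ((1 + \<bar>\<beta>\<bar>) * (1 + \<bar>Im s\<bar>)) ^ Suc m"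
      proof (intro mult_left_mono power_mono C0)
        have "0 \<le> \<bar>\<beta>\<bar> * \<bar>Im s\<bar>" by simp
        moreover have "(1 + \<bar>\<beta>\<bar>) * (1 + \<bar>Im s\<bar>) = 1 + \<bar>Im s\<bar> + \<bar>\<beta>\<bar> + \<bar>\<beta>\<bar> * \<bar>Im s\<bar>" by (simp add: algebra_simps)
        ultimately show "1 + \<bar>Im z\<bar> \<le> (1 + \<bar>\<beta>\<bar>) * (1 + \<bar>Im s\<bar>)" unfolding z by linarith
      qed auto
      finally show ?thesis by (simp only: G_def z_def power_mult_distrib mult.assoc)
    qed
    show "\<omega> * of_real Q powr s * Gamma (s / 2 + of_real (Re \<mu>)) * G s =
       of_real Q powr (1 - s) * Gamma ((1 - s) / 2 + of_real (Re \<mu>)) * cnj (G (cnj (1 - s)))"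
      if s: "T0 \<le> \<bar>Im s\<bar>" for s
    proof -
      define z where "z = s - \<i> * of_real \<beta>"
      have Im: "Im s \<noteq> 0" "Im z \<noteq> 0" using s by (auto simp: z_def T0_def)
      have e1: "z / 2 + \<mu> = s / 2 + of_real (Re \<mu>)"
        and e2: "(1 - z) / 2 + cnj \<mu> = (1 - s) / 2 + of_real (Re \<mu>)"
        by (simp_all add: complex_eq_iff z_def \<beta>_def field_simps)
      have e3: "cnj (1 - z) = cnj (1 - s) - \<i> * of_real \<beta>" by (simp add: z_def)
      have np: "s / 2 + of_real (Re \<mu>) \<notin> \<int>\<^sub>\<le>\<^sub>0" "(1 - s) / 2 + of_real (Re \<mu>) \<notin> \<int>\<^sub>\<le>\<^sub>0"
        using Im by (auto intro!: Im_nonzero_not_nonpos_Ints)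
      have z01: "z \<noteq> 0" "z \<noteq> 1" using Im by auto
      have "\<epsilon>\<^sup>2 * of_real Q powr z * Gamma (z / 2 + \<mu>) * F z =
          of_real Q powr (1 - z) * Gamma ((1 - z) / 2 + cnj \<mu>) * cnj (F (cnj (1 - z)))"
        unfolding e1 e2 by (rule feq[OF z01, unfolded e1 e2, OF np])
      then have fe: "\<epsilon>\<^sup>2 * of_real Q powr z * Gamma (s / 2 + of_real (Re \<mu>)) * G s =
          of_real Q powr (1 - z) * Gamma ((1 - s) / 2 + of_real (Re \<mu>)) * cnj (G (cnj (1 - s)))"
        unfolding e1 e2 e3 by (simp only: G_def z_def)
      have q1: "of_real Q powr (- 2 * \<i> * of_real \<beta>) * of_real Q powr s = of_real Q powr (- \<i> * of_real \<beta>) * of_real Q powr z"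
        and q2: "of_real Q powr (1 - s) = of_real Q powr (- \<i> * of_real \<beta>) * of_real Q powr (1 - z)"
        by (simp_all add: z_def powr_add[symmetric] mult.assoc)
      have "\<omega> * of_real Q powr s * Gamma (s / 2 + of_real (Re \<mu>)) * G s =
          (of_real Q powr (- 2 * \<i> * of_real \<beta>) * of_real Q powr s) * (\<epsilon>\<^sup>2 * Gamma (s / 2 + of_real (Re \<mu>)) * G s)"
        unfolding \<omega>_def by (simp only: mult_ac)
      also have "\<dots> = of_real Q powr (- \<i> * of_real \<beta>) * (\<epsilon>\<^sup>2 * of_real Q powr z * Gamma (s / 2 + of_real (Re \<mu>)) * G s)"
        unfolding q1 by (simp only: mult_ac)
      also have "\<dots> = of_real Q powr (1 - s) * Gamma ((1 - s) / 2 + of_real (Re \<mu>)) * cnj (G (cnj (1 - s)))"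
        unfolding fe q2 by (simp only: mult_ac)
      finally show ?thesis .
    qed
  qed
  obtain q where q: "q > 0" "real q = pi * Q\<^sup>2" "\<And>n. n > 0 \<Longrightarrow> A (n + q) = A n"
    using conductor by blast
  obtain \<kappa> where \<kappa>: "\<And>m. m > 0 \<Longrightarrow> A m = \<kappa> * cnj (\<Sum>r<q. A (Suc r) * unity_root q (Suc r * m))"
    using fourier_self_dual[OF q] by blast
  define chi where "chi = (\<lambda>n. A (if n = 0 then q else n))"
  have prim: "primitive_character q chi"
    unfolding chi_def by (rule primitive_character_of_coefficients[OF q(1,3) A1 A_mult \<kappa> A_nonvanishing])
  have "continues_dirichlet_series G chi"
    unfolding continues_dirichlet_series_def
  proof (intro conjI allI impI)
    have "F nicely_meromorphic_on UNIV" using F by (simp add: continues_dirichlet_series_def)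
    from nicely_meromorphic_translate[OF this, of "- \<i> * of_real \<beta>"]
    show "G nicely_meromorphic_on UNIV" by (simp add: G_def[abs_def])
    show "(\<lambda>n. chi (Suc n) * of_nat (Suc n) powr (- s)) sums G s" if "Re s > 1" for s
      using G_sums[OF that] by (simp add: chi_def)
  qed
  then have "dirichlet_L chi = G"
    unfolding dirichlet_L_def using continues_dirichlet_series_unique by blast
  then have "F s = dirichlet_L chi (s + \<i> * of_real \<beta>)" for s by (simp add: G_def)
  then show ?thesis using q(1,2) prim by blast
qed

end
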